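(* Let $J$ be the Jacobi operator in $\ell^2(\mathbb Z_+)$ with coefficients $a_n=\sqrt{(n+1)/2}$, $b_n=0$. For $g\in C_0^\infty(\mathbb R)$ let $$(U(t)g)_n=i^{\mp n}(2n+1)^{-1/4}\,\hat g\big(t\mp\sqrt{2n+1}\big),\qquad \pm t>0,\ n\in\mathbb Z_+ .$$ Suppose that $\Phi f\in C_0^\infty(\mathbb R)$. Then $$\lim_{t\to\pm\infty}\big\|e^{-iJt}f-U(t)\Phi f\big\|=0 .$$
   Context: $\mathbb Z_+=\{0,1,2,\dots\}$; $\|\cdot\|$ is the norm of $\ell^2(\mathbb Z_+)$; $\hat g(x)=(2\pi)^{-1/2}\int_{-\infty}^\infty e^{-ix\lambda}g(\lambda)d\lambda$ is the Fourier transform. $J$ is the self-adjoint closure of the operator $(Jf)_n=a_{n-1}f_{n-1}+b_nf_n+a_nf_{n+1}$, $a_{-1}=0$, which is essentially self-adjoint on the set $\mathcal D$ of sequences with finitely many non-zero components. The orthonormal Hermite polynomials $H_n$ are defined by $a_{n-1}H_{n-1}(z)+a_nH_{n+1}(z)=zH_n(z)$, $H_{-1}=0$, $H_0=1$; they are orthonormal with respect to $\pi^{-1/2}e^{-\lambda^2}d\lambda$ on $\mathbb R$. The operator $\Phi:\ell^2(\mathbb Z_+)\to L^2(\mathbb R)$ is the unitary operator given by $(\Phi f)(\lambda)=\pi^{-1/4}\sum_{n=0}^\infty e^{-\lambda^2/2}H_n(\lambda)f_n$ for $f\in\mathcal D$ (and extended by continuity). *)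

theory Defs
  imports "HOL-Analysis.Analysis"
begin

definition ell2 :: "(nat \<Rightarrow> complex) set" where
  "ell2 = {f. summable (\<lambda>n. (cmod (f n))\<^sup>2)}"

text \<open>Only meaningful on \<^const>\<open>ell2\<close>: off it, \<^const>\<open>suminf\<close> has an unspecified value.\<close>

definition ell2_norm :: "(nat \<Rightarrow> complex) \<Rightarrow> real" where
  "ell2_norm f = sqrt (\<Sum>n. (cmod (f n))\<^sup>2)"

definition finite_seqs :: "(nat \<Rightarrow> complex) set" where
  "finite_seqs = {f. finite {n. f n \<noteq> 0}}"

text \<open>A possibly unbounded operator in \<open>\<ell>\<^sup>2\<close> is represented by its graph.\<close>

type_synonym ell2_op = "((nat \<Rightarrow> complex) \<times> (nat \<Rightarrow> complex)) set"

definition op_closure :: "ell2_op \<Rightarrow> ell2_op" where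
  "op_closure T = {(f, h). f \<in> ell2 \<and> h \<in> ell2 \<and>
     (\<exists>F G. (\<forall>k::nat. (F k, G k) \<in> T) \<and>
        (\<lambda>k. ell2_norm (\<lambda>n. F k n - f n)) \<longlonglongrightarrow> 0 \<and>
        (\<lambda>k. ell2_norm (\<lambda>n. G k n - h n)) \<longlonglongrightarrow> 0)}"

definition unitary_ell2 :: "((nat \<Rightarrow> complex) \<Rightarrow> (nat \<Rightarrow> complex)) \<Rightarrow> bool" where
  "unitary_ell2 V \<longleftrightarrow>
     (\<forall>f\<in>ell2. \<forall>g\<in>ell2. V (\<lambda>n. f n + g n) = (\<lambda>n. V f n + V g n)) \<and>
     (\<forall>c. \<forall>f\<in>ell2. V (\<lambda>n. c * f n) = (\<lambda>n. c * V f n)) \<and>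
     (\<forall>f\<in>ell2. ell2_norm (V f) = ell2_norm f) \<and>
     V ` ell2 = ell2"

definition unitary_group :: "(real \<Rightarrow> (nat \<Rightarrow> complex) \<Rightarrow> (nat \<Rightarrow> complex)) \<Rightarrow> bool" where
  "unitary_group V \<longleftrightarrow>
     (\<forall>t. unitary_ell2 (V t)) \<and>
     (\<forall>f\<in>ell2. V 0 f = f) \<and>
     (\<forall>s t. \<forall>f\<in>ell2. V (s + t) f = V s (V t f)) \<and>
     (\<forall>f\<in>ell2. ((\<lambda>t. ell2_norm (\<lambda>n. V t f n - f n)) \<longlongrightarrow> 0) (at 0))"

text \<open>The operator \<open>A\<close> with \<open>A f = i d/dt V(t) f\<close> at \<open>t = 0\<close>, on the maximal domain where
  this strong derivative exists.\<close>

definition group_generator :: "(real \<Rightarrow> (nat \<Rightarrow> complex) \<Rightarrow> (nat \<Rightarrow> complex)) \<Rightarrow> ell2_op" where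
  "group_generator V = {(f, h). f \<in> ell2 \<and> h \<in> ell2 \<and>
     ((\<lambda>t. ell2_norm (\<lambda>n. \<i> * (V t f n - f n) / complex_of_real t - h n)) \<longlongrightarrow> 0) (at 0)}"

text \<open>For self-adjoint \<open>A\<close>, \<open>exp_group A t f\<close> is \<open>exp (-i A t) f\<close>. By Stone's theorem there is a
  strongly continuous unitary group whose generator, in the sense above, is exactly \<open>A\<close>, and it
  is unique on \<^const>\<open>ell2\<close>.\<close>

definition exp_group :: "ell2_op \<Rightarrow> real \<Rightarrow> (nat \<Rightarrow> complex) \<Rightarrow> (nat \<Rightarrow> complex)" where
  "exp_group A t f = (THE u. \<exists>V. unitary_group V \<and> group_generator V = A \<and> u = V t f)"

definition jacobi_apply ::
    "(nat \<Rightarrow> real) \<Rightarrow> (nat \<Rightarrow> real) \<Rightarrow> (nat \<Rightarrow> complex) \<Rightarrow> nat \<Rightarrow> complex" where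
  "jacobi_apply a b f n =
     (if n = 0 then 0 else complex_of_real (a (n - 1)) * f (n - 1)) +
     complex_of_real (b n) * f n + complex_of_real (a n) * f (n + 1)"

definition jacobi_op :: "(nat \<Rightarrow> real) \<Rightarrow> (nat \<Rightarrow> real) \<Rightarrow> ell2_op" where
  "jacobi_op a b = op_closure {(f, jacobi_apply a b f) | f. f \<in> finite_seqs}"

definition hermite_a :: "nat \<Rightarrow> real" where
  "hermite_a n = sqrt ((real n + 1) / 2)"

definition hermite_J :: ell2_op where
  "hermite_J = jacobi_op hermite_a (\<lambda>n. 0)"

text \<open>The recurrence \<open>a\<^bsub>n-1\<^esub> H\<^bsub>n-1\<^esub> + a\<^bsub>n\<^esub> H\<^bsub>n+1\<^esub> = z H\<^bsub>n\<^esub>\<close> solved for the term of highest index.\<close>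

fun hermite :: "nat \<Rightarrow> real \<Rightarrow> real" where
  "hermite 0 z = 1"
| "hermite (Suc 0) z = z / hermite_a 0"
| "hermite (Suc (Suc n)) z =
     (z * hermite (Suc n) z - hermite_a n * hermite n z) / hermite_a (Suc n)"

definition Phi_fin :: "(nat \<Rightarrow> complex) \<Rightarrow> real \<Rightarrow> complex" where
  "Phi_fin f x = complex_of_real (pi powr (-1/4)) *
     (\<Sum>n | f n \<noteq> 0. complex_of_real (exp (- (x\<^sup>2) / 2) * hermite n x) * f n)"

definition L2_fun :: "(real \<Rightarrow> complex) set" where
  "L2_fun = {g. g \<in> borel_measurable lborel \<and> integrable lborel (\<lambda>x. (cmod (g x))\<^sup>2)}"

definition L2_norm :: "(real \<Rightarrow> complex) \<Rightarrow> real" where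
  "L2_norm g = sqrt (\<integral>x. (cmod (g x))\<^sup>2 \<partial>lborel)"

text \<open>The extension of \<^const>\<open>Phi_fin\<close> by continuity to \<open>f \<in> ell2\<close>. The value \<open>Phi f\<close> is an element
  of \<open>L\<^sup>2(\<real>)\<close>, i.e. the class of all its almost everywhere equal representatives, so
  \<open>g \<in> Phi f\<close> says that \<open>\<Phi> f = g\<close> in \<open>L\<^sup>2(\<real>)\<close>.\<close>

definition Phi :: "(nat \<Rightarrow> complex) \<Rightarrow> (real \<Rightarrow> complex) set" where
  "Phi f = {g. g \<in> L2_fun \<and>
     (\<forall>F. (\<forall>k::nat. F k \<in> finite_seqs) \<longrightarrow>
        (\<lambda>k. ell2_norm (\<lambda>n. F k n - f n)) \<longlonglongrightarrow> 0 \<longrightarrow>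
        (\<lambda>k. L2_norm (\<lambda>x. Phi_fin (F k) x - g x)) \<longlonglongrightarrow> 0)}"

definition C0_infty :: "(real \<Rightarrow> complex) set" where
  "C0_infty = {g. compact (closure {x. g x \<noteq> 0}) \<and>
     (\<exists>D :: nat \<Rightarrow> real \<Rightarrow> complex. D 0 = g \<and>
        (\<forall>k x. (D k has_vector_derivative D (Suc k) x) (at x)))}"

definition fourier :: "(real \<Rightarrow> complex) \<Rightarrow> real \<Rightarrow> complex" where
  "fourier g x = complex_of_real ((2 * pi) powr (-1/2)) *
     (\<integral>s. exp (- (\<i> * complex_of_real (x * s))) * g s \<partial>lborel)"

text \<open>The value at \<open>t = 0\<close> is irrelevant.\<close>

definition U_asymp :: "real \<Rightarrow> (real \<Rightarrow> complex) \<Rightarrow> nat \<Rightarrow> complex" where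
  "U_asymp t g n =
     (if t > 0
      then \<i> powi (- int n) * complex_of_real ((2 * real n + 1) powr (-1/4)) *
             fourier g (t - sqrt (2 * real n + 1))
      else \<i> powi (int n) * complex_of_real ((2 * real n + 1) powr (-1/4)) *
             fourier g (t + sqrt (2 * real n + 1)))"

end

theory Submission
  imports Defs "HOL-Probability.Probability" "HOL-Real_Asymp.Real_Asymp"
begin

text \<open>\<open>\<Phi>\<close> turns the Jacobi operator into multiplication by \<open>x\<close>, so the \<open>n\<close>-th component of
  \<open>e\<^sup>-\<^sup>i\<^sup>J\<^sup>t f\<close> is the integral of \<open>e\<^sup>-\<^sup>i\<^sup>t\<^sup>x g(x)\<close> against the \<open>n\<close>-th Hermite function. With
  \<open>\<omega> = sqrt (2n + 1)\<close>, that function is a wave of frequency \<open>\<omega>\<close> and amplitude of order \<open>\<omega>\<^bsup>-1/2\<^esup>\<close>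
  up to an error \<open>O(\<omega>\<^bsup>-3/2\<^esup>)\<close>, uniformly on compact sets; inserting this gives \<open>U(t) g\<close> plus a wave
  travelling in the opposite direction, which is again \<open>O(\<omega>\<^bsup>-3/2\<^esup>)\<close> uniformly in \<open>t\<close>. The squared
  errors are thus dominated by a summable sequence, and each tends to \<open>0\<close> as \<open>t\<close> tends to
  infinity, so dominated convergence applies.

  The group \<open>e\<^sup>-\<^sup>i\<^sup>J\<^sup>t\<close> is constructed from its matrix elements between Hermite functions. Its group law,
  and its uniqueness, follow because the coordinatewise equation \<open>x' = - i J x\<close> has at most one
  bounded solution for a given initial value: the coefficients of \<open>J\<close> grow only like \<open>sqrt n\<close>.\<close>

section \<open>The space of square summable sequences\<close>

text \<open>\<open>exp_group\<close> is a definite description over all unitary groups whose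
  generator equals the closed graph \<open>hermite_J\<close>. The closure therefore has to be
  computed exactly, and the group has to be both built and shown to be unique. The closure turns out
  to be the maximal graph \<open>Jmax\<close>, in which membership can be tested coordinate by
  coordinate. Bessel's inequality for the Hermite functions makes every \<open>propagator t\<close>
  a contraction, and a one-parameter group of contractions consists of isometries. The exponents
  shape the asymptotic part. The amplitude, of order \<open>n powr (-1/4)\<close>, is not square
  summable; only the extra factor \<open>1 / freq n\<close> brings the squared errors down to order
  \<open>n powr (-3/2)\<close>. The asymptotics must therefore come with a rate, and so must the
  value or slope of \<open>psi n\<close> at the origin, which fixes the amplitude. That rate comes
  from two monotone sequences that enclose the Wallis product. The numerical constants are crude;
  what matters is that they depend neither on \<open>t\<close> nor on \<open>n\<close>.\<close>

lemma L2_set_sq: "(L2_set f A)\<^sup>2 = (\<Sum>i\<in>A. (f i)\<^sup>2)"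
  unfolding L2_set_def by (simp add: sum_nonneg)

lemma ell2I:
  assumes "\<And>N. L2_set (\<lambda>n. cmod (f n)) {..<N} \<le> B"
  shows "f \<in> ell2"
proof -
  have "(\<Sum>n<N. (cmod (f n))\<^sup>2) \<le> B\<^sup>2" for N
    using power_mono[OF assms[of N], of 2] by (simp add: L2_set_sq)
  then have "summable (\<lambda>n. (cmod (f n))\<^sup>2)"
    by (intro summableI_nonneg_bounded) auto
  then show ?thesis by (simp add: ell2_def)
qed

lemma ell2_norm_le:
  assumes "\<And>N. L2_set (\<lambda>n. cmod (f n)) {..<N} \<le> B"
  shows "ell2_norm f \<le> B"
proof -
  have B: "0 \<le> B" using assms[of 0] by simp
  have "(\<Sum>n<N. (cmod (f n))\<^sup>2) \<le> B\<^sup>2" for N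
    using power_mono[OF assms[of N], of 2] by (simp add: L2_set_sq)
  then have "(\<Sum>n. (cmod (f n))\<^sup>2) \<le> B\<^sup>2"
    using ell2I[OF assms] by (intro suminf_le_const) (auto simp: ell2_def)
  then show ?thesis
    unfolding ell2_norm_def using B real_le_lsqrt by (auto intro: real_sqrt_le_iff' real_le_lsqrt)
qed

lemma L2_set_le_ell2_norm:
  assumes "f \<in> ell2" "finite A"
  shows "L2_set (\<lambda>n. cmod (f n)) A \<le> ell2_norm f"
  unfolding L2_set_def ell2_norm_def using assms
  by (auto simp: ell2_def intro!: sum_le_suminf)

lemma ell2_norm_nonneg: "f \<in> ell2 \<Longrightarrow> 0 \<le> ell2_norm f"
  using L2_set_le_ell2_norm[of f "{}"] by simp

lemma norm_component_le_ell2_norm: "f \<in> ell2 \<Longrightarrow> cmod (f n) \<le> ell2_norm f"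
  using L2_set_le_ell2_norm[of f "{n}"] by simp

lemma ell2_sum_bound:
  assumes "f \<in> ell2" "g \<in> ell2"
  shows "L2_set (\<lambda>n. cmod (f n + g n)) {..<N} \<le> ell2_norm f + ell2_norm g"
proof -
  have "L2_set (\<lambda>n. cmod (f n + g n)) {..<N} \<le> L2_set (\<lambda>n. cmod (f n) + cmod (g n)) {..<N}"
    by (intro L2_set_mono norm_triangle_ineq) auto
  also have "\<dots> \<le> L2_set (\<lambda>n. cmod (f n)) {..<N} + L2_set (\<lambda>n. cmod (g n)) {..<N}"
    by (rule L2_set_triangle_ineq)
  also have "\<dots> \<le> ell2_norm f + ell2_norm g"
    using assms by (intro add_mono L2_set_le_ell2_norm) auto
  finally show ?thesis .
qed

lemma ell2_add: "f \<in> ell2 \<Longrightarrow> g \<in> ell2 \<Longrightarrow> (\<lambda>n. f n + g n) \<in> ell2"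
  by (rule ell2I, rule ell2_sum_bound)

lemma ell2_norm_triangle:
  "f \<in> ell2 \<Longrightarrow> g \<in> ell2 \<Longrightarrow> ell2_norm (\<lambda>n. f n + g n) \<le> ell2_norm f + ell2_norm g"
  by (rule ell2_norm_le, rule ell2_sum_bound)

lemma ell2_scale: "f \<in> ell2 \<Longrightarrow> (\<lambda>n. c * f n) \<in> ell2"
  by (auto simp: ell2_def norm_mult power_mult_distrib intro: summable_mult)

lemma ell2_norm_scale: 
  assumes "f \<in> ell2" shows "ell2_norm (\<lambda>n. c * f n) = cmod c * ell2_norm f"
proof -
  have "(\<Sum>n. (cmod (c * f n))\<^sup>2) = (cmod c)\<^sup>2 * (\<Sum>n. (cmod (f n))\<^sup>2)"
    using assms by (simp add: norm_mult power_mult_distrib ell2_def suminf_mult)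
  then show ?thesis by (simp add: ell2_norm_def real_sqrt_mult)
qed

lemma ell2_minus: "f \<in> ell2 \<Longrightarrow> g \<in> ell2 \<Longrightarrow> (\<lambda>n. f n - g n) \<in> ell2"
  using ell2_add[of f "\<lambda>n. (-1) * g n"] ell2_scale[of g "-1"] by simp

lemma ell2_norm_minus_commute: "ell2_norm (\<lambda>n. f n - g n) = ell2_norm (\<lambda>n. g n - f n)"
  by (simp add: ell2_norm_def norm_minus_commute)

lemma ell2_norm_triangle3:
  assumes "f \<in> ell2" "g \<in> ell2" "h \<in> ell2"
  shows "ell2_norm (\<lambda>n. f n - h n) \<le> ell2_norm (\<lambda>n. f n - g n) + ell2_norm (\<lambda>n. g n - h n)"
  using ell2_norm_triangle[of "\<lambda>n. f n - g n" "\<lambda>n. g n - h n"] assms by (simp add: ell2_minus)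

lemma finite_seqs_subset_ell2: "finite_seqs \<subseteq> ell2"
proof
  fix F assume "F \<in> finite_seqs"
  then have "finite {n. F n \<noteq> 0}" by (simp add: finite_seqs_def)
  then have "summable (\<lambda>n. (cmod (F n))\<^sup>2)"
    by (rule summable_finite) auto
  then show "F \<in> ell2" by (simp add: ell2_def)
qed

definition trunc :: "(nat \<Rightarrow> complex) \<Rightarrow> nat \<Rightarrow> nat \<Rightarrow> complex" where
  "trunc f N n = (if n < N then f n else 0)"

lemma trunc_finite: "trunc f N \<in> finite_seqs"
proof -
  have "{n. trunc f N n \<noteq> 0} \<subseteq> {..<N}" by (auto simp: trunc_def)
  then show ?thesis unfolding finite_seqs_def using finite_subset by auto
qed

lemma trunc_tendsto:
  assumes "f \<in> ell2"
  shows "(\<lambda>N. ell2_norm (\<lambda>n. trunc f N n - f n)) \<longlonglongrightarrow> 0"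
proof -
  have s: "summable (\<lambda>n. (cmod (f n))\<^sup>2)" using assms by (simp add: ell2_def)
  have "(\<Sum>n. (cmod (trunc f N n - f n))\<^sup>2) = (\<Sum>n. (cmod (f n))\<^sup>2) - (\<Sum>n<N. (cmod (f n))\<^sup>2)" for N
  proof -
    have "(\<lambda>n. (cmod (f n))\<^sup>2 - (if n \<in> {..<N} then (cmod (f n))\<^sup>2 else 0)) sums
      ((\<Sum>n. (cmod (f n))\<^sup>2) - (\<Sum>n<N. (cmod (f n))\<^sup>2))"
      by (intro sums_diff summable_sums s sums_If_finite_set) auto
    moreover have "(\<lambda>n. (cmod (f n))\<^sup>2 - (if n \<in> {..<N} then (cmod (f n))\<^sup>2 else 0)) =
       (\<lambda>n. (cmod (trunc f N n - f n))\<^sup>2)"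
      by (auto simp: trunc_def)
    ultimately show ?thesis by (simp add: sums_iff)
  qed
  moreover have "(\<lambda>N. (\<Sum>n. (cmod (f n))\<^sup>2) - (\<Sum>n<N. (cmod (f n))\<^sup>2)) \<longlonglongrightarrow> (\<Sum>n. (cmod (f n))\<^sup>2) - (\<Sum>n. (cmod (f n))\<^sup>2)"
    by (intro tendsto_intros summable_LIMSEQ s)
  ultimately have "(\<lambda>N. sqrt (\<Sum>n. (cmod (trunc f N n - f n))\<^sup>2)) \<longlonglongrightarrow> sqrt 0"
    by (intro tendsto_real_sqrt) simp
  then show ?thesis by (simp add: ell2_norm_def)
qed

lemma ell2_norm_trunc_le: "f \<in> ell2 \<Longrightarrow> ell2_norm (trunc f N) \<le> ell2_norm f"
  by (rule ell2_norm_le, rule order_trans[OF L2_set_mono L2_set_le_ell2_norm]) (auto simp: trunc_def)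

lemma ell2_norm_tendsto_component:
  assumes "((\<lambda>k. ell2_norm (\<lambda>n. F k n - f n)) \<longlongrightarrow> 0) G" "\<And>k. F k \<in> ell2" "f \<in> ell2"
  shows "((\<lambda>k. F k n) \<longlongrightarrow> f n) G"
  unfolding tendsto_dist_iff[of "\<lambda>k. F k n"]
proof (rule tendsto_sandwich[OF _ _ tendsto_const assms(1)])
  show "\<forall>\<^sub>F k in G. dist (F k n) (f n) \<le> ell2_norm (\<lambda>n. F k n - f n)"
    using norm_component_le_ell2_norm[OF ell2_minus[OF assms(2,3)]] by (simp add: dist_norm)
qed auto

lemma ell2_mult_summable:
  assumes "f \<in> ell2" "g \<in> ell2"
  shows "summable (\<lambda>n. f n * g n)" "cmod (\<Sum>n. f n * g n) \<le> ell2_norm f * ell2_norm g"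
proof -
  have b: "(\<Sum>n<N. cmod (f n * g n)) \<le> ell2_norm f * ell2_norm g" for N
  proof -
    have "(\<Sum>n<N. cmod (f n * g n)) \<le> L2_set (\<lambda>n. cmod (f n)) {..<N} * L2_set (\<lambda>n. cmod (g n)) {..<N}"
      using L2_set_mult_ineq[of "\<lambda>n. cmod (f n)" "\<lambda>n. cmod (g n)" "{..<N}"] by (simp add: norm_mult)
    also have "\<dots> \<le> ell2_norm f * ell2_norm g"
      using assms by (intro mult_mono L2_set_le_ell2_norm ell2_norm_nonneg) auto
    finally show ?thesis .
  qed
  have s: "summable (\<lambda>n. cmod (f n * g n))"
    by (rule summableI_nonneg_bounded[OF _ b]) auto
  then show "summable (\<lambda>n. f n * g n)" by (rule summable_norm_cancel)
  have "cmod (\<Sum>n. f n * g n) \<le> (\<Sum>n. cmod (f n * g n))"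
    using s by (rule summable_norm)
  also have "\<dots> \<le> ell2_norm f * ell2_norm g"
    by (rule suminf_le_const[OF s b])
  finally show "cmod (\<Sum>n. f n * g n) \<le> ell2_norm f * ell2_norm g" .
qed

text \<open>Pairing \<open>x s\<close> with a truncation of \<open>x t\<close> reduces this to the scalar mean value inequality.\<close>

lemma ell2_mean_value:
  fixes x x' :: "real \<Rightarrow> nat \<Rightarrow> complex"
  assumes der: "\<And>n s. ((\<lambda>s. x s n) has_vector_derivative x' s n) (at s)"
    and x0: "\<And>n. x 0 n = 0"
    and B: "\<And>s. \<bar>s\<bar> \<le> \<bar>t\<bar> \<Longrightarrow> x' s \<in> ell2 \<and> ell2_norm (x' s) \<le> B"
  shows "x t \<in> ell2 \<and> ell2_norm (x t) \<le> B * \<bar>t\<bar>"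
proof -
  have B0: "0 \<le> B" using B[of 0] ell2_norm_nonneg[of "x' 0"] by force
  have "L2_set (\<lambda>n. cmod (x t n)) {..<N} \<le> B * \<bar>t\<bar>" for N
  proof -
    define w where "w = x t"
    define p where "p s = (\<Sum>n<N. cnj (w n) * x s n)" for s
    let ?W = "L2_set (\<lambda>n. cmod (w n)) {..<N}"
    have pd: "(p has_vector_derivative (\<Sum>n<N. cnj (w n) * x' s n)) (at s)" for s
      unfolding p_def by (intro has_vector_derivative_sum has_vector_derivative_mult_right der)
    have bd: "cmod (\<Sum>n<N. cnj (w n) * x' s n) \<le> ?W * B" if "\<bar>s\<bar> \<le> \<bar>t\<bar>" for s
    proof -
      have "cmod (\<Sum>n<N. cnj (w n) * x' s n) \<le> (\<Sum>n<N. \<bar>cmod (w n)\<bar> * \<bar>cmod (x' s n)\<bar>)"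
        by (rule sum_norm_le) (simp add: norm_mult)
      also have "\<dots> \<le> ?W * L2_set (\<lambda>n. cmod (x' s n)) {..<N}"
        by (rule L2_set_mult_ineq)
      also have "\<dots> \<le> ?W * B"
        using B[OF that] L2_set_le_ell2_norm[of "x' s" "{..<N}"]
        by (intro mult_left_mono) auto
      finally show ?thesis .
    qed
    have "norm (p t - p 0) \<le> (?W * B) * norm (t - 0)"
    proof (rule differentiable_bound[of "{-\<bar>t\<bar>..\<bar>t\<bar>}" p "\<lambda>s h. h *\<^sub>R (\<Sum>n<N. cnj (w n) * x' s n)"])
      fix s assume "s \<in> {-\<bar>t\<bar>..\<bar>t\<bar>}"
      then have s: "\<bar>s\<bar> \<le> \<bar>t\<bar>" by auto
      show "(p has_derivative (\<lambda>h. h *\<^sub>R (\<Sum>n<N. cnj (w n) * x' s n))) (at s within {-\<bar>t\<bar>..\<bar>t\<bar>})"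
        using pd[of s] by (simp add: has_vector_derivative_def has_derivative_at_withinI)
      show "onorm (\<lambda>h. h *\<^sub>R (\<Sum>n<N. cnj (w n) * x' s n)) \<le> ?W * B"
        by (rule onorm_le) (use bd[OF s] in \<open>simp add: mult.commute mult_left_mono\<close>)
    qed auto
    moreover have "p 0 = 0" by (simp add: p_def x0)
    moreover have "p t = of_real (?W\<^sup>2)"
      by (simp add: p_def w_def L2_set_sq mult.commute flip: complex_norm_square)
    ultimately have le: "?W\<^sup>2 \<le> ?W * B * \<bar>t\<bar>" by (simp add: norm_power)
    show ?thesis
    proof (cases "?W = 0")
      case True then show ?thesis using B0 by (simp add: w_def)
    next
      case False
      then have "?W > 0" using L2_set_nonneg[of "\<lambda>n. cmod (w n)" "{..<N}"] by linarith
      then show ?thesis using le by (simp add: power2_eq_square w_def mult.assoc)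
    qed
  qed
  then show ?thesis using ell2I ell2_norm_le by blast
qed

section \<open>The Jacobi operator and its coordinatewise evolution equation\<close>

abbreviation Jform :: "(nat \<Rightarrow> complex) \<Rightarrow> nat \<Rightarrow> complex" where
  "Jform \<equiv> jacobi_apply hermite_a (\<lambda>n. 0)"

text \<open>The maximal operator of the Jacobi matrix. It serves as the working form of
  \<open>hermite_J\<close>, because limits of its elements can be checked one coordinate at a
  time.\<close>

definition Jmax :: ell2_op where
  "Jmax = {(f, Jform f) | f. f \<in> ell2 \<and> Jform f \<in> ell2}"

lemma hermite_a_nonneg: "0 \<le> hermite_a n" by (simp add: hermite_a_def)

lemma hermite_a_pos: "0 < hermite_a n" by (simp add: hermite_a_def)

lemma hermite_a_sq: "(hermite_a n)\<^sup>2 = (real n + 1) / 2" by (simp add: hermite_a_def)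

lemma hermite_a_mono: "m \<le> n \<Longrightarrow> hermite_a m \<le> hermite_a n" by (simp add: hermite_a_def)

lemma Jform_eq:
  fixes f :: "nat \<Rightarrow> complex"
  shows "Jform f n = (if n = 0 then 0 else hermite_a (n - 1) * f (n - 1)) + hermite_a n * f (n + 1)"
  by (simp add: jacobi_apply_def)

lemma Jform_diff:
  fixes f g :: "nat \<Rightarrow> complex"
  shows "Jform (\<lambda>n. f n - g n) n = Jform f n - Jform g n"
  by (simp add: Jform_eq algebra_simps)

lemma Jform_tendsto:
  assumes "\<And>n. ((\<lambda>k. F k n) \<longlongrightarrow> f n) G"
  shows "((\<lambda>k. Jform (F k) n) \<longlongrightarrow> Jform f n) G"
  unfolding Jform_eq by (cases n) (auto intro!: tendsto_intros assms)

lemma Jform_finite: 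
  assumes "F \<in> finite_seqs" shows "Jform F \<in> finite_seqs"
proof -
  from assms have "finite {n. F n \<noteq> 0}" by (simp add: finite_seqs_def)
  moreover have "{n. Jform F n \<noteq> 0} \<subseteq> Suc ` {n. F n \<noteq> 0} \<union> (\<lambda>n. n - 1) ` {n. F n \<noteq> 0}"
  proof
    fix n assume "n \<in> {n. Jform F n \<noteq> 0}"
    then have "(n \<noteq> 0 \<and> F (n - 1) \<noteq> 0) \<or> F (n + 1) \<noteq> 0"
      by (auto simp: Jform_eq split: if_splits)
    then show "n \<in> Suc ` {n. F n \<noteq> 0} \<union> (\<lambda>n. n - 1) ` {n. F n \<noteq> 0}"
    proof
      assume "n \<noteq> 0 \<and> F (n - 1) \<noteq> 0"
      then have "n = Suc (n - 1)" "n - 1 \<in> {n. F n \<noteq> 0}" by auto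
      then show ?thesis by blast
    next
      assume "F (n + 1) \<noteq> 0"
      then have "n = (n + 1) - 1" "n + 1 \<in> {n. F n \<noteq> 0}" by auto
      then show ?thesis by blast
    qed
  qed
  ultimately show ?thesis unfolding finite_seqs_def
    by (simp add: finite_subset)
qed

lemma cmod_Jform_le:
  fixes f :: "nat \<Rightarrow> complex"
  assumes "\<And>m. cmod (f m) \<le> B"
  shows "cmod (Jform f n) \<le> 2 * hermite_a n * B"
proof -
  have B: "0 \<le> B" using assms[of 0] norm_ge_zero order_trans by blast
  have "cmod (Jform f n) \<le> cmod (if n = 0 then 0 else hermite_a (n - 1) * f (n - 1)) + cmod (hermite_a n * f (n + 1))"
    unfolding Jform_eq by (rule norm_triangle_ineq)
  also have "\<dots> \<le> hermite_a n * B + hermite_a n * B"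
    by (intro add_mono)
      (auto simp: norm_mult hermite_a_nonneg B intro!: mult_mono hermite_a_mono assms mult_nonneg_nonneg)
  finally show ?thesis by (simp add: mult_ac)
qed

text \<open>The cutoff has slope \<open>1/N\<close> on a range where \<open>hermite_a\<close> is of order \<open>sqrt N\<close>, so its
  commutator with the Jacobi operator is of order \<open>1 / sqrt N\<close>.\<close>

definition cutoff :: "nat \<Rightarrow> nat \<Rightarrow> real" where
  "cutoff N n = max 0 (1 - real n / (real N + 1))"

lemma cutoff_range: "0 \<le> cutoff N n" "cutoff N n \<le> 1"
  by (auto simp: cutoff_def)

lemma cutoff_finite:
  fixes f :: "nat \<Rightarrow> complex"
  shows "(\<lambda>n. cutoff N n * f n) \<in> finite_seqs"
proof -
  have "{n. complex_of_real (cutoff N n) * f n \<noteq> 0} \<subseteq> {..N}"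
  proof
    fix n assume "n \<in> {n. complex_of_real (cutoff N n) * f n \<noteq> 0}"
    then have "1 - real n / (real N + 1) > 0" by (auto simp: cutoff_def max_def split: if_splits)
    then show "n \<in> {..N}" by (simp add: field_simps)
  qed
  then show ?thesis unfolding finite_seqs_def using finite_subset by auto
qed

lemma cutoff_step: "hermite_a n * \<bar>cutoff N (Suc n) - cutoff N n\<bar> \<le> 1 / sqrt (real N + 1)"
proof (cases "n \<le> N")
  case True
  have "cutoff N n = 1 - real n / (real N + 1)" "cutoff N (Suc n) = 1 - (real n + 1) / (real N + 1)"
    using True by (auto simp: cutoff_def max_def field_simps)
  then have "\<bar>cutoff N (Suc n) - cutoff N n\<bar> \<le> 1 / (real N + 1)"
    by (simp add: diff_divide_distrib[symmetric])
  moreover have "hermite_a n \<le> sqrt (real N + 1)"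
    using True by (simp add: hermite_a_def)
  ultimately have "hermite_a n * \<bar>cutoff N (Suc n) - cutoff N n\<bar> \<le> sqrt (real N + 1) * (1 / (real N + 1))"
    by (intro mult_mono) auto
  also have "\<dots> = 1 / sqrt (real N + 1)" 
    by (simp add: real_div_sqrt field_simps)
  finally show ?thesis .
next
  case False
  then have "cutoff N n = 0" "cutoff N (Suc n) = 0" by (auto simp: cutoff_def max_def field_simps)
  then show ?thesis by simp
qed

lemma real_plus_one_at_top: "filterlim (\<lambda>n. real n + 1) at_top sequentially"
  by (rule filterlim_at_top_mono[OF filterlim_real_sequentially]) auto

lemma cutoff_one: "(\<lambda>N. cutoff N n) \<longlonglongrightarrow> 1"
proof -
  have "(\<lambda>N. max 0 (1 - real n / (real N + 1))) \<longlonglongrightarrow> max 0 (1 - 0)"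
    by (intro tendsto_intros tendsto_divide_0[OF tendsto_const] filterlim_at_top_imp_at_infinity
        real_plus_one_at_top)
  then show ?thesis by (simp add: cutoff_def)
qed

lemma cutoff_tendsto:
  fixes f :: "nat \<Rightarrow> complex"
  assumes "f \<in> ell2"
  shows "(\<lambda>N. ell2_norm (\<lambda>n. cutoff N n * f n - f n)) \<longlonglongrightarrow> 0"
proof -
  have s: "summable (\<lambda>n. (cmod (f n))\<^sup>2)" using assms by (simp add: ell2_def)
  have "(\<lambda>N. \<Sum>n. (cmod (cutoff N n * f n - f n))\<^sup>2) \<longlonglongrightarrow> (\<Sum>n::nat. 0)"
  proof (rule tannerys_theorem[THEN conjunct2, THEN conjunct2])
    fix n
    have "(\<lambda>N. (cmod (complex_of_real (cutoff N n) * f n - f n))\<^sup>2) \<longlonglongrightarrow> (cmod (of_real 1 * f n - f n))\<^sup>2"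
      by (intro tendsto_intros cutoff_one)
    then show "(\<lambda>N. (cmod (complex_of_real (cutoff N n) * f n - f n))\<^sup>2) \<longlonglongrightarrow> 0" by simp
  next
    show "\<forall>\<^sub>F (n, N) in sequentially \<times>\<^sub>F sequentially.
       norm ((cmod (complex_of_real (cutoff N n) * f n - f n))\<^sup>2) \<le> (cmod (f n))\<^sup>2"
    proof (rule always_eventually, safe)
      fix n N
      have "complex_of_real (cutoff N n) * f n - f n = of_real (cutoff N n - 1) * f n"
        by (simp add: algebra_simps)
      then have "cmod (complex_of_real (cutoff N n) * f n - f n) = \<bar>cutoff N n - 1\<bar> * cmod (f n)"
        by (simp only: norm_mult norm_of_real)
      also have "\<dots> \<le> 1 * cmod (f n)"
        using cutoff_range[of N n] by (intro mult_right_mono) auto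
      finally show "norm ((cmod (complex_of_real (cutoff N n) * f n - f n))\<^sup>2) \<le> (cmod (f n))\<^sup>2"
        by (simp add: power_mono)
    qed
  qed (use s in auto)
  then have "(\<lambda>N. sqrt (\<Sum>n. (cmod (cutoff N n * f n - f n))\<^sup>2)) \<longlonglongrightarrow> sqrt 0"
    by (intro tendsto_real_sqrt) simp
  then show ?thesis by (simp add: ell2_norm_def)
qed

text \<open>In the commutator the cutoff values combine to increments, leaving two shifted copies of
  \<open>f\<close> whose weights are bounded by \<open>cutoff_step\<close>.\<close>

lemma cutoff_commutator:
  fixes f :: "nat \<Rightarrow> complex"
  assumes "f \<in> ell2"
  defines "c \<equiv> \<lambda>N n. Jform (\<lambda>n. cutoff N n * f n) n - cutoff N n * Jform f n"
  shows "c N \<in> ell2" "ell2_norm (c N) \<le> 2 * ell2_norm f / sqrt (real N + 1)"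
proof -
  define s where "s = 1 / sqrt (real N + 1)"
  have s0: "0 \<le> s" by (simp add: s_def)
  \<comment> \<open>The right and left shifts of \<open>f\<close>; neither has larger norm than
    \<open>f\<close>.\<close>
  define u v where "u n = (if n = 0 then 0 else f (n - 1))" and "v n = f (Suc n)" for n
  have sf: "summable (\<lambda>n. (cmod (f n))\<^sup>2)" using assms by (simp add: ell2_def)
  have v: "L2_set (\<lambda>n. cmod (v n)) {..<M} \<le> ell2_norm f" for M
  proof -
    have "L2_set (\<lambda>n. cmod (v n)) {..<M} = L2_set (\<lambda>n. cmod (f n)) (Suc ` {..<M})"
      unfolding L2_set_def v_def by (simp add: sum.reindex)
    then show ?thesis using L2_set_le_ell2_norm[OF assms(1), of "Suc ` {..<M}"] by simp
  qed
  have u: "L2_set (\<lambda>n. cmod (u n)) {..<M} \<le> ell2_norm f" for M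
  proof (cases M)
    case 0 then show ?thesis using ell2_norm_nonneg[OF assms(1)] by simp
  next
    case (Suc k)
    have "L2_set (\<lambda>n. cmod (u n)) {..<M} = L2_set (\<lambda>n. cmod (f n)) {..<k}"
      unfolding L2_set_def u_def Suc by (subst sum.lessThan_Suc_shift) simp
    then show ?thesis using L2_set_le_ell2_norm[OF assms(1), of "{..<k}"] by simp
  qed
  have pt: "cmod (c N n) \<le> s * cmod (u n) + s * cmod (v n)" for n
  proof -
    have "c N n = (if n = 0 then 0 else of_real (hermite_a (n - 1) * (cutoff N (n - 1) - cutoff N n)) * f (n - 1)) +
        of_real (hermite_a n * (cutoff N (Suc n) - cutoff N n)) * f (Suc n)"
      unfolding c_def Jform_eq by (simp add: algebra_simps)
    also have "cmod \<dots> \<le> cmod (if n = 0 then 0 else of_real (hermite_a (n - 1) * (cutoff N (n - 1) - cutoff N n)) * f (n - 1))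
        + cmod (of_real (hermite_a n * (cutoff N (Suc n) - cutoff N n)) * f (Suc n))"
      by (rule norm_triangle_ineq)
    also have "\<dots> \<le> s * cmod (u n) + s * cmod (v n)"
    proof (rule add_mono)
      show "cmod (of_real (hermite_a n * (cutoff N (Suc n) - cutoff N n)) * f (Suc n)) \<le> s * cmod (v n)"
        unfolding norm_mult norm_of_real abs_mult v_def s_def
        using cutoff_step[of n N] hermite_a_nonneg[of n] by (intro mult_right_mono) auto
      show "cmod (if n = 0 then 0 else of_real (hermite_a (n - 1) * (cutoff N (n - 1) - cutoff N n)) * f (n - 1)) \<le> s * cmod (u n)"
      proof (cases n)
        case (Suc m)
        have "hermite_a m * \<bar>cutoff N m - cutoff N (Suc m)\<bar> \<le> s"
          using cutoff_step[of m N] by (simp add: s_def abs_minus_commute)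
        then show ?thesis unfolding Suc u_def using hermite_a_nonneg[of m]
          by (simp add: norm_mult mult_right_mono abs_mult del: of_real_mult of_real_diff)
      qed (simp add: u_def)
    qed
    finally show ?thesis .
  qed
  have b: "L2_set (\<lambda>n. cmod (c N n)) {..<M} \<le> 2 * ell2_norm f / sqrt (real N + 1)" for M
  proof -
    have "L2_set (\<lambda>n. cmod (c N n)) {..<M} \<le> L2_set (\<lambda>n. s * cmod (u n) + s * cmod (v n)) {..<M}"
      by (intro L2_set_mono pt) auto
    also have "\<dots> \<le> L2_set (\<lambda>n. s * cmod (u n)) {..<M} + L2_set (\<lambda>n. s * cmod (v n)) {..<M}"
      by (rule L2_set_triangle_ineq)
    also have "\<dots> = s * L2_set (\<lambda>n. cmod (u n)) {..<M} + s * L2_set (\<lambda>n. cmod (v n)) {..<M}"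
      by (simp add: L2_set_right_distrib s0)
    also have "\<dots> \<le> s * ell2_norm f + s * ell2_norm f"
      by (intro add_mono mult_left_mono u v s0)
    finally show ?thesis by (simp add: s_def)
  qed
  show "c N \<in> ell2" by (rule ell2I, rule b)
  show "ell2_norm (c N) \<le> 2 * ell2_norm f / sqrt (real N + 1)" by (rule ell2_norm_le, rule b)
qed

text \<open>The error splits into the commutator, which vanishes by the previous bound, and the
  cutoff error of \<open>Jform f\<close> itself. A sharp truncation would instead leave boundary
  terms such as \<open>hermite_a (N - 1) * f N\<close>, which square summability does not force to
  vanish.\<close>

lemma cutoff_Jform_tendsto:
  fixes f :: "nat \<Rightarrow> complex"
  assumes "f \<in> ell2" "Jform f \<in> ell2"
  shows "(\<lambda>N. ell2_norm (\<lambda>n. Jform (\<lambda>n. cutoff N n * f n) n - Jform f n)) \<longlonglongrightarrow> 0"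
proof (rule tendsto_sandwich[of "\<lambda>_. 0"])
  let ?c = "\<lambda>N n. complex_of_real (cutoff N n) * Jform f n"
  let ?F = "\<lambda>N. Jform (\<lambda>n. complex_of_real (cutoff N n) * f n)"
  have F: "?F N \<in> ell2" for N using Jform_finite[OF cutoff_finite] finite_seqs_subset_ell2 by auto
  have c: "?c N \<in> ell2" for N using cutoff_finite finite_seqs_subset_ell2 by auto
  show "\<forall>\<^sub>F N in sequentially. ell2_norm (\<lambda>n. ?F N n - Jform f n) \<le>
      2 * ell2_norm f / sqrt (real N + 1) + ell2_norm (\<lambda>n. ?c N n - Jform f n)"
  proof (rule always_eventually, safe)
    fix N
    show "ell2_norm (\<lambda>n. ?F N n - Jform f n) \<le>
      2 * ell2_norm f / sqrt (real N + 1) + ell2_norm (\<lambda>n. ?c N n - Jform f n)"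
      using ell2_norm_triangle3[OF F[of N] c[of N] assms(2)] cutoff_commutator(2)[OF assms(1), of N]
      by linarith
  qed
  show "\<forall>\<^sub>F N in sequentially. 0 \<le> ell2_norm (\<lambda>n. ?F N n - Jform f n)"
    by (intro always_eventually allI ell2_norm_nonneg ell2_minus F assms)
  have "filterlim (\<lambda>N. sqrt (real N + 1)) at_top sequentially"
    by (intro filterlim_compose[OF sqrt_at_top] real_plus_one_at_top)
  then have "(\<lambda>N. 2 * ell2_norm f / sqrt (real N + 1)) \<longlonglongrightarrow> 0"
    by (intro tendsto_divide_0[OF tendsto_const] filterlim_at_top_imp_at_infinity)
  from tendsto_add[OF this cutoff_tendsto[OF assms(2)]]
  show "(\<lambda>N. 2 * ell2_norm f / sqrt (real N + 1) + ell2_norm (\<lambda>n. ?c N n - Jform f n)) \<longlonglongrightarrow> 0"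
    by simp
qed auto

text \<open>Norm limits are coordinatewise limits and \<open>Jform\<close> involves only
  neighbouring coordinates, so the closure stays inside \<open>Jmax\<close>. Conversely, the cutoffs
  of an element of \<open>Jmax\<close> converge to it in the graph norm.\<close>

lemma hermite_J_eq_Jmax: "hermite_J = Jmax"
proof (rule set_eqI, rule iffI)
  fix p assume "p \<in> hermite_J"
  obtain f h where p: "p = (f, h)" by (cases p)
  with \<open>p \<in> hermite_J\<close> have "f \<in> ell2 \<and> h \<in> ell2 \<and> (\<exists>F G. (\<forall>k::nat. F k \<in> finite_seqs \<and> G k = Jform (F k)) \<and>
      (\<lambda>k. ell2_norm (\<lambda>n. F k n - f n)) \<longlonglongrightarrow> 0 \<and> (\<lambda>k. ell2_norm (\<lambda>n. G k n - h n)) \<longlonglongrightarrow> 0)"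
    unfolding hermite_J_def jacobi_op_def op_closure_def by (simp add: conj_commute)
  then obtain F G where fh: "f \<in> ell2" "h \<in> ell2"
    and FG: "\<forall>k::nat. F k \<in> finite_seqs \<and> G k = Jform (F k)"
    and lim: "(\<lambda>k. ell2_norm (\<lambda>n. F k n - f n)) \<longlonglongrightarrow> 0" "(\<lambda>k. ell2_norm (\<lambda>n. G k n - h n)) \<longlonglongrightarrow> 0"
    by (elim conjE exE)
  have F: "F k \<in> finite_seqs" and G: "G k = Jform (F k)" for k using FG by auto
  have F2: "F k \<in> ell2" "G k \<in> ell2" for k
    using F Jform_finite[OF F] finite_seqs_subset_ell2 unfolding G by auto
  have "h n = Jform f n" for n
  proof (rule LIMSEQ_unique)
    show "(\<lambda>k. G k n) \<longlonglongrightarrow> h n" by (rule ell2_norm_tendsto_component[OF lim(2) F2(2) fh(2)])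
    show "(\<lambda>k. G k n) \<longlonglongrightarrow> Jform f n"
      unfolding G by (intro Jform_tendsto ell2_norm_tendsto_component[OF lim(1) F2(1) fh(1)])
  qed
  then have "h = Jform f" by auto
  then show "p \<in> Jmax" using fh p unfolding Jmax_def by auto
next
  fix p assume "p \<in> Jmax"
  then obtain f where p: "p = (f, Jform f)" and f: "f \<in> ell2" "Jform f \<in> ell2" by (auto simp: Jmax_def)
  let ?F = "\<lambda>N n. complex_of_real (cutoff N n) * f n"
  show "p \<in> hermite_J"
    unfolding hermite_J_def jacobi_op_def op_closure_def p mem_Collect_eq prod.case
    using cutoff_tendsto[OF f(1)] cutoff_Jform_tendsto[OF f] cutoff_finite
    by (intro conjI f exI[of _ ?F] exI[of _ "\<lambda>k. Jform (?F k)"]) auto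
qed

text \<open>Only coordinatewise differentiability is asked for, not square summability. The notion
  thereby also covers the matrix elements of an unknown group, read as a sequence in the index of
  the initial unit vector.\<close>

definition evolution_solution :: "(real \<Rightarrow> nat \<Rightarrow> complex) \<Rightarrow> bool" where
  "evolution_solution x \<longleftrightarrow>
     (\<forall>n t. ((\<lambda>t. x t n) has_vector_derivative (- \<i> * Jform (x t) n)) (at t))"

lemma evolution_solution_diff:
  "evolution_solution x \<Longrightarrow> evolution_solution y \<Longrightarrow> evolution_solution (\<lambda>t n. x t n - y t n)"
  unfolding evolution_solution_def Jform_diff right_diff_distrib
  by (intro allI has_vector_derivative_diff) auto

lemma power_bound_of_derivative:
  fixes u u' :: "real \<Rightarrow> complex"
  assumes der: "\<And>t. (u has_vector_derivative u' t) (at t)" and u0: "u 0 = 0"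
    and bd: "\<And>t. cmod (u' t) \<le> M * \<bar>t\<bar> ^ k / fact k"
  shows "cmod (u t) \<le> M * \<bar>t\<bar> ^ Suc k / fact (Suc k)"
proof -
  \<comment> \<open>Rescaling time to the interval from 0 to 1 handles both signs of
    \<open>t\<close> at once and lets a power of \<open>s\<close> serve as the majorant.\<close>
  define p where "p s = u (t * s)" for s
  have pd: "(p has_vector_derivative t *\<^sub>R u' (t * s)) (at s)" for s
  proof -
    have "((\<lambda>s. t * s) has_vector_derivative t) (at s)"
      using DERIV_cmult_Id[of t] by (simp add: has_real_derivative_iff_has_vector_derivative)
    from vector_diff_chain_at[OF this der] show ?thesis by (simp add: p_def[abs_def] o_def)
  qed
  let ?phi = "\<lambda>s. M * \<bar>t\<bar> ^ Suc k * s ^ Suc k / fact (Suc k)"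
  have "norm (p 1 - p 0) \<le> ?phi 1 - ?phi 0"
  proof (rule differentiable_bound_general[of 0 1])
    show "continuous_on {0..1} p"
      by (meson continuous_at_imp_continuous_on has_vector_derivative_continuous pd)
    show "continuous_on {0..1} ?phi" by (intro continuous_intros) auto
    show "(p has_vector_derivative t *\<^sub>R u' (t * s)) (at s)" for s by (rule pd)
    show "(?phi has_vector_derivative M * \<bar>t\<bar> ^ Suc k * s ^ k / fact k) (at s)" for s
    proof -
      have "(?phi has_real_derivative M * \<bar>t\<bar> ^ Suc k * (real (Suc k) * s ^ k) / fact (Suc k)) (at s)"
        using DERIV_pow[of "Suc k" s UNIV] 
        by (intro DERIV_cdivide DERIV_cmult) simp
      moreover have "M * \<bar>t\<bar> ^ Suc k * (real (Suc k) * s ^ k) / fact (Suc k) = M * \<bar>t\<bar> ^ Suc k * s ^ k / fact k"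
        by (simp add: divide_simps del: of_nat_Suc)
      ultimately show ?thesis by (simp only: has_real_derivative_iff_has_vector_derivative)
    qed
    show "norm (t *\<^sub>R u' (t * s)) \<le> M * \<bar>t\<bar> ^ Suc k * s ^ k / fact k" if "0 < s" "s < 1" for s
    proof -
      have "norm (t *\<^sub>R u' (t * s)) \<le> \<bar>t\<bar> * (M * \<bar>t * s\<bar> ^ k / fact k)"
        unfolding norm_scaleR real_norm_def by (intro mult_left_mono bd) auto
      also have "\<dots> = M * \<bar>t\<bar> ^ Suc k * s ^ k / fact k"
        using that by (simp add: abs_mult power_mult_distrib)
      finally show ?thesis .
    qed
  qed simp
  then show ?thesis by (simp add: p_def u0)
qed

text \<open>Iterating the equation \<open>k\<close> times bounds a solution with zero initial value by
  \<open>\<bar>t\<bar>\<^sup>k / k!\<close> times a product of \<open>k\<close> coefficients, which grows only like \<open>sqrt (k!)\<close>.\<close>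

lemma evolution_solution_zero:
  assumes sol: "evolution_solution x" and bd: "\<And>t n. cmod (x t n) \<le> C" and x0: "\<And>n. x 0 n = 0"
  shows "x t n = 0"
proof -
  \<comment> \<open>Each use of the equation costs a factor \<open>2 * hermite_a\<close> for the two
    neighbours and raises the largest index involved by one.\<close>
  define b where "b k n = C * (\<Prod>j<k. 2 * hermite_a (n + j))" for k n
  have C: "0 \<le> C" using bd[of 0 0] norm_ge_zero order_trans by blast
  have bmono: "b k m \<le> b k n" if "m \<le> n" for k m n
    unfolding b_def using that C
    by (intro mult_left_mono prod_mono) (auto intro!: hermite_a_mono mult_nonneg_nonneg hermite_a_nonneg)
  have bSuc: "b (Suc k) n = 2 * hermite_a n * b k (Suc n)" for k n
    unfolding b_def prod.lessThan_Suc_shift by simp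
  have step: "cmod (x t n) \<le> b k n * \<bar>t\<bar> ^ k / fact k" for k t n
  proof (induction k arbitrary: t n)
    case 0 then show ?case by (simp add: b_def bd)
  next
    case (Suc k)
    show ?case
    proof (rule power_bound_of_derivative)
      show "((\<lambda>t. x t n) has_vector_derivative (- \<i> * Jform (x t) n)) (at t)" for t
        using sol by (simp add: evolution_solution_def)
      fix t
      define D where "D = b k (Suc n) * \<bar>t\<bar> ^ k / fact k"
      have D0: "0 \<le> D"
        using Suc.IH[of t "Suc n"] norm_ge_zero order_trans unfolding D_def by blast
      \<comment> \<open>The lower neighbour is estimated by the bound of the upper one, since
        \<open>b k\<close> increases with the index.\<close>
      have D1: "cmod (x t (n - 1)) \<le> D" unfolding D_def
        by (rule order_trans[OF Suc.IH]) (auto intro!: divide_right_mono mult_right_mono bmono)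
      have "cmod (Jform (x t) n) \<le> cmod (if n = 0 then 0 else hermite_a (n - 1) * x t (n - 1)) + cmod (hermite_a n * x t (n + 1))"
        unfolding Jform_eq by (rule norm_triangle_ineq)
      also have "\<dots> \<le> hermite_a n * D + hermite_a n * D"
      proof (intro add_mono)
        show "cmod (if n = 0 then 0 else hermite_a (n - 1) * x t (n - 1)) \<le> hermite_a n * D"
          using D0 D1 hermite_a_nonneg
          by (auto simp: norm_mult intro!: mult_mono hermite_a_mono)
        show "cmod (hermite_a n * x t (n + 1)) \<le> hermite_a n * D"
          unfolding norm_mult using Suc.IH[of t "Suc n"] hermite_a_nonneg[of n]
          by (intro mult_mono) (auto simp: D_def)
      qed
      finally show "cmod (- \<i> * Jform (x t) n) \<le> b (Suc k) n * \<bar>t\<bar> ^ k / fact k"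
        by (simp add: norm_mult bSuc D_def mult_ac)
    qed (rule x0)
  qed
  \<comment> \<open>Squaring removes the square roots:
    \<open>(2 * hermite_a j)\<^sup>2 = 2 * (real j + 1)\<close>, and the product becomes a quotient
    of factorials.\<close>
  have prod_sq: "(\<Prod>j<k. 2 * hermite_a (n + j))\<^sup>2 = 2 ^ k * (\<Prod>j<k. real (n + j + 1))" for k
    by (induction k) (simp_all add: power_mult_distrib hermite_a_sq field_simps)
  have prod_fact: "(\<Prod>j<k. real (n + j + 1)) * fact n = fact (n + k)" for k
  proof (induction k)
    case (Suc k)
    have "(\<Prod>j<Suc k. real (n + j + 1)) * fact n = real (n + k + 1) * ((\<Prod>j<k. real (n + j + 1)) * fact n)"
      by simp
    then show ?case unfolding Suc by simp
  qed simp
  have prod_le: "(\<Prod>j<k. real (n + j + 1)) \<le> 2 ^ (n + k) * fact k" for k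
  proof -
    have "fact n * (\<Prod>j<k. real (n + j + 1)) = fact n * (real ((n + k) choose k) * fact k)"
      using prod_fact[of k] binomial_fact[of k "n + k", where 'a = real] by (simp add: field_simps)
    then have "(\<Prod>j<k. real (n + j + 1)) = real ((n + k) choose k) * fact k"
      by (subst (asm) mult_left_cancel) auto
    also have "\<dots> \<le> 2 ^ (n + k) * fact k"
      using binomial_le_pow2[of "n + k" k] 
      by (intro mult_right_mono) (metis of_nat_le_iff of_nat_numeral of_nat_power, simp)
    finally show ?thesis .
  qed
  have power_over_fact_tendsto: "(\<lambda>k. y ^ k / fact k) \<longlonglongrightarrow> 0" for y :: real
    using summable_LIMSEQ_zero[OF summable_exp[of y]] by (simp add: divide_inverse mult.commute)
  \<comment> \<open>One factorial of the squared denominator survives against the product; the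
    powers of two come from \<open>prod_sq\<close> and from bounding a binomial coefficient by
    \<open>2 ^ (n + k)\<close>.\<close>
  have sq: "(cmod (x t n))\<^sup>2 \<le> C\<^sup>2 * 2 ^ n * ((4 * t\<^sup>2) ^ k / fact k)" for k
  proof -
    have "(cmod (x t n))\<^sup>2 \<le> (b k n * \<bar>t\<bar> ^ k / fact k)\<^sup>2"
      by (intro power_mono step) auto
    also have "\<dots> = C\<^sup>2 * (2 ^ k * (\<Prod>j<k. real (n + j + 1))) * (t\<^sup>2) ^ k / (fact k)\<^sup>2"
      unfolding b_def prod_sq[symmetric] by (simp add: power_mult_distrib power_divide power_even_abs flip: power_mult) (simp add: mult.commute)
    also have "\<dots> \<le> C\<^sup>2 * (2 ^ k * (2 ^ (n + k) * fact k)) * (t\<^sup>2) ^ k / (fact k)\<^sup>2"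
      by (intro divide_right_mono mult_right_mono mult_left_mono prod_le) auto
    also have "\<dots> = C\<^sup>2 * 2 ^ n * ((4 * t\<^sup>2) ^ k / fact k)"
      by (simp add: power_add power2_eq_square power_mult_distrib field_simps flip: power_mult_distrib[of 2 2 k])
    finally show ?thesis .
  qed
  have "(\<lambda>k. C\<^sup>2 * 2 ^ n * ((4 * t\<^sup>2) ^ k / fact k)) \<longlonglongrightarrow> C\<^sup>2 * 2 ^ n * 0"
    by (intro tendsto_intros power_over_fact_tendsto)
  then have "(cmod (x t n))\<^sup>2 \<le> 0"
    using sq by (intro LIMSEQ_le_const[of _ 0]) auto
  then show ?thesis by simp
qed

lemma evolution_solution_unique:
  assumes "evolution_solution x" "evolution_solution y"
    and "\<And>t n. cmod (x t n) \<le> C" "\<And>t n. cmod (y t n) \<le> D" "x 0 = y 0"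
  shows "x t = y t"
proof
  fix n
  have "x t n - y t n = 0"
  proof (rule evolution_solution_zero[OF evolution_solution_diff[OF assms(1,2)], of "C + D"])
    show "cmod (x t n - y t n) \<le> C + D" for t n
      using norm_triangle_ineq4[of "x t n" "y t n"] assms(3)[of t n] assms(4)[of t n] by linarith
  qed (use assms(5) in simp)
  then show "x t n = y t n" by simp
qed

section \<open>Hermite functions\<close>

definition psi :: "nat \<Rightarrow> real \<Rightarrow> real" where
  "psi n x = pi powr (-1/4) * (exp (- (x\<^sup>2) / 2) * hermite n x)"

lemma hermite_recurrence:
  "z * hermite n z = (if n = 0 then 0 else hermite_a (n - 1) * hermite (n - 1) z) + hermite_a n * hermite (Suc n) z"
  using hermite_a_pos[of n] by (cases n) (auto simp: less_imp_neq)

text \<open>The source of both intertwining relations \<open>Phi_fin_Jform\<close> and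
  \<open>Jform_fcoef\<close>: on the Hermite functions, multiplication by \<open>x\<close> acts
  through the Jacobi matrix.\<close>

lemma psi_recurrence:
  "x * psi n x = (if n = 0 then 0 else hermite_a (n - 1) * psi (n - 1) x) + hermite_a n * psi (Suc n) x"
proof -
  have "x * psi n x = pi powr (-1/4) * exp (- (x\<^sup>2) / 2) * (x * hermite n x)" by (simp add: psi_def)
  then show ?thesis unfolding hermite_recurrence by (simp add: psi_def algebra_simps)
qed

text \<open>Differentiating the three-term recurrence reproduces the pattern because \<open>1 + 2 *
  (hermite_a n)\<^sup>2 = 2 * (hermite_a (Suc n))\<^sup>2\<close>, a property of these particular
  coefficients.\<close>

lemma hermite_deriv:
  "(hermite n has_real_derivative (if n = 0 then 0 else 2 * hermite_a (n - 1) * hermite (n - 1) z)) (at z)"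
proof (induction n z rule: hermite.induct)
  case (1 z)
  have "hermite 0 = (\<lambda>z. 1)" by auto
  then show ?case by simp
next
  case (2 z)
  have "hermite (Suc 0) = (\<lambda>z. z / hermite_a 0)" by auto
  moreover have "1 / hermite_a 0 = 2 * hermite_a 0"
    using hermite_a_sq[of 0] hermite_a_pos[of 0] by (simp add: field_simps power2_eq_square)
  moreover have "((\<lambda>z. z / hermite_a 0) has_real_derivative 1 / hermite_a 0) (at z)"
    by (intro DERIV_cdivide DERIV_ident)
  ultimately show ?case by simp
next
  case (3 n z)
  have eq: "hermite (Suc (Suc n)) = (\<lambda>z. (z * hermite (Suc n) z - hermite_a n * hermite n z) / hermite_a (Suc n))"
    by auto
  let ?d = "if n = 0 then 0 else 2 * hermite_a (n - 1) * hermite (n - 1) z"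
  have "(hermite (Suc n) has_real_derivative 2 * hermite_a n * hermite n z) (at z)"
    using "3.IH"(1) by simp
  from DERIV_cdivide[OF DERIV_diff[OF DERIV_mult[OF DERIV_ident this] DERIV_cmult[OF "3.IH"(2)]], of "hermite_a n" "hermite_a (Suc n)"]
  have "(hermite (Suc (Suc n)) has_real_derivative
      (hermite (Suc n) z + z * (2 * hermite_a n * hermite n z) - hermite_a n * ?d) / hermite_a (Suc n)) (at z)"
    unfolding eq by (rule DERIV_cong) (simp add: mult_ac del: hermite.simps)
  moreover have "(hermite (Suc n) z + z * (2 * hermite_a n * hermite n z) - hermite_a n * ?d) / hermite_a (Suc n)
      = 2 * hermite_a (Suc n) * hermite (Suc n) z"
  proof -
    have "hermite (Suc n) z + z * (2 * hermite_a n * hermite n z) - hermite_a n * ?d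
        = hermite (Suc n) z + 2 * hermite_a n * (z * hermite n z) - hermite_a n * ?d" by simp
    also have "\<dots> = (1 + 2 * (hermite_a n)\<^sup>2) * hermite (Suc n) z"
      unfolding hermite_recurrence by (simp add: algebra_simps power2_eq_square)
    also have "1 + 2 * (hermite_a n)\<^sup>2 = 2 * (hermite_a (Suc n))\<^sup>2" by (simp add: hermite_a_sq)
    finally show ?thesis using hermite_a_pos[of "Suc n"] by (simp add: power2_eq_square)
  qed
  ultimately show ?case by (simp only: nat.simps if_False diff_Suc_1)
qed

lemma psi_deriv:
  "(psi n has_real_derivative (if n = 0 then 0 else 2 * hermite_a (n - 1) * psi (n - 1) x) - x * psi n x) (at x)"
proof -
  have e: "((\<lambda>x. exp (- (x\<^sup>2) / 2)) has_real_derivative exp (- (x\<^sup>2) / 2) * (- x)) (at x)"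
    by (auto intro!: derivative_eq_intros)
  from DERIV_cmult[OF DERIV_mult[OF e hermite_deriv[of n x]], of "pi powr (-1/4)"]
  show ?thesis unfolding psi_def[abs_def]
    by (rule DERIV_cong) (simp add: algebra_simps)
qed

text \<open>The raising form, obtained from the lowering form \<open>psi_deriv\<close> by
  eliminating \<open>psi (n - 1)\<close> with the recurrence.\<close>

lemma psi_deriv': 
  "(psi n has_real_derivative (x * psi n x - 2 * hermite_a n * psi (Suc n) x)) (at x)"
  using psi_deriv[of n x] psi_recurrence[of x n] by (simp split: if_splits)

lemma continuous_psi [continuous_intros]: "continuous_on S (psi n)"
  by (meson DERIV_isCont continuous_at_imp_continuous_on psi_deriv)

lemma borel_measurable_psi [measurable]: "psi n \<in> borel_measurable borel"
  by (intro borel_measurable_continuous_onI continuous_psi)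

section \<open>Rapid decay and integrability of the Hermite functions\<close>

lemma power_le_fact_exp:
  fixes y :: real
  assumes "0 \<le> y" shows "y ^ k \<le> fact k * exp y"
proof -
  have s: "(\<lambda>n. y ^ n /\<^sub>R fact n) sums exp y"
    using summable_sums[OF summable_exp_generic[of y]] by (simp add: exp_def)
  have "sum (\<lambda>n. y ^ n /\<^sub>R fact n) {k} \<le> exp y"
    unfolding sums_unique[OF s] using assms by (intro sum_le_suminf sums_summable[OF s]) auto
  then show ?thesis by (simp add: field_simps)
qed

text \<open>Strong induction on \<open>n\<close> for all powers at once: the recurrence expresses
  \<open>psi n\<close> by lower Hermite functions, at the price of one more factor \<open>x\<close>.
  The Gaussian starts the induction.\<close>

lemma psi_rapid: "\<exists>C. \<forall>x. \<bar>x ^ k * psi n x\<bar> \<le> C"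
proof (induction n arbitrary: k rule: less_induct)
  case (less n)
  show ?case
  proof (cases n)
    case 0
    have "\<bar>x ^ k * psi n x\<bar> \<le> pi powr (-1/4) * (1 + 2 ^ k * fact k)" for x
    proof -
      \<comment> \<open>Passing to the square of the power makes it a power of
        \<open>x\<^sup>2\<close>, whatever the parity of \<open>k\<close>.\<close>
      have "y \<le> 1 + y\<^sup>2" for y :: real
        using zero_le_power2[of "y - 1 / 2"] by (simp add: power2_eq_square algebra_simps)
      then have "\<bar>x\<bar> ^ k \<le> 1 + (\<bar>x\<bar> ^ k)\<^sup>2" .
      also have "(\<bar>x\<bar> ^ k)\<^sup>2 = (x\<^sup>2) ^ k"
        by (simp only: power_mult[symmetric] mult.commute[of k 2]) (simp only: power_mult power2_abs)
      also have "\<dots> = 2 ^ k * (x\<^sup>2 / 2) ^ k"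
        by (simp add: power_divide)
      also have "\<dots> \<le> 2 ^ k * (fact k * exp (x\<^sup>2 / 2))"
        by (intro mult_left_mono power_le_fact_exp) auto
      also have "1 + 2 ^ k * (fact k * exp (x\<^sup>2 / 2)) \<le> (1 + 2 ^ k * fact k) * exp (x\<^sup>2 / 2)"
        by (simp add: distrib_right)
      finally have "\<bar>x\<bar> ^ k * exp (- (x\<^sup>2) / 2) \<le> (1 + 2 ^ k * fact k) * exp (x\<^sup>2 / 2) * exp (- (x\<^sup>2) / 2)"
        by (intro mult_right_mono) auto
      also have "\<dots> = 1 + 2 ^ k * fact k" by (simp flip: exp_add)
      finally have "pi powr (-1/4) * (\<bar>x\<bar> ^ k * exp (- (x\<^sup>2) / 2)) \<le> pi powr (-1/4) * (1 + 2 ^ k * fact k)"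
        by (intro mult_left_mono) auto
      moreover have "\<bar>x ^ k * psi n x\<bar> = pi powr (-1/4) * (\<bar>x\<bar> ^ k * exp (- (x\<^sup>2) / 2))"
        unfolding 0 psi_def abs_mult power_abs by simp
      ultimately show ?thesis by linarith
    qed
    then show ?thesis by blast
  next
    case (Suc m)
    obtain C1 where C1: "\<bar>x ^ Suc k * psi m x\<bar> \<le> C1" for x
      using less[of m "Suc k"] Suc by blast
    obtain C2 where C2: "\<bar>x ^ k * psi (m - 1) x\<bar> \<le> C2" for x
    proof -
      have "m - 1 < n" using Suc by simp
      from less[OF this, of k] show thesis using that by blast
    qed
    have C20: "0 \<le> C2" using C2[of 0] by linarith
    have "\<bar>x ^ k * psi n x\<bar> \<le> (C1 + hermite_a (m - 1) * C2) / hermite_a m" for x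
    proof -
      have eq: "hermite_a m * (x ^ k * psi n x) = x ^ k * (x * psi m x) - (if m = 0 then 0 else hermite_a (m - 1) * (x ^ k * psi (m - 1) x))"
        unfolding psi_recurrence[of x m] Suc by (simp add: algebra_simps)
      have "hermite_a m * \<bar>x ^ k * psi n x\<bar> = \<bar>hermite_a m * (x ^ k * psi n x)\<bar>"
        using hermite_a_nonneg[of m] by (simp add: abs_mult)
      also have "\<dots> = \<bar>x ^ Suc k * psi m x - (if m = 0 then 0 else hermite_a (m - 1) * (x ^ k * psi (m - 1) x))\<bar>"
        unfolding eq by (simp add: mult_ac)
      also have "\<dots> \<le> \<bar>x ^ Suc k * psi m x\<bar> + \<bar>if m = 0 then 0 else hermite_a (m - 1) * (x ^ k * psi (m - 1) x)\<bar>"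
        by (rule abs_triangle_ineq4)
      also have "\<dots> \<le> C1 + hermite_a (m - 1) * C2"
        unfolding abs_mult[of "hermite_a (m - 1)"] if_distrib[of abs] using hermite_a_nonneg[of "m - 1"] C20
        by (intro add_mono C1) (auto intro!: mult_left_mono C2[simplified])
      finally show ?thesis using hermite_a_pos[of m] by (simp add: field_simps)
    qed
    then show ?thesis by blast
  qed
qed

lemma psi_bounded: obtains C where "\<And>x. \<bar>psi n x\<bar> \<le> C" "0 \<le> C"
proof -
  obtain C where "\<bar>x ^ 0 * psi n x\<bar> \<le> C" for x using psi_rapid[of 0 n] by blast
  then have C: "\<bar>psi n x\<bar> \<le> C" for x by simp
  moreover have "0 \<le> C" using C[of 0] by linarith
  ultimately show ?thesis by (rule that)
qed

lemma integrable_inverse_1_plus_sq: "integrable lborel (\<lambda>x::real. inverse (1 + x\<^sup>2))"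
  using integrable_inverse_1_plus_square by (simp add: set_integrable_def)

lemma integrable_of_decay:
  fixes f :: "real \<Rightarrow> 'b::{banach, second_countable_topology}"
  assumes "f \<in> borel_measurable borel" "\<And>x. norm (f x) \<le> C" "\<And>x. x\<^sup>2 * norm (f x) \<le> D"
  shows "integrable lborel f"
proof (rule Bochner_Integration.integrable_bound)
  show "integrable lborel (\<lambda>x. (C + D) * inverse (1 + x\<^sup>2))"
    by (intro integrable_mult_right integrable_inverse_1_plus_sq)
  show "AE x in lborel. norm (f x) \<le> norm ((C + D) * inverse (1 + x\<^sup>2))"
  proof (rule AE_I2)
    fix x :: real
    have p: "1 + x\<^sup>2 > 0" using zero_le_power2[of x] by linarith
    have "(1 + x\<^sup>2) * norm (f x) \<le> C + D" using assms(2,3)[of x] by (simp add: distrib_right)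
    then have "norm (f x) \<le> (C + D) * inverse (1 + x\<^sup>2)"
      using p by (simp only: pos_le_divide_eq divide_inverse[symmetric] mult.commute)
    then show "norm (f x) \<le> norm ((C + D) * inverse (1 + x\<^sup>2))"
      unfolding real_norm_def by (rule order_trans[OF _ abs_ge_self])
  qed
qed (use assms in simp)

lemma integrable_psi_mult:
  fixes u :: "real \<Rightarrow> 'b::{banach, second_countable_topology}"
  assumes u: "u \<in> borel_measurable borel" "\<And>x. norm (u x) \<le> B"
  shows "integrable lborel (\<lambda>x. (x ^ k * psi n x) *\<^sub>R u x)"
proof -
  obtain C where C: "\<And>x. \<bar>x ^ k * psi n x\<bar> \<le> C" using psi_rapid by blast
  obtain D where D: "\<And>x. \<bar>x ^ (k + 2) * psi n x\<bar> \<le> D" using psi_rapid by blast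
  have B: "0 \<le> B" using u(2)[of 0] norm_ge_zero order_trans by blast
  have C0: "0 \<le> C" and D0: "0 \<le> D" using C[of 0] D[of 0] by linarith+
  show ?thesis
  proof (rule integrable_of_decay)
    show "(\<lambda>x. (x ^ k * psi n x) *\<^sub>R u x) \<in> borel_measurable borel" using u(1) by measurable
    show "norm ((x ^ k * psi n x) *\<^sub>R u x) \<le> C * B" for x
      unfolding norm_scaleR using C C0 by (intro mult_mono u) auto
    show "x\<^sup>2 * norm ((x ^ k * psi n x) *\<^sub>R u x) \<le> D * B" for x
    proof -
      have "x\<^sup>2 * norm ((x ^ k * psi n x) *\<^sub>R u x) = \<bar>x ^ (k + 2) * psi n x\<bar> * norm (u x)"
        by (simp add: power_add abs_mult mult_ac power2_eq_square)
      also have "\<dots> \<le> D * B" using D D0 by (intro mult_mono u) auto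
      finally show ?thesis .
    qed
  qed
qed

lemma integrable_psi_psi: "integrable lborel (\<lambda>x. psi m x * psi n x)"
proof -
  obtain C where "\<And>x. \<bar>psi n x\<bar> \<le> C" using psi_bounded[of n] by metis
  then show ?thesis using integrable_psi_mult[of "psi n" C 0 m] by simp
qed

section \<open>Orthonormality of the Hermite functions\<close>

lemma integral_derivative_eq_0:
  fixes F F' :: "real \<Rightarrow> 'b::euclidean_space"
  assumes der: "\<And>x. (F has_vector_derivative F' x) (at x)" and cont: "\<And>x. isCont F' x"
    and int: "integrable lborel F'" and lim: "(F \<longlongrightarrow> 0) at_top" "(F \<longlongrightarrow> 0) at_bot"
  shows "(\<integral>x. F' x \<partial>lborel) = 0"
proof -
  have "(LBINT x=-\<infinity>..\<infinity>. F' x) = 0 - 0"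
  proof (rule interval_integral_FTC_integrable)
    show "((F \<circ> real_of_ereal) \<longlongrightarrow> 0) (at_right (-\<infinity>))" "((F \<circ> real_of_ereal) \<longlongrightarrow> 0) (at_left \<infinity>)"
      using lim by (simp_all add: ereal_tendsto_simps)
    show "set_integrable lborel (einterval (- \<infinity>) \<infinity>) F'" using int by (simp add: set_integrable_def)
  qed (use der cont in auto)
  then show ?thesis by (simp add: interval_integral_to_infinity_eq interval_lebesgue_integral_def set_lebesgue_integral_def)
qed

lemma psi_tendsto_0: "(psi n \<longlongrightarrow> 0) at_infinity"
proof -
  obtain C where C: "\<And>x. \<bar>x ^ 1 * psi n x\<bar> \<le> C" using psi_rapid by blast
  have "((\<lambda>x::real. C / norm x) \<longlongrightarrow> 0) at_infinity"
    by (intro tendsto_divide_0[OF tendsto_const] filterlim_at_top_imp_at_infinity filterlim_norm_at_top)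
  moreover have "\<forall>\<^sub>F x in at_infinity. norm (psi n x) \<le> C / norm x"
    unfolding eventually_at_infinity
  proof (intro exI[of _ 1] allI impI)
    fix x :: real assume "1 \<le> norm x"
    then show "norm (psi n x) \<le> C / norm x" using C[of x] by (simp add: field_simps abs_mult)
  qed
  ultimately show ?thesis by (rule Lim_null_comparison[rotated])
qed

text \<open>Integrate the derivative of \<open>psi m * psi n\<close> over the line. With the
  lowering form for one factor and the raising form for the other, the terms containing
  \<open>x\<close> cancel.\<close>

lemma psi_orthogonality_step:
  "hermite_a n * (\<integral>x. psi m x * psi (Suc n) x \<partial>lborel) =
   (if m = 0 then 0 else hermite_a (m - 1) * (\<integral>x. psi (m - 1) x * psi n x \<partial>lborel))"
proof -
  let ?F' = "\<lambda>x. (if m = 0 then 0 else 2 * hermite_a (m - 1) * (psi (m - 1) x * psi n x)) - 2 * hermite_a n * (psi m x * psi (Suc n) x)"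
  have lim: "((\<lambda>x. psi m x * psi n x) \<longlongrightarrow> 0) at_infinity"
    using tendsto_mult[OF psi_tendsto_0[of m] psi_tendsto_0[of n]] by simp
  have "(\<integral>x. ?F' x \<partial>lborel) = 0"
  proof (rule integral_derivative_eq_0)
    fix x
    have "((\<lambda>x. psi m x * psi n x) has_real_derivative
       (((if m = 0 then 0 else 2 * hermite_a (m - 1) * psi (m - 1) x) - x * psi m x) * psi n x
       + (x * psi n x - 2 * hermite_a n * psi (Suc n) x) * psi m x)) (at x)"
      by (intro DERIV_mult psi_deriv psi_deriv')
    then show "((\<lambda>x. psi m x * psi n x) has_vector_derivative ?F' x) (at x)"
      unfolding has_real_derivative_iff_has_vector_derivative[symmetric]
      by (rule DERIV_cong) (simp add: algebra_simps)
    show "isCont ?F' x"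
      using DERIV_isCont[OF psi_deriv] by (cases m) (auto intro!: continuous_intros)
    show "integrable lborel ?F'"
      by (cases m) (auto intro!: integrable_psi_psi)
  qed (use lim at_top_le_at_infinity at_bot_le_at_infinity in \<open>auto intro: tendsto_mono\<close>)
  moreover have "(\<integral>x. ?F' x \<partial>lborel) =
     (if m = 0 then 0 else 2 * hermite_a (m - 1) * (\<integral>x. psi (m - 1) x * psi n x \<partial>lborel)) - 2 * hermite_a n * (\<integral>x. psi m x * psi (Suc n) x \<partial>lborel)"
    by (cases m) (simp_all add: integrable_psi_psi)
  ultimately show ?thesis by (simp split: if_splits)
qed

lemma integral_gaussian: "(\<integral>x. exp (- (x::real)\<^sup>2) \<partial>lborel) = sqrt pi"
proof -
  have "has_bochner_integral lborel (\<lambda>x::real. exp (- x\<^sup>2)) (2 *\<^sub>R (sqrt pi / 2))"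
    by (rule has_bochner_integral_even_function[OF gaussian_moment_0]) simp
  then show ?thesis by (simp add: has_bochner_integral_integral_eq)
qed

text \<open>Each application of the preceding identity lowers both indices by one. The case
  \<open>n = 0\<close> is the Gaussian integral, or that identity with first index 0, where its
  right-hand side vanishes.\<close>

lemma psi_orthonormal: "(\<integral>x. psi m x * psi n x \<partial>lborel) = (if m = n then 1 else 0)"
proof (induction n arbitrary: m)
  case 0
  show ?case
  proof (cases m)
    case 0
    have "psi 0 x * psi 0 x = pi powr (-1/2) * exp (- x\<^sup>2)" for x
    proof -
      have "psi 0 x * psi 0 x = (pi powr (-1/4) * pi powr (-1/4)) * (exp (- (x\<^sup>2) / 2) * exp (- (x\<^sup>2) / 2))"
        unfolding psi_def hermite.simps by (simp only: mult_1_right mult_ac)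
      then show ?thesis unfolding powr_add[symmetric] exp_add[symmetric] by simp
    qed
    then have "(\<integral>x. psi 0 x * psi 0 x \<partial>lborel) = pi powr (-1/2) * sqrt pi"
      by (simp only: integral_mult_right_zero integral_gaussian)
    also have "\<dots> = 1"
    proof -
      have "sqrt pi = pi powr (1/2)" by (simp add: powr_half_sqrt)
      then have "pi powr (-1/2) * sqrt pi = pi powr (-1/2 + 1/2)" by (simp only: powr_add)
      then show ?thesis by simp
    qed
    finally show ?thesis unfolding 0 by simp
  next
    case (Suc k)
    have "hermite_a k * (\<integral>x. psi 0 x * psi (Suc k) x \<partial>lborel) = 0"
      by (subst psi_orthogonality_step) simp
    then have "(\<integral>x. psi 0 x * psi (Suc k) x \<partial>lborel) = 0"
      using hermite_a_pos[of k] by simp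
    moreover have "(\<integral>x. psi (Suc k) x * psi 0 x \<partial>lborel) = (\<integral>x. psi 0 x * psi (Suc k) x \<partial>lborel)"
      by (intro Bochner_Integration.integral_cong refl) (rule mult.commute)
    ultimately show ?thesis unfolding Suc by (simp only:) simp
  qed
next
  case (Suc n)
  have "hermite_a n * (\<integral>x. psi m x * psi (Suc n) x \<partial>lborel) = hermite_a n * (if m = Suc n then 1 else 0)"
    unfolding psi_orthogonality_step Suc by auto
  then show ?case using hermite_a_pos[of n] by (subst (asm) mult_left_cancel) auto
qed

section \<open>Hermite coefficients of square integrable functions\<close>

lemma L2_fun_measurable: "u \<in> L2_fun \<Longrightarrow> u \<in> borel_measurable borel"
  by (simp add: L2_fun_def)

lemma L2_norm_power2: "(L2_norm u)\<^sup>2 = (\<integral>x. (cmod (u x))\<^sup>2 \<partial>lborel)"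
  by (simp add: L2_norm_def)

lemma L2_norm_nonneg: "0 \<le> L2_norm u"
  by (simp add: L2_norm_def)

text \<open>The adjoint of \<open>Phi\<close>; the conjugate in the inner product is absent because
  \<open>psi n\<close> is real.\<close>

definition fcoef :: "(real \<Rightarrow> complex) \<Rightarrow> nat \<Rightarrow> complex" where
  "fcoef u n = (\<integral>x. complex_of_real (psi n x) * u x \<partial>lborel)"

lemma integrable_psi_L2:
  assumes "u \<in> L2_fun"
  shows "integrable lborel (\<lambda>x. complex_of_real (psi n x) * u x)"
proof (rule Bochner_Integration.integrable_bound)
  show "integrable lborel (\<lambda>x. psi n x * psi n x + (cmod (u x))\<^sup>2)"
    using assms by (intro Bochner_Integration.integrable_add integrable_psi_psi) (simp add: L2_fun_def)
  show "(\<lambda>x. complex_of_real (psi n x) * u x) \<in> borel_measurable lborel"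
    using L2_fun_measurable[OF assms] by measurable
  show "AE x in lborel. norm (complex_of_real (psi n x) * u x) \<le> norm (psi n x * psi n x + (cmod (u x))\<^sup>2)"
  proof (rule AE_I2)
    fix x
    have "0 \<le> (\<bar>psi n x\<bar> - cmod (u x))\<^sup>2" by simp
    then have "2 * (\<bar>psi n x\<bar> * cmod (u x)) \<le> psi n x * psi n x + (cmod (u x))\<^sup>2"
      by (simp add: power2_diff) (simp add: power2_eq_square)
    moreover have "0 \<le> \<bar>psi n x\<bar> * cmod (u x)" by simp
    ultimately have "\<bar>psi n x\<bar> * cmod (u x) \<le> psi n x * psi n x + (cmod (u x))\<^sup>2" by linarith
    then show "norm (complex_of_real (psi n x) * u x) \<le> norm (psi n x * psi n x + (cmod (u x))\<^sup>2)"
      by (simp add: norm_mult)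
  qed
qed

lemma hermite_sum_square:
  fixes c :: "nat \<Rightarrow> complex"
  assumes "finite A"
  defines "S \<equiv> \<lambda>x. \<Sum>n\<in>A. complex_of_real (psi n x) * c n"
  shows "S \<in> L2_fun" "(\<integral>x. (cmod (S x))\<^sup>2 \<partial>lborel) = (\<Sum>n\<in>A. (cmod (c n))\<^sup>2)"
proof -
  let ?T = "\<lambda>x. \<Sum>n\<in>A. \<Sum>m\<in>A. complex_of_real (psi n x * psi m x) * (c n * cnj (c m))"
  have eq: "complex_of_real ((cmod (S x))\<^sup>2) = ?T x" for x
    unfolding S_def complex_norm_square by (simp add: sum_product mult_ac)
  have i: "integrable lborel (\<lambda>x. complex_of_real (psi n x * psi m x) * (c n * cnj (c m)))" for n m
    by (intro integrable_mult_left integrable_of_real integrable_psi_psi)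
  have "integrable lborel ?T" by (intro Bochner_Integration.integrable_sum i)
  then have int: "integrable lborel (\<lambda>x. (cmod (S x))\<^sup>2)"
    unfolding eq[symmetric] by (simp only: complex_of_real_integrable_eq)
  moreover have "S \<in> borel_measurable borel" unfolding S_def by measurable
  ultimately show "S \<in> L2_fun" by (simp add: L2_fun_def)
  have "complex_of_real (\<integral>x. (cmod (S x))\<^sup>2 \<partial>lborel) = (\<integral>x. ?T x \<partial>lborel)"
    unfolding eq[symmetric] by (rule integral_complex_of_real[symmetric])
  also have "\<dots> = (\<Sum>n\<in>A. \<Sum>m\<in>A. (\<integral>x. complex_of_real (psi n x * psi m x) * (c n * cnj (c m)) \<partial>lborel))"
    by (subst Bochner_Integration.integral_sum, intro Bochner_Integration.integrable_sum i,
        subst Bochner_Integration.integral_sum, intro i, rule refl)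
  also have "\<dots> = (\<Sum>n\<in>A. \<Sum>m\<in>A. if n = m then c n * cnj (c m) else 0)"
  proof (intro sum.cong refl)
    fix n m
    have "(\<integral>x. complex_of_real (psi n x * psi m x) * (c n * cnj (c m)) \<partial>lborel)
        = (\<integral>x. complex_of_real (psi n x * psi m x) \<partial>lborel) * (c n * cnj (c m))"
      by (rule integral_mult_left_zero)
    also have "\<dots> = (if n = m then c n * cnj (c m) else 0)"
      unfolding integral_complex_of_real psi_orthonormal by simp
    finally show "(\<integral>x. complex_of_real (psi n x * psi m x) * (c n * cnj (c m)) \<partial>lborel) = (if n = m then c n * cnj (c m) else 0)" .
  qed
  also have "\<dots> = (\<Sum>n\<in>A. c n * cnj (c n))" using assms(1) by (simp add: sum.delta)
  also have "\<dots> = complex_of_real (\<Sum>n\<in>A. (cmod (c n))\<^sup>2)" by (simp flip: complex_norm_square)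
  finally show "(\<integral>x. (cmod (S x))\<^sup>2 \<partial>lborel) = (\<Sum>n\<in>A. (cmod (c n))\<^sup>2)"
    by (simp only: of_real_eq_iff)
qed

lemma Bessel_inequality:
  assumes u: "u \<in> L2_fun"
  shows "L2_set (\<lambda>n. cmod (fcoef u n)) {..<N} \<le> L2_norm u"
proof -
  define S where "S = (\<lambda>x. \<Sum>n<N. complex_of_real (psi n x) * fcoef u n)"
  let ?s = "\<Sum>n<N. (cmod (fcoef u n))\<^sup>2"
  have S: "S \<in> L2_fun" "(\<integral>x. (cmod (S x))\<^sup>2 \<partial>lborel) = ?s"
    unfolding S_def by (rule hermite_sum_square, simp)+
  let ?C = "\<lambda>x. \<Sum>n<N. cnj (fcoef u n) * (complex_of_real (psi n x) * u x)"
  have C: "integrable lborel ?C"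
    by (intro Bochner_Integration.integrable_sum integrable_mult_right integrable_psi_L2 u)
  have "(\<integral>x. ?C x \<partial>lborel) = (\<Sum>n<N. (\<integral>x. cnj (fcoef u n) * (complex_of_real (psi n x) * u x) \<partial>lborel))"
    by (intro Bochner_Integration.integral_sum integrable_mult_right integrable_psi_L2 u)
  also have "\<dots> = (\<Sum>n<N. cnj (fcoef u n) * fcoef u n)"
    by (intro sum.cong refl) (simp only: integral_mult_right_zero fcoef_def)
  also have "\<dots> = complex_of_real ?s" by (simp add: mult.commute flip: complex_norm_square)
  finally have IC: "(\<integral>x. ?C x \<partial>lborel) = complex_of_real ?s" .
  have u2: "integrable lborel (\<lambda>x. (cmod (u x))\<^sup>2)" and S2: "integrable lborel (\<lambda>x. (cmod (S x))\<^sup>2)"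
    using u S(1) by (auto simp: L2_fun_def)
  have eq: "(cmod (u x - S x))\<^sup>2 = (cmod (u x))\<^sup>2 - 2 * Re (?C x) + (cmod (S x))\<^sup>2" for x
  proof -
    have "?C x = cnj (S x) * u x" by (simp add: S_def sum_distrib_right sum_distrib_left mult_ac)
    moreover have "(cmod (a - b))\<^sup>2 = (cmod a)\<^sup>2 - 2 * Re (cnj b * a) + (cmod b)\<^sup>2" for a b
      unfolding cmod_power2 by (simp add: power2_eq_square algebra_simps)
    ultimately show ?thesis by simp
  qed
  have "0 \<le> (\<integral>x. (cmod (u x - S x))\<^sup>2 \<partial>lborel)" by simp
  also have "\<dots> = (\<integral>x. (cmod (u x))\<^sup>2 \<partial>lborel) - 2 * (\<integral>x. Re (?C x) \<partial>lborel) + (\<integral>x. (cmod (S x))\<^sup>2 \<partial>lborel)"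
    unfolding eq using u2 S2 integrable_Re[OF C] by simp
  also have "(\<integral>x. Re (?C x) \<partial>lborel) = ?s" using integral_Re[OF C] unfolding IC by simp
  finally have "?s \<le> (L2_norm u)\<^sup>2" unfolding S(2) L2_norm_power2 by simp
  then show ?thesis unfolding L2_set_def by (intro real_le_lsqrt L2_norm_nonneg) auto
qed

lemma cmod_fcoef_le: "u \<in> L2_fun \<Longrightarrow> cmod (fcoef u n) \<le> L2_norm u"
  by (rule order_trans[OF member_le_L2_set[of "{..<Suc n}" n "\<lambda>n. cmod (fcoef u n)"] Bessel_inequality]) auto

lemma fcoef_diff:
  "u \<in> L2_fun \<Longrightarrow> v \<in> L2_fun \<Longrightarrow> fcoef (\<lambda>x. u x - v x) n = fcoef u n - fcoef v n"
  unfolding fcoef_def by (simp add: right_diff_distrib integrable_psi_L2)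

lemma L2_fun_diff:
  assumes "u \<in> L2_fun" "v \<in> L2_fun" shows "(\<lambda>x. u x - v x) \<in> L2_fun"
proof -
  have u: "u \<in> borel_measurable borel" "v \<in> borel_measurable borel"
    and i: "integrable lborel (\<lambda>x. (cmod (u x))\<^sup>2)" "integrable lborel (\<lambda>x. (cmod (v x))\<^sup>2)"
    using assms by (auto simp: L2_fun_def)
  have "integrable lborel (\<lambda>x. (cmod (u x - v x))\<^sup>2)"
  proof (rule Bochner_Integration.integrable_bound)
    show "integrable lborel (\<lambda>x. 2 * (cmod (u x))\<^sup>2 + 2 * (cmod (v x))\<^sup>2)" using i by simp
    show "(\<lambda>x. (cmod (u x - v x))\<^sup>2) \<in> borel_measurable lborel" using u by simp
    show "AE x in lborel. norm ((cmod (u x - v x))\<^sup>2) \<le> norm (2 * (cmod (u x))\<^sup>2 + 2 * (cmod (v x))\<^sup>2)"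
    proof (rule AE_I2)
      fix x
      have "(cmod (u x - v x))\<^sup>2 \<le> (cmod (u x) + cmod (v x))\<^sup>2"
        by (intro power_mono norm_triangle_ineq4) auto
      also have "\<dots> \<le> 2 * (cmod (u x))\<^sup>2 + 2 * (cmod (v x))\<^sup>2"
        using zero_le_power2[of "cmod (u x) - cmod (v x)"] by (simp add: power2_sum power2_diff)
      finally show "norm ((cmod (u x - v x))\<^sup>2) \<le> norm (2 * (cmod (u x))\<^sup>2 + 2 * (cmod (v x))\<^sup>2)" by simp
    qed
  qed
  then show ?thesis using u by (simp add: L2_fun_def)
qed

definition modulate :: "real \<Rightarrow> (real \<Rightarrow> complex) \<Rightarrow> real \<Rightarrow> complex" where
  "modulate t u x = cis (- (t * x)) * u x"

lemma cmod_modulate: "cmod (modulate t u x) = cmod (u x)"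
  by (simp add: modulate_def norm_mult)

lemma measurable_cis [measurable]: "(\<lambda>x. cis (c * x)) \<in> borel_measurable borel"
  by (intro borel_measurable_continuous_onI continuous_intros)

lemma measurable_modulate: "u \<in> borel_measurable borel \<Longrightarrow> modulate t u \<in> borel_measurable borel"
  unfolding modulate_def[abs_def] using measurable_cis[of "- t"] by simp

lemma modulate_L2: "u \<in> L2_fun \<Longrightarrow> modulate t u \<in> L2_fun"
  using measurable_modulate[of u t] by (simp add: L2_fun_def cmod_modulate)

lemma L2_norm_modulate: "L2_norm (modulate t u) = L2_norm u"
  by (simp add: L2_norm_def cmod_modulate)

section \<open>The intertwining of the Jacobi operator with multiplication by
  \<open>x\<close>\<close>

lemma Phi_fin_eq:
  assumes "finite A" "{n. F n \<noteq> 0} \<subseteq> A"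
  shows "Phi_fin F x = (\<Sum>n\<in>A. complex_of_real (psi n x) * F n)"
proof -
  have "Phi_fin F x = (\<Sum>n | F n \<noteq> 0. complex_of_real (psi n x) * F n)"
    unfolding Phi_fin_def sum_distrib_left by (intro sum.cong refl) (simp add: psi_def)
  also have "\<dots> = (\<Sum>n\<in>A. complex_of_real (psi n x) * F n)"
    using assms by (intro sum.mono_neutral_left) auto
  finally show ?thesis .
qed

lemma Phi_fin_L2:
  assumes "F \<in> finite_seqs"
  shows "Phi_fin F \<in> L2_fun" "L2_norm (Phi_fin F) = ell2_norm F"
proof -
  let ?A = "{n. F n \<noteq> 0}"
  have f: "finite ?A" using assms by (simp add: finite_seqs_def)
  have eq: "Phi_fin F = (\<lambda>x. \<Sum>n\<in>?A. complex_of_real (psi n x) * F n)"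
    using Phi_fin_eq[OF f order_refl] by auto
  show "Phi_fin F \<in> L2_fun" unfolding eq by (rule hermite_sum_square(1)[OF f])
  have "(\<Sum>n. (cmod (F n))\<^sup>2) = (\<Sum>n\<in>?A. (cmod (F n))\<^sup>2)" by (rule suminf_finite[OF f]) auto
  then show "L2_norm (Phi_fin F) = ell2_norm F"
    unfolding L2_norm_def ell2_norm_def eq hermite_sum_square(2)[OF f] by simp
qed

lemma Phi_fin_bounded:
  assumes "F \<in> finite_seqs" obtains B where "\<And>x. cmod (Phi_fin F x) \<le> B"
proof -
  let ?A = "{n. F n \<noteq> 0}"
  have f: "finite ?A" using assms by (simp add: finite_seqs_def)
  have "\<forall>n. \<exists>C. \<forall>x. \<bar>psi n x\<bar> \<le> C" using psi_bounded by metis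
  then obtain C where C: "\<And>n x. \<bar>psi n x\<bar> \<le> C n" by metis
  have "cmod (Phi_fin F x) \<le> (\<Sum>n\<in>?A. C n * cmod (F n))" for x
    unfolding Phi_fin_eq[OF f order_refl]
    by (intro sum_norm_le) (simp add: norm_mult C mult_right_mono)
  then show ?thesis by (rule that)
qed

lemma sum_shift_pred:
  fixes h :: "nat \<Rightarrow> complex"
  shows "(\<Sum>n<Suc M. if n = 0 then 0 else h (n - 1)) = (\<Sum>n<M. h n)"
  by (subst sum.lessThan_Suc_shift) simp

text \<open>Shifting indices moves the Jacobi matrix from the sequence onto the Hermite functions,
  where the recurrence turns it into multiplication by \<open>x\<close>.\<close>

lemma Phi_fin_Jform:
  assumes "F \<in> finite_seqs"
  shows "Phi_fin (Jform F) x = of_real x * Phi_fin F x"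
proof -
  have "finite {n. F n \<noteq> 0}" using assms by (simp add: finite_seqs_def)
  then obtain M where M: "\<And>n. F n \<noteq> 0 \<Longrightarrow> n < M"
    using finite_nat_set_iff_bounded by auto
  have F0: "F n = 0" if "n \<ge> M" for n using M[of n] that by force
  \<comment> \<open>The support bound has room to spare, so that after the shifts both halves of the
    sum can be written over \<open>n < Suc M\<close>.\<close>
  have J: "{n. Jform F n \<noteq> 0} \<subseteq> {..<Suc (Suc M)}"
  proof
    fix n assume "n \<in> {n. Jform F n \<noteq> 0}"
    moreover have "Jform F n = 0" if "n \<ge> Suc (Suc M)"
      using that by (simp add: Jform_eq F0)
    ultimately show "n \<in> {..<Suc (Suc M)}" by force
  qed
  let ?p = "\<lambda>n. complex_of_real (psi n x)" and ?a = "\<lambda>n. complex_of_real (hermite_a n)"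
  have rec: "of_real x * ?p n = (if n = 0 then 0 else ?a (n - 1) * ?p (n - 1)) + ?a n * ?p (Suc n)" for n
    using arg_cong[OF psi_recurrence[of x n], of complex_of_real] by (simp split: if_splits)
  have "Phi_fin (Jform F) x = (\<Sum>n<Suc (Suc M). ?p n * Jform F n)"
    by (rule Phi_fin_eq[OF _ J]) simp
  also have "\<dots> = (\<Sum>n<Suc (Suc M). (if n = 0 then 0 else ?a (n - 1) * ?p (Suc (n - 1)) * F (n - 1)) + ?a n * ?p n * F (Suc n))"
    by (intro sum.cong refl) (auto simp: Jform_eq algebra_simps)
  also have "\<dots> = (\<Sum>n<Suc M. ?a n * ?p (Suc n) * F n) + (\<Sum>n<Suc (Suc M). ?a n * ?p n * F (Suc n))"
    unfolding sum.distrib sum_shift_pred[where h = "\<lambda>n. ?a n * ?p (Suc n) * F n"] by simp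
  also have "(\<Sum>n<Suc (Suc M). ?a n * ?p n * F (Suc n)) = (\<Sum>n<M. ?a n * ?p n * F (Suc n))"
    by (simp add: F0)
  also have "\<dots> = (\<Sum>n<Suc M. if n = 0 then 0 else ?a (n - 1) * ?p (n - 1) * F (Suc (n - 1)))"
    by (rule sum_shift_pred[symmetric])
  also have "(\<Sum>n<Suc M. ?a n * ?p (Suc n) * F n) + \<dots> = (\<Sum>n<Suc M. of_real x * (?p n * F n))"
    unfolding sum.distrib[symmetric]
  proof (intro sum.cong refl)
    fix n
    show "?a n * ?p (Suc n) * F n + (if n = 0 then 0 else ?a (n - 1) * ?p (n - 1) * F (Suc (n - 1))) = of_real x * (?p n * F n)"
      unfolding mult.assoc[symmetric] rec by (auto simp: algebra_simps)
  qed
  also have "\<dots> = of_real x * Phi_fin F x"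
    unfolding sum_distrib_left[symmetric] using M by (subst Phi_fin_eq[of "{..<Suc M}"]) (auto simp: less_Suc_eq)
  finally show ?thesis .
qed

lemma integrable_psi_bounded:
  fixes u :: "real \<Rightarrow> complex"
  assumes "u \<in> borel_measurable borel" "\<And>x. cmod (u x) \<le> B"
  shows "integrable lborel (\<lambda>x. complex_of_real (psi n x) * u x)"
    "integrable lborel (\<lambda>x. complex_of_real (x * psi n x) * u x)"
  using integrable_psi_mult[OF assms, of 0 n] integrable_psi_mult[OF assms, of 1 n]
  by (simp_all add: scaleR_conv_of_real)

text \<open>The dual intertwining relation. Boundedness of \<open>u\<close> makes the separate
  integrals converge, so the recurrence can be split inside the integral.\<close>

lemma Jform_fcoef:
  assumes "u \<in> borel_measurable borel" "\<And>x. cmod (u x) \<le> B"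
  shows "Jform (fcoef u) n = (\<integral>x. complex_of_real (x * psi n x) * u x \<partial>lborel)"
proof -
  note i = integrable_psi_bounded(1)[OF assms]
  have "(\<integral>x. complex_of_real (x * psi n x) * u x \<partial>lborel) =
     (\<integral>x. (if n = 0 then 0 else hermite_a (n - 1) * (complex_of_real (psi (n - 1) x) * u x))
       + hermite_a n * (complex_of_real (psi (Suc n) x) * u x) \<partial>lborel)"
    by (intro Bochner_Integration.integral_cong refl, subst psi_recurrence) (auto simp: algebra_simps)
  also have "\<dots> = Jform (fcoef u) n"
    using i by (cases n) (simp_all add: Jform_eq fcoef_def)
  finally show ?thesis ..
qed

section \<open>Differentiation in the time parameter\<close>

lemma cmod_cis_diff_le: "cmod (cis a - cis b) \<le> \<bar>a - b\<bar>"
proof -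
  have "cis a - cis b = cis b * (cis (a - b) - 1)"
    by (simp add: right_diff_distrib cis_mult)
  then have "cmod (cis a - cis b) = cmod (iexp (a - b) - 1)"
    by (simp add: norm_mult cis_conv_exp)
  also have "\<dots> \<le> \<bar>a - b\<bar>" using iexp_approx1[of "a - b" 0] by simp
  finally show ?thesis .
qed

text \<open>Puts derivatives into difference-quotient form, the one used by
  \<open>group_generator\<close> and suited to dominated convergence.\<close>

lemma has_vector_derivative_iff_quotient:
  fixes f :: "real \<Rightarrow> complex"
  shows "(f has_vector_derivative D) (at t) \<longleftrightarrow>
    ((\<lambda>s. (f s - f t) / of_real (s - t)) \<longlongrightarrow> D) (at t)"
proof -
  have "(f has_vector_derivative D) (at t) \<longleftrightarrow>
      ((\<lambda>s. norm ((f s - f t) - (s - t) *\<^sub>R D) / norm (s - t)) \<longlongrightarrow> 0) (at t)"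
    unfolding has_vector_derivative_def has_derivative_iff_norm
    by (simp add: bounded_linear_scaleR_left)
  also have "\<dots> \<longleftrightarrow> ((\<lambda>s. norm ((f s - f t) / of_real (s - t) - D)) \<longlongrightarrow> 0) (at t)"
  proof (rule filterlim_cong[OF refl refl], unfold eventually_at_filter, rule always_eventually, safe)
    fix s assume "s \<noteq> t"
    then have "(f s - f t) / of_real (s - t) - D = ((f s - f t) - (s - t) *\<^sub>R D) / of_real (s - t)"
      by (simp add: diff_divide_distrib scaleR_conv_of_real)
    then show "norm ((f s - f t) - (s - t) *\<^sub>R D) / norm (s - t) = norm ((f s - f t) / of_real (s - t) - D)"
      by (simp add: norm_divide del: of_real_diff)
  qed
  also have "\<dots> \<longleftrightarrow> ((\<lambda>s. (f s - f t) / of_real (s - t)) \<longlongrightarrow> D) (at t)"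
    by (simp add: tendsto_norm_zero_iff Lim_null[symmetric])
  finally show ?thesis .
qed

lemma cis_linear_derivative:
  "((\<lambda>x. cis (- (c * x))) has_vector_derivative (- c) *\<^sub>R (\<i> * cis (- (c * x)))) (at x)"
proof -
  have "((\<lambda>x. - (c * x)) has_real_derivative - c) (at x)"
    by (auto intro!: derivative_eq_intros)
  then have "((\<lambda>x. - (c * x)) has_derivative (\<lambda>h. h * (- c))) (at x)"
    unfolding has_field_derivative_def by (rule has_derivative_eq_rhs) (simp add: fun_eq_iff mult.commute)
  from has_derivative_cis[OF this] show ?thesis
    by (simp add: has_vector_derivative_def scaleR_conv_of_real mult_ac)
qed

text \<open>By \<open>cmod_cis_diff_le\<close> the difference quotients are dominated by
  \<open>cmod (of_real x * w x)\<close>, whose integrability is the second assumption.\<close>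

lemma cis_integral_derivative:
  fixes w :: "real \<Rightarrow> complex"
  assumes w: "integrable lborel w" and xw: "integrable lborel (\<lambda>x. of_real x * w x)"
  shows "((\<lambda>t. \<integral>x. cis (- (t * x)) * w x \<partial>lborel) has_vector_derivative
    (- \<i> * (\<integral>x. cis (- (t * x)) * (of_real x * w x) \<partial>lborel))) (at t)"
proof -
  have wm [measurable]: "w \<in> borel_measurable borel" using w by auto
  have cm [measurable]: "(\<lambda>x. cis (- (s * x))) \<in> borel_measurable borel" for s
    using measurable_cis[of "- s"] by simp
  have int: "integrable lborel (\<lambda>x. cis (- (s * x)) * w x)" for s
    by (rule Bochner_Integration.integrable_bound[OF w]) (auto simp: norm_mult)
  have "((\<lambda>s. ((\<integral>x. cis (- (s * x)) * w x \<partial>lborel) - (\<integral>x. cis (- (t * x)) * w x \<partial>lborel)) / of_real (s - t))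
    \<longlongrightarrow> (\<integral>x. - \<i> * (cis (- (t * x)) * (of_real x * w x)) \<partial>lborel)) (at t)"
    unfolding tendsto_at_iff_sequentially o_def
  proof safe
    fix X assume X: "\<forall>i. X i \<in> UNIV - {t}" "X \<longlonglongrightarrow> t"
    have eq: "((\<integral>x. cis (- (s * x)) * w x \<partial>lborel) - (\<integral>x. cis (- (t * x)) * w x \<partial>lborel)) / of_real (s - t)
       = (\<integral>x. (cis (- (s * x)) - cis (- (t * x))) / of_real (s - t) * w x \<partial>lborel)" for s
    proof -
      have "((\<integral>x. cis (- (s * x)) * w x \<partial>lborel) - (\<integral>x. cis (- (t * x)) * w x \<partial>lborel)) / of_real (s - t)
         = (\<integral>x. (cis (- (s * x)) * w x - cis (- (t * x)) * w x) / of_real (s - t) \<partial>lborel)"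
        by (simp only: Bochner_Integration.integral_diff[OF int int] integral_divide_zero)
      also have "\<dots> = (\<integral>x. (cis (- (s * x)) - cis (- (t * x))) / of_real (s - t) * w x \<partial>lborel)"
        by (simp only: left_diff_distrib times_divide_eq_left)
      finally show ?thesis .
    qed
    show "(\<lambda>i. ((\<integral>x. cis (- (X i * x)) * w x \<partial>lborel) - (\<integral>x. cis (- (t * x)) * w x \<partial>lborel)) / of_real (X i - t))
      \<longlonglongrightarrow> (\<integral>x. - \<i> * (cis (- (t * x)) * (of_real x * w x)) \<partial>lborel)"
      unfolding eq
    proof (rule integral_dominated_convergence)
      show "integrable lborel (\<lambda>x. cmod (of_real x * w x))" by (intro integrable_norm xw)
      show "AE x in lborel. (\<lambda>i. (cis (- (X i * x)) - cis (- (t * x))) / of_real (X i - t) * w x)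
          \<longlonglongrightarrow> - \<i> * (cis (- (t * x)) * (of_real x * w x))"
      proof (rule AE_I2)
        fix x
        have "((\<lambda>s. cis (- (s * x))) has_vector_derivative (- x) *\<^sub>R (\<i> * cis (- (t * x)))) (at t)"
          using cis_linear_derivative[of x t] by (simp only: mult.commute[of x])
        then have "((\<lambda>s. (cis (- (s * x)) - cis (- (t * x))) / of_real (s - t)) \<longlongrightarrow> (- x) *\<^sub>R (\<i> * cis (- (t * x)))) (at t)"
          unfolding has_vector_derivative_iff_quotient .
        then have "(\<lambda>i. (cis (- (X i * x)) - cis (- (t * x))) / of_real (X i - t)) \<longlonglongrightarrow> (- x) *\<^sub>R (\<i> * cis (- (t * x)))"
          using X unfolding tendsto_at_iff_sequentially o_def by blast
        from tendsto_mult[OF this tendsto_const[of "w x"]]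
        show "(\<lambda>i. (cis (- (X i * x)) - cis (- (t * x))) / of_real (X i - t) * w x)
          \<longlonglongrightarrow> - \<i> * (cis (- (t * x)) * (of_real x * w x))"
          by (simp add: scaleR_conv_of_real mult_ac)
      qed
      show "AE x in lborel. norm ((cis (- (X i * x)) - cis (- (t * x))) / of_real (X i - t) * w x) \<le> cmod (of_real x * w x)" for i
      proof (rule AE_I2)
        fix x
        have ne: "X i \<noteq> t" using X by auto
        have "cmod (cis (- (X i * x)) - cis (- (t * x))) \<le> \<bar>X i - t\<bar> * \<bar>x\<bar>"
        proof -
          have "- (X i * x) - - (t * x) = - ((X i - t) * x)" by (simp add: algebra_simps)
          then have "\<bar>- (X i * x) - - (t * x)\<bar> = \<bar>X i - t\<bar> * \<bar>x\<bar>" by (simp only: abs_minus_cancel abs_mult)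
          then show ?thesis using cmod_cis_diff_le[of "- (X i * x)" "- (t * x)"] by (simp only:)
        qed
        then have "cmod ((cis (- (X i * x)) - cis (- (t * x))) / of_real (X i - t)) \<le> \<bar>x\<bar>"
          using ne by (simp add: norm_divide divide_le_eq mult.commute del: of_real_diff)
        then show "norm ((cis (- (X i * x)) - cis (- (t * x))) / of_real (X i - t) * w x) \<le> cmod (of_real x * w x)"
          unfolding norm_mult by (intro mult_right_mono) auto
      qed
    qed (use X in \<open>auto intro!: borel_measurable_times borel_measurable_divide borel_measurable_diff\<close>)
  qed
  then show ?thesis unfolding has_vector_derivative_iff_quotient
    by (simp only: integral_mult_right_zero)
qed

lemma modulate_evolution:
  assumes u: "u \<in> borel_measurable borel" "\<And>x. cmod (u x) \<le> B"
  shows "evolution_solution (\<lambda>t. fcoef (modulate t u))"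
  unfolding evolution_solution_def
proof (intro allI)
  fix n t
  have mu: "modulate t u \<in> borel_measurable borel" "\<And>x. cmod (modulate t u x) \<le> B" for t
    using measurable_modulate[OF u(1)] u(2) by (simp_all add: cmod_modulate)
  have J: "Jform (fcoef (modulate t u)) n = (\<integral>x. cis (- (t * x)) * (of_real x * (complex_of_real (psi n x) * u x)) \<partial>lborel)" for t
    unfolding Jform_fcoef[OF mu] by (intro Bochner_Integration.integral_cong) (auto simp: modulate_def mult_ac)
  have f: "fcoef (modulate t u) n = (\<integral>x. cis (- (t * x)) * (complex_of_real (psi n x) * u x) \<partial>lborel)" for t
    unfolding fcoef_def by (intro Bochner_Integration.integral_cong) (auto simp: modulate_def mult_ac)
  show "((\<lambda>t. fcoef (modulate t u) n) has_vector_derivative - \<i> * Jform (fcoef (modulate t u)) n) (at t)"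
    unfolding f J
    by (rule cis_integral_derivative)
      (use integrable_psi_bounded[OF u, of n] in \<open>simp_all add: mult_ac\<close>)
qed

section \<open>The unitary group generated by the Jacobi operator\<close>

definition kernel :: "real \<Rightarrow> nat \<Rightarrow> nat \<Rightarrow> complex" where
  "kernel t n m = fcoef (modulate t (\<lambda>x. complex_of_real (psi m x))) n"

text \<open>The group is given by its matrix and not by conjugating with \<open>Phi\<close>, whose
  values are classes of functions: this makes it a plain map on sequences. The link to
  \<open>Phi\<close> is recovered in \<open>propagator_eq_fcoef\<close>.\<close>

definition propagator :: "real \<Rightarrow> (nat \<Rightarrow> complex) \<Rightarrow> nat \<Rightarrow> complex" where
  "propagator t f n = (\<Sum>m. kernel t n m * f m)"

definition unit_seq :: "nat \<Rightarrow> nat \<Rightarrow> complex" where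
  "unit_seq m n = (if n = m then 1 else 0)"

lemma unit_seq_finite: "unit_seq m \<in> finite_seqs"
  by (simp add: unit_seq_def finite_seqs_def)

lemma ell2_norm_unit_seq: "ell2_norm (unit_seq m) = 1"
proof -
  have "(\<Sum>n. (cmod (unit_seq m n))\<^sup>2) = (\<Sum>n\<in>{m}. (cmod (unit_seq m n))\<^sup>2)"
    by (rule suminf_finite) (auto simp: unit_seq_def)
  then show ?thesis by (simp add: ell2_norm_def unit_seq_def)
qed

lemma psi_L2: "(\<lambda>x. complex_of_real (psi m x)) \<in> L2_fun"
  using hermite_sum_square(1)[of "{m}" "\<lambda>_. 1"] by simp

text \<open>Holds because the Hermite functions are real. Bessel's inequality controls the columns
  of the matrix, and symmetry carries this over to the rows summed in
  \<open>propagator\<close>.\<close>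

lemma kernel_sym: "kernel t n m = kernel t m n"
  unfolding kernel_def fcoef_def modulate_def by (simp add: mult_ac)

lemma kernel_ell2: "kernel t n \<in> ell2"
proof -
  have eq: "kernel t n = fcoef (modulate t (\<lambda>x. complex_of_real (psi n x)))"
    using kernel_sym by (auto simp: kernel_def)
  show ?thesis unfolding eq
    by (rule ell2I, rule Bessel_inequality, intro modulate_L2 psi_L2)
qed

lemma propagator_summable: "f \<in> ell2 \<Longrightarrow> summable (\<lambda>m. kernel t n m * f m)"
  by (rule ell2_mult_summable(1)[OF kernel_ell2])

lemma propagator_add: "f \<in> ell2 \<Longrightarrow> g \<in> ell2 \<Longrightarrow> propagator t (\<lambda>n. f n + g n) = (\<lambda>n. propagator t f n + propagator t g n)"
  unfolding propagator_def by (simp add: distrib_left suminf_add propagator_summable)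

lemma propagator_diff: "f \<in> ell2 \<Longrightarrow> g \<in> ell2 \<Longrightarrow> propagator t (\<lambda>n. f n - g n) n = propagator t f n - propagator t g n"
  unfolding propagator_def by (simp add: right_diff_distrib suminf_diff propagator_summable)

lemma propagator_scale: "f \<in> ell2 \<Longrightarrow> propagator t (\<lambda>n. c * f n) = (\<lambda>n. c * propagator t f n)"
  unfolding propagator_def by (simp add: mult.left_commute[of _ c] suminf_mult propagator_summable)

lemma propagator_finite:
  assumes F: "F \<in> finite_seqs"
  shows "propagator t F = fcoef (modulate t (Phi_fin F))"
proof
  fix n
  let ?A = "{n. F n \<noteq> 0}"
  have f: "finite ?A" using F by (simp add: finite_seqs_def)
  have "propagator t F n = (\<Sum>m\<in>?A. kernel t n m * F m)"
    unfolding propagator_def by (rule suminf_finite[OF f]) auto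
  also have "\<dots> = (\<Sum>m\<in>?A. (\<integral>x. complex_of_real (psi n x) * modulate t (\<lambda>x. complex_of_real (psi m x)) x * F m \<partial>lborel))"
    unfolding kernel_def fcoef_def by simp
  also have "\<dots> = (\<integral>x. (\<Sum>m\<in>?A. complex_of_real (psi n x) * modulate t (\<lambda>x. complex_of_real (psi m x)) x * F m) \<partial>lborel)"
    by (intro Bochner_Integration.integral_sum[symmetric] integrable_mult_left integrable_psi_L2 modulate_L2 psi_L2)
  also have "\<dots> = fcoef (modulate t (Phi_fin F)) n"
    unfolding fcoef_def modulate_def Phi_fin_eq[OF f order_refl] by (simp add: sum_distrib_left mult.assoc)
  finally show "propagator t F n = fcoef (modulate t (Phi_fin F)) n" .
qed

text \<open>For finite sequences this is Bessel's inequality for the modulated function. The bound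
  on each finite section passes to the coordinatewise limit along truncations.\<close>

lemma propagator_contraction:
  assumes f: "f \<in> ell2"
  shows "propagator t f \<in> ell2" "ell2_norm (propagator t f) \<le> ell2_norm f"
proof -
  have fin: "L2_set (\<lambda>n. cmod (propagator t F n)) {..<N} \<le> ell2_norm F" if "F \<in> finite_seqs" for F N
    unfolding propagator_finite[OF that]
    using Bessel_inequality[OF modulate_L2[OF Phi_fin_L2(1)[OF that]]]
    by (simp add: L2_norm_modulate Phi_fin_L2(2)[OF that])
  have b: "L2_set (\<lambda>n. cmod (propagator t f n)) {..<N} \<le> ell2_norm f" for N
  proof (rule LIMSEQ_le_const2)
    have eq: "propagator t (trunc f M) n = (\<Sum>m<M. kernel t n m * f m)" for M n
      unfolding propagator_def by (subst suminf_finite[of "{..<M}"]) (auto simp: trunc_def)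
    have "(\<lambda>M. propagator t (trunc f M) n) \<longlonglongrightarrow> propagator t f n" for n
      unfolding eq propagator_def[of t f] by (rule summable_LIMSEQ[OF propagator_summable[OF f]])
    then show "(\<lambda>M. L2_set (\<lambda>n. cmod (propagator t (trunc f M) n)) {..<N}) \<longlonglongrightarrow> L2_set (\<lambda>n. cmod (propagator t f n)) {..<N}"
      unfolding L2_set_def by (intro tendsto_intros)
    show "\<exists>K. \<forall>M\<ge>K. L2_set (\<lambda>n. cmod (propagator t (trunc f M) n)) {..<N} \<le> ell2_norm f"
      using order_trans[OF fin[OF trunc_finite] ell2_norm_trunc_le[OF f]] by blast
  qed
  show "propagator t f \<in> ell2" by (rule ell2I[OF b])
  show "ell2_norm (propagator t f) \<le> ell2_norm f" by (rule ell2_norm_le[OF b])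
qed

lemma cmod_prop_le: "f \<in> ell2 \<Longrightarrow> cmod (propagator t f n) \<le> ell2_norm f"
  using norm_component_le_ell2_norm propagator_contraction order_trans by metis

lemma propagator_tendsto:
  assumes "((\<lambda>k. ell2_norm (\<lambda>n. F k n - f n)) \<longlongrightarrow> 0) G" "\<And>k. F k \<in> ell2" "f \<in> ell2"
  shows "((\<lambda>k. propagator t (F k) n) \<longlongrightarrow> propagator t f n) G"
  unfolding tendsto_dist_iff[of "\<lambda>k. propagator t (F k) n"]
proof (rule tendsto_sandwich[OF _ _ tendsto_const assms(1)])
  show "\<forall>\<^sub>F k in G. dist (propagator t (F k) n) (propagator t f n) \<le> ell2_norm (\<lambda>n. F k n - f n)"
    using cmod_prop_le[OF ell2_minus[OF assms(2,3)]] by (simp add: dist_norm propagator_diff assms(2,3))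
qed auto

text \<open>Holds for finite sequences by differentiation under the integral. For general
  \<open>f\<close> the derivatives of the truncations converge uniformly in \<open>t\<close>, since
  the contraction bound does not depend on \<open>t\<close>.\<close>

lemma propagator_evolution:
  assumes f: "f \<in> ell2"
  shows "evolution_solution (\<lambda>t. propagator t f)"
  unfolding evolution_solution_def
proof (intro allI)
  fix n t
  have tr: "trunc f N \<in> ell2" for N using trunc_finite finite_seqs_subset_ell2 by auto
  have fin: "evolution_solution (\<lambda>t. propagator t F)" if F: "F \<in> finite_seqs" for F
  proof -
    obtain B where "\<And>x. cmod (Phi_fin F x) \<le> B" using Phi_fin_bounded[OF F] by metis
    from modulate_evolution[OF L2_fun_measurable[OF Phi_fin_L2(1)[OF F]] this]
    show ?thesis by (simp add: propagator_finite[OF F])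
  qed
  let ?D = "\<lambda>F t. - \<i> * Jform (propagator t F) n"
  have "\<exists>g. \<forall>t\<in>UNIV. (\<lambda>N. propagator t (trunc f N) n) \<longlonglongrightarrow> g t \<and> (g has_derivative (\<lambda>h. h *\<^sub>R ?D f t)) (at t within UNIV)"
  proof (rule has_derivative_sequence)
    show "((\<lambda>t. propagator t (trunc f N) n) has_derivative (\<lambda>h. h *\<^sub>R ?D (trunc f N) t)) (at t within UNIV)" for N t
      using fin[OF trunc_finite] by (simp add: evolution_solution_def has_vector_derivative_def)
    show "(\<lambda>N. propagator 0 (trunc f N) n) \<longlonglongrightarrow> propagator 0 f n"
      by (rule propagator_tendsto[OF trunc_tendsto[OF f] tr f])
    fix e :: real assume e: "0 < e"
    have "(\<lambda>N. 2 * hermite_a n * ell2_norm (\<lambda>n. trunc f N n - f n)) \<longlonglongrightarrow> 2 * hermite_a n * 0"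
      by (intro tendsto_intros trunc_tendsto f)
    then have "\<forall>\<^sub>F N in sequentially. 2 * hermite_a n * ell2_norm (\<lambda>n. trunc f N n - f n) < e"
      using e by (intro order_tendstoD(2)) auto
    then show "\<forall>\<^sub>F N in sequentially. \<forall>t\<in>UNIV. \<forall>h. norm (h *\<^sub>R ?D (trunc f N) t - h *\<^sub>R ?D f t) \<le> e * norm h"
    proof (eventually_elim, intro ballI allI)
      fix N t and h :: real
      assume N: "2 * hermite_a n * ell2_norm (\<lambda>n. trunc f N n - f n) < e"
      have "cmod (propagator t (trunc f N) m - propagator t f m) \<le> ell2_norm (\<lambda>n. trunc f N n - f n)" for m
        using cmod_prop_le[OF ell2_minus[OF tr f]] by (simp add: propagator_diff tr f)
      then have "cmod (Jform (\<lambda>m. propagator t (trunc f N) m - propagator t f m) n) \<le> 2 * hermite_a n * ell2_norm (\<lambda>n. trunc f N n - f n)"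
        by (rule cmod_Jform_le)
      then have "cmod (Jform (propagator t (trunc f N)) n - Jform (propagator t f) n) \<le> e"
        using N by (simp add: Jform_diff)
      moreover have "h *\<^sub>R ?D (trunc f N) t - h *\<^sub>R ?D f t = h *\<^sub>R (- \<i> * (Jform (propagator t (trunc f N)) n - Jform (propagator t f) n))"
        by (simp add: algebra_simps)
      ultimately show "norm (h *\<^sub>R ?D (trunc f N) t - h *\<^sub>R ?D f t) \<le> e * norm h"
        using mult_right_mono[of _ e "\<bar>h\<bar>"] by (simp only: norm_scaleR norm_mult norm_minus_cancel norm_ii mult_1 mult.commute[of "\<bar>h\<bar>"] real_norm_def abs_ge_zero)
    qed
  qed auto
  then obtain g where g: "\<And>t. (\<lambda>N. propagator t (trunc f N) n) \<longlonglongrightarrow> g t" "\<And>t. (g has_derivative (\<lambda>h. h *\<^sub>R ?D f t)) (at t)"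
    by auto
  have "g = (\<lambda>t. propagator t f n)"
    using LIMSEQ_unique[OF g(1) propagator_tendsto[OF trunc_tendsto[OF f] tr f]] by auto
  with g(2) show "((\<lambda>t. propagator t f n) has_vector_derivative ?D f t) (at t)"
    by (simp add: has_vector_derivative_def)
qed

lemma propagator_0: "propagator 0 f = f"
proof
  fix n
  have "kernel 0 n m = (if m = n then 1 else 0)" for m
  proof -
    have "kernel 0 n m = (\<integral>x. complex_of_real (psi n x * psi m x) \<partial>lborel)"
      unfolding kernel_def fcoef_def modulate_def by simp
    then show ?thesis unfolding integral_complex_of_real psi_orthonormal by simp
  qed
  then have "propagator 0 f n = (\<Sum>m. if m = n then f m else 0)"
    unfolding propagator_def by (intro suminf_cong) auto
  also have "\<dots> = (\<Sum>m\<in>{n}. if m = n then f m else 0)" by (rule suminf_finite) auto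
  finally show "propagator 0 f n = f n" by simp
qed

lemma propagator_group:
  assumes f: "f \<in> ell2"
  shows "propagator (s + t) f = propagator s (propagator t f)"
proof (rule evolution_solution_unique[where x = "\<lambda>s. propagator (s + t) f" and y = "\<lambda>s. propagator s (propagator t f)"])
  show "evolution_solution (\<lambda>s. propagator (s + t) f)"
    unfolding evolution_solution_def
  proof (intro allI)
    fix n s
    have "((\<lambda>s. s + t) has_vector_derivative 1) (at s)"
      by (auto intro!: derivative_eq_intros)
    moreover have "((\<lambda>t. propagator t f n) has_vector_derivative - \<i> * Jform (propagator (s + t) f) n) (at (s + t))"
      using propagator_evolution[OF f] by (simp add: evolution_solution_def)
    ultimately show "((\<lambda>s. propagator (s + t) f n) has_vector_derivative - \<i> * Jform (propagator (s + t) f) n) (at s)"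
      using vector_diff_chain_at by (fastforce simp: o_def)
  qed
  show "evolution_solution (\<lambda>s. propagator s (propagator t f))"
    by (intro propagator_evolution propagator_contraction f)
  show "cmod (propagator (s + t) f n) \<le> ell2_norm f" for s n by (rule cmod_prop_le[OF f])
  show "cmod (propagator s (propagator t f) n) \<le> ell2_norm (propagator t f)" for s n
    by (intro cmod_prop_le propagator_contraction f)
qed (simp add: propagator_0)

text \<open>Both \<open>propagator t\<close> and its inverse \<open>propagator (- t)\<close> are
  contractions, so neither can decrease the norm.\<close>

lemma propagator_unitary: "unitary_ell2 (propagator t)"
  unfolding unitary_ell2_def
proof (intro conjI ballI allI)
  have inv: "propagator (- t) (propagator t f) = f" if "f \<in> ell2" for f t
    using propagator_group[OF that, of "- t" t] by (simp add: propagator_0)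
  show "ell2_norm (propagator t f) = ell2_norm f" if "f \<in> ell2" for f
    using propagator_contraction(2)[OF that, of t] propagator_contraction(2)[OF propagator_contraction(1)[OF that], of "- t" t]
    by (simp add: inv[OF that])
  show "propagator t ` ell2 = ell2"
  proof (intro equalityI subsetI)
    fix f assume "f \<in> ell2"
    then have "f = propagator t (propagator (- t) f)" "propagator (- t) f \<in> ell2"
      using inv[of f "- t"] propagator_contraction(1) by auto
    then show "f \<in> propagator t ` ell2" by blast
  qed (auto intro: propagator_contraction)
qed (simp_all add: propagator_add propagator_scale)

text \<open>On finite sequences both sides are the Hermite coefficient of \<open>x\<close> times the
  modulated function. Cutoffs extend this to the whole domain, since they converge together with
  their images under \<open>Jform\<close>.\<close>

lemma propagator_Jform:
  assumes f: "f \<in> ell2" "Jform f \<in> ell2"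
  shows "Jform (propagator t f) n = propagator t (Jform f) n"
proof -
  have fin: "Jform (propagator t F) n = propagator t (Jform F) n" if F: "F \<in> finite_seqs" for F n
  proof -
    obtain B where B: "\<And>x. cmod (Phi_fin F x) \<le> B" using Phi_fin_bounded[OF F] by metis
    have "Jform (propagator t F) n = (\<integral>x. complex_of_real (x * psi n x) * modulate t (Phi_fin F) x \<partial>lborel)"
      unfolding propagator_finite[OF F]
      by (rule Jform_fcoef[OF measurable_modulate[OF L2_fun_measurable[OF Phi_fin_L2(1)[OF F]]], where B = B]) (simp add: cmod_modulate B)
    also have "\<dots> = propagator t (Jform F) n"
      unfolding propagator_finite[OF Jform_finite[OF F]] fcoef_def modulate_def Phi_fin_Jform[OF F]
      by (simp add: mult_ac)
    finally show ?thesis .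
  qed
  let ?F = "\<lambda>N n. complex_of_real (cutoff N n) * f n"
  have F: "?F N \<in> finite_seqs" "?F N \<in> ell2" "Jform (?F N) \<in> ell2" for N
    using cutoff_finite Jform_finite[OF cutoff_finite] finite_seqs_subset_ell2 by auto
  have "(\<lambda>N. Jform (propagator t (?F N)) n) \<longlonglongrightarrow> Jform (propagator t f) n"
    by (intro Jform_tendsto propagator_tendsto cutoff_tendsto f F)
  moreover have "(\<lambda>N. Jform (propagator t (?F N)) n) \<longlonglongrightarrow> propagator t (Jform f) n"
    unfolding fin[OF F(1)] by (rule propagator_tendsto[OF cutoff_Jform_tendsto[OF f] F(3) f(2)])
  ultimately show ?thesis by (rule LIMSEQ_unique)
qed

text \<open>The derivative of the sequence being estimated is \<open>- i\<close> times the
  difference in the hypothesis, so the mean value inequality applies. The zero sequence as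
  \<open>h\<close> gives Lipschitz continuity in time, and \<open>h = Jform f\<close> gives the
  generator.\<close>

lemma propagator_deviation:
  assumes f: "f \<in> ell2" "Jform f \<in> ell2" and h: "h \<in> ell2"
    and B: "\<And>s. \<bar>s\<bar> \<le> \<bar>t\<bar> \<Longrightarrow> ell2_norm (\<lambda>n. propagator s (Jform f) n - h n) \<le> B"
  shows "ell2_norm (\<lambda>n. propagator t f n - f n + \<i> * of_real t * h n) \<le> B * \<bar>t\<bar>"
proof -
  define x where "x s n = propagator s f n - f n + \<i> * of_real s * h n" for s n
  define x' where "x' s n = - \<i> * (propagator s (Jform f) n - h n)" for s n
  have "x t \<in> ell2 \<and> ell2_norm (x t) \<le> B * \<bar>t\<bar>"
  proof (rule ell2_mean_value)
    fix n s
    have "((\<lambda>s. propagator s f n) has_vector_derivative - \<i> * Jform (propagator s f) n) (at s)"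
      using propagator_evolution[OF f(1)] by (simp add: evolution_solution_def)
    moreover have "((\<lambda>s. \<i> * of_real s * h n) has_vector_derivative \<i> * h n) (at s)"
      by (rule derivative_eq_intros refl | simp)+
    ultimately have "((\<lambda>s. propagator s f n - f n + \<i> * of_real s * h n) has_vector_derivative (- \<i> * Jform (propagator s f) n - 0 + \<i> * h n)) (at s)"
      by (intro has_vector_derivative_add has_vector_derivative_diff has_vector_derivative_const)
    then show "((\<lambda>s. x s n) has_vector_derivative x' s n) (at s)"
      unfolding x_def x'_def propagator_Jform[OF f] by (simp add: algebra_simps)
  next
    fix s :: real assume "\<bar>s\<bar> \<le> \<bar>t\<bar>"
    moreover have d: "(\<lambda>n. propagator s (Jform f) n - h n) \<in> ell2"
      by (intro ell2_minus propagator_contraction f h)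
    ultimately show "x' s \<in> ell2 \<and> ell2_norm (x' s) \<le> B"
      unfolding x'_def using ell2_scale[OF d, of "- \<i>"] ell2_norm_scale[OF d, of "- \<i>"] B[of s] by simp
  qed (simp add: x_def propagator_0)
  moreover have "x t = (\<lambda>n. propagator t f n - f n + \<i> * of_real t * h n)" by (auto simp: x_def)
  ultimately show ?thesis by simp
qed

lemma propagator_continuous:
  assumes f: "f \<in> ell2"
  shows "((\<lambda>t. ell2_norm (\<lambda>n. propagator t f n - f n)) \<longlongrightarrow> 0) (at 0)"
proof (rule tendstoI)
  fix e :: real assume e: "0 < e"
  have "\<forall>\<^sub>F N in sequentially. ell2_norm (\<lambda>n. trunc f N n - f n) < e / 3"
    using trunc_tendsto[OF f] e by (intro order_tendstoD(2)) auto
  then obtain N where N: "ell2_norm (\<lambda>n. trunc f N n - f n) < e / 3"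
    by (meson eventually_happens trivial_limit_sequentially)
  define F where "F = trunc f N"
  have F: "F \<in> ell2" "Jform F \<in> ell2"
    using trunc_finite Jform_finite[OF trunc_finite] finite_seqs_subset_ell2 by (auto simp: F_def)
  have lip: "ell2_norm (\<lambda>n. propagator t F n - F n) \<le> ell2_norm (Jform F) * \<bar>t\<bar>" for t
    using propagator_deviation[OF F, of "\<lambda>_. 0" t "ell2_norm (Jform F)"] propagator_contraction(2)[OF F(2)]
    by (simp add: ell2_def)
  have "((\<lambda>t. ell2_norm (Jform F) * \<bar>t\<bar>) \<longlongrightarrow> ell2_norm (Jform F) * \<bar>0\<bar>) (at 0)"
    by (intro tendsto_intros)
  then have "\<forall>\<^sub>F t in at 0. ell2_norm (Jform F) * \<bar>t\<bar> < e / 3"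
    using e by (intro order_tendstoD(2)) auto
  then show "\<forall>\<^sub>F t in at 0. dist (ell2_norm (\<lambda>n. propagator t f n - f n)) 0 < e"
  proof eventually_elim
    fix t assume t: "ell2_norm (Jform F) * \<bar>t\<bar> < e / 3"
    note p = propagator_contraction(1)
    have "ell2_norm (\<lambda>n. propagator t f n - f n) \<le> ell2_norm (\<lambda>n. propagator t f n - propagator t F n) + ell2_norm (\<lambda>n. propagator t F n - f n)"
      by (intro ell2_norm_triangle3 p f F)
    also have "ell2_norm (\<lambda>n. propagator t f n - propagator t F n) \<le> ell2_norm (\<lambda>n. f n - F n)"
    proof -
      have "(\<lambda>n. propagator t f n - propagator t F n) = propagator t (\<lambda>n. f n - F n)"
        by (auto simp: propagator_diff[OF f F(1)])
      then show ?thesis using propagator_contraction(2)[OF ell2_minus[OF f F(1)], of t] by simp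
    qed
    also have "\<dots> < e / 3" using N by (simp add: F_def ell2_norm_minus_commute)
    also have "ell2_norm (\<lambda>n. propagator t F n - f n) \<le> ell2_norm (\<lambda>n. propagator t F n - F n) + ell2_norm (\<lambda>n. F n - f n)"
      by (intro ell2_norm_triangle3 p f F)
    also have "\<dots> < e / 3 + e / 3" using lip[of t] t N by (simp add: F_def)
    finally have "ell2_norm (\<lambda>n. propagator t f n - f n) < e" by simp
    then show "dist (ell2_norm (\<lambda>n. propagator t f n - f n)) 0 < e"
      using ell2_norm_nonneg[OF ell2_minus[OF p[OF f] f]] by simp
  qed
qed

lemma propagator_unitary_group: "unitary_group propagator"
  unfolding unitary_group_def using propagator_unitary propagator_group propagator_continuous by (simp add: propagator_0)

text \<open>Convergence of the quotients in norm forces it in each coordinate, where the limit is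
  known from the evolution equation. Conversely, strong continuity on \<open>Jform f\<close> makes
  the hypothesis of \<open>propagator_deviation\<close> hold with an arbitrarily small
  bound.\<close>

lemma propagator_generator: "group_generator propagator = Jmax"
proof (rule set_eqI, rule iffI)
  fix p assume p: "p \<in> group_generator propagator"
  obtain f h where ph: "p = (f, h)" by (cases p)
  have fh: "f \<in> ell2" "h \<in> ell2"
    and lim: "((\<lambda>t. ell2_norm (\<lambda>n. \<i> * (propagator t f n - f n) / complex_of_real t - h n)) \<longlongrightarrow> 0) (at 0)"
    using p unfolding ph group_generator_def by auto
  have q: "(\<lambda>n. \<i> * (propagator t f n - f n) / complex_of_real t) \<in> ell2" for t
    using ell2_scale[OF ell2_minus[OF propagator_contraction(1)[OF fh(1)] fh(1)], of "\<i> / complex_of_real t"]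
    by simp
  have "h n = Jform f n" for n
  proof -
    have "((\<lambda>t. \<i> * (propagator t f n - f n) / complex_of_real t) \<longlongrightarrow> h n) (at 0)"
      by (rule ell2_norm_tendsto_component[OF lim q fh(2)])
    moreover have "((\<lambda>t. propagator t f n) has_vector_derivative - \<i> * Jform (propagator 0 f) n) (at 0)"
      using propagator_evolution[OF fh(1)] by (simp add: evolution_solution_def)
    then have "((\<lambda>t. (propagator t f n - f n) / complex_of_real t) \<longlongrightarrow> - \<i> * Jform f n) (at 0)"
      unfolding has_vector_derivative_iff_quotient by (simp add: propagator_0)
    then have "((\<lambda>t. \<i> * ((propagator t f n - f n) / complex_of_real t)) \<longlongrightarrow> \<i> * (- \<i> * Jform f n)) (at 0)"
      by (intro tendsto_intros)
    then have "((\<lambda>t. \<i> * (propagator t f n - f n) / complex_of_real t) \<longlongrightarrow> Jform f n) (at 0)"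
      by (simp add: mult.assoc[symmetric])
    ultimately show ?thesis by (rule tendsto_unique[OF trivial_limit_at])
  qed
  then have "h = Jform f" by auto
  then show "p \<in> Jmax" using fh ph by (auto simp: Jmax_def)
next
  fix p assume "p \<in> Jmax"
  then obtain f where p: "p = (f, Jform f)" and f: "f \<in> ell2" "Jform f \<in> ell2" by (auto simp: Jmax_def)
  have "((\<lambda>t. ell2_norm (\<lambda>n. \<i> * (propagator t f n - f n) / complex_of_real t - Jform f n)) \<longlongrightarrow> 0) (at 0)"
  proof (rule tendstoI)
    fix e :: real assume e: "0 < e"
    have "\<forall>\<^sub>F s in at 0. ell2_norm (\<lambda>n. propagator s (Jform f) n - Jform f n) < e / 2"
      using propagator_continuous[OF f(2)] e by (intro order_tendstoD(2)) auto
    then obtain d where d: "d > 0" "\<And>s. s \<noteq> 0 \<Longrightarrow> \<bar>s\<bar> < d \<Longrightarrow> ell2_norm (\<lambda>n. propagator s (Jform f) n - Jform f n) < e / 2"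
      unfolding eventually_at by (auto simp: dist_norm)
    \<comment> \<open>The punctured limit says nothing at \<open>s = 0\<close>; there the difference
      is zero.\<close>
    have B: "ell2_norm (\<lambda>n. propagator s (Jform f) n - Jform f n) \<le> e / 2" if "\<bar>s\<bar> < d" for s
      using d(2)[of s] that e by (cases "s = 0") (auto simp: propagator_0 ell2_norm_def)
    show "\<forall>\<^sub>F t in at 0. dist (ell2_norm (\<lambda>n. \<i> * (propagator t f n - f n) / complex_of_real t - Jform f n)) 0 < e"
      unfolding eventually_at
    proof (intro exI[of _ d] conjI ballI impI d)
      fix t :: real assume t: "t \<noteq> 0 \<and> dist t 0 < d"
      let ?y = "\<lambda>n. propagator t f n - f n + \<i> * of_real t * Jform f n"
      have y: "?y \<in> ell2" by (intro ell2_add ell2_minus ell2_scale propagator_contraction f)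
      have "ell2_norm ?y \<le> e / 2 * \<bar>t\<bar>"
        by (rule propagator_deviation[OF f f(2)]) (use t B in auto)
      moreover have "(\<lambda>n. \<i> * (propagator t f n - f n) / complex_of_real t - Jform f n) = (\<lambda>n. (\<i> / complex_of_real t) * ?y n)"
        using t by (auto simp: field_simps)
      ultimately have "ell2_norm (\<lambda>n. \<i> * (propagator t f n - f n) / complex_of_real t - Jform f n) \<le> e / 2"
        using t ell2_norm_scale[OF y, of "\<i> / complex_of_real t"] by (simp add: norm_divide divide_le_eq mult.commute)
      moreover have "0 \<le> ell2_norm (\<lambda>n. \<i> * (propagator t f n - f n) / complex_of_real t - Jform f n)"
        by (intro ell2_norm_nonneg) (use ell2_minus[OF ell2_scale[OF ell2_minus[OF propagator_contraction(1)[OF f(1)] f(1)], of "\<i> / complex_of_real t"] f(2)] in simp)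
      ultimately show "dist (ell2_norm (\<lambda>n. \<i> * (propagator t f n - f n) / complex_of_real t - Jform f n)) 0 < e"
        using e by simp
    qed
  qed
  then show "p \<in> group_generator propagator" using f by (simp add: p group_generator_def)
qed

text \<open>For fixed \<open>n\<close> the numbers \<open>(V t (unit_seq m))\<^sub>n\<close>, as a sequence in \<open>m\<close>, solve the coordinatewise
  evolution equation, so they are determined by their values at time \<open>0\<close>.\<close>

lemma group_unit_seq_evolution:
  assumes V: "unitary_group V" and gen: "group_generator V = Jmax"
  shows "evolution_solution (\<lambda>t m. V t (unit_seq m) n)"
  unfolding evolution_solution_def
proof (intro allI)
  fix m t
  have un: "unitary_ell2 (V t)" for t using V by (simp add: unitary_group_def)
  have Vell: "V t f \<in> ell2" if "f \<in> ell2" for f t using un[of t] that by (auto simp: unitary_ell2_def)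
  have add: "V t (\<lambda>n. f n + g n) = (\<lambda>n. V t f n + V t g n)" if "f \<in> ell2" "g \<in> ell2" for f g t
    using un[of t] that by (auto simp: unitary_ell2_def)
  have scale: "V t (\<lambda>n. c * f n) = (\<lambda>n. c * V t f n)" if "f \<in> ell2" for f t c
    using un[of t] that by (auto simp: unitary_ell2_def)
  have diff: "V t (\<lambda>n. f n - g n) = (\<lambda>n. V t f n - V t g n)" if "f \<in> ell2" "g \<in> ell2" for f g t
    using add[OF that(1) ell2_scale[OF that(2), of "-1"]] scale[OF that(2), of t "-1"] by simp
  have iso: "ell2_norm (V t f) = ell2_norm f" if "f \<in> ell2" for f t
    using un[of t] that by (auto simp: unitary_ell2_def)
  have e: "unit_seq m \<in> ell2" for m using unit_seq_finite finite_seqs_subset_ell2 by auto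
  have Je: "Jform (unit_seq m) \<in> ell2" using Jform_finite[OF unit_seq_finite] finite_seqs_subset_ell2 by auto
  have "(unit_seq m, Jform (unit_seq m)) \<in> group_generator V"
    unfolding gen Jmax_def using e Je by auto
  then have lim: "((\<lambda>s. ell2_norm (\<lambda>n. \<i> * (V s (unit_seq m) n - unit_seq m n) / complex_of_real s - Jform (unit_seq m) n)) \<longlongrightarrow> 0) (at 0)"
    by (simp add: group_generator_def)
  \<comment> \<open>The symmetric Jacobi matrix moves from the sequence onto the index
    \<open>m\<close>: \<open>Jform (unit_seq m)\<close> combines the neighbouring unit vectors with
    the coefficients that \<open>Jform\<close> uses in row \<open>m\<close>.\<close>
  have JV: "V t (Jform (unit_seq m)) n = Jform (\<lambda>m. V t (unit_seq m) n) m"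
  proof (cases m)
    case 0
    have "Jform (unit_seq 0) = (\<lambda>k. hermite_a 0 * unit_seq (Suc 0) k)"
      by (auto simp: Jform_eq unit_seq_def)
    then show ?thesis using scale[OF e] by (simp add: 0 Jform_eq)
  next
    case (Suc j)
    have "Jform (unit_seq (Suc j)) = (\<lambda>k. hermite_a j * unit_seq j k + hermite_a (Suc j) * unit_seq (Suc (Suc j)) k)"
      by (auto simp: Jform_eq unit_seq_def fun_eq_iff)
    then show ?thesis using scale[OF e] add[OF ell2_scale[OF e] ell2_scale[OF e]] by (simp add: Suc Jform_eq)
  qed
  let ?q = "\<lambda>s k. \<i> * (V s (unit_seq m) k - unit_seq m k) / complex_of_real s"
  have q: "?q s \<in> ell2" for s
    using ell2_scale[OF ell2_minus[OF Vell[OF e] e], of "\<i> / complex_of_real s"] by simp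
  \<comment> \<open>By the group law, applying \<open>V t\<close> carries the difference quotient at
    time 0 to the one at time \<open>t\<close>. Since \<open>V t\<close> is an isometry, the norm
    limit is carried along.\<close>
  have Vq: "V t (?q s) n = \<i> * (V (t + s) (unit_seq m) n - V t (unit_seq m) n) / complex_of_real s" for s
  proof -
    have "V t (?q s) = V t (\<lambda>k. (\<i> / complex_of_real s) * (V s (unit_seq m) k - unit_seq m k))" by simp
    also have "\<dots> = (\<lambda>k. (\<i> / complex_of_real s) * (V t (V s (unit_seq m)) k - V t (unit_seq m) k))"
      by (subst scale, intro ell2_minus Vell e, subst diff, intro Vell e, rule e, rule refl)
    also have "V t (V s (unit_seq m)) = V (t + s) (unit_seq m)"
      using V e by (simp add: unitary_group_def)
    finally show ?thesis by simp
  qed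
  have "((\<lambda>s. \<i> * (V (t + s) (unit_seq m) n - V t (unit_seq m) n) / complex_of_real s) \<longlongrightarrow> V t (Jform (unit_seq m)) n) (at 0)"
    unfolding Vq[symmetric]
  proof (rule ell2_norm_tendsto_component)
    show "((\<lambda>s. ell2_norm (\<lambda>n. V t (?q s) n - V t (Jform (unit_seq m)) n)) \<longlongrightarrow> 0) (at 0)"
      using lim by (simp add: diff[OF q Je, symmetric] iso[OF ell2_minus[OF q Je]])
  qed (intro Vell q Je)+
  from tendsto_mult[OF tendsto_const[of "- \<i>"] this]
  have "((\<lambda>s. (V (t + s) (unit_seq m) n - V t (unit_seq m) n) / complex_of_real s) \<longlongrightarrow> - \<i> * V t (Jform (unit_seq m)) n) (at 0)"
    by (simp add: mult.assoc[symmetric])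
  from LIM_offset[OF this, of "- t"]
  show "((\<lambda>t. V t (unit_seq m) n) has_vector_derivative - \<i> * Jform (\<lambda>m. V t (unit_seq m) n) m) (at t)"
    unfolding has_vector_derivative_iff_quotient JV by simp
qed

text \<open>Agreement on unit vectors comes from uniqueness for the evolution equation, agreement on
  truncations from linearity, and the rest from continuity of both maps.\<close>

lemma group_determined_by_generator:
  assumes V: "unitary_group V" and gen: "group_generator V = Jmax" and f: "f \<in> ell2"
  shows "V t f = propagator t f"
proof
  fix n
  have un: "unitary_ell2 (V t)" if "unitary_group V" for t V using that by (simp add: unitary_group_def)
  have e: "unit_seq m \<in> ell2" for m using unit_seq_finite finite_seqs_subset_ell2 by auto
  have tr: "trunc f N \<in> ell2" for N using trunc_finite finite_seqs_subset_ell2 by auto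
  have b: "cmod (V t (unit_seq m) n) \<le> 1" if "unitary_group V" for m n t V
  proof -
    have "V t (unit_seq m) \<in> ell2" "ell2_norm (V t (unit_seq m)) = 1"
      using un[OF that, of t] e[of m] by (auto simp: unitary_ell2_def ell2_norm_unit_seq)
    then show ?thesis using norm_component_le_ell2_norm by metis
  qed
  have "(\<lambda>m. V t (unit_seq m) n) = (\<lambda>m. propagator t (unit_seq m) n)" for n
    by (rule evolution_solution_unique[OF group_unit_seq_evolution[OF V gen] group_unit_seq_evolution[OF propagator_unitary_group propagator_generator]
         b[OF V] b[OF propagator_unitary_group]])
      (use V e in \<open>simp add: unitary_group_def propagator_0\<close>)
  then have eqe: "V t (unit_seq m) = propagator t (unit_seq m)" for m by (metis ext)
  have eqt: "V t (trunc f N) = propagator t (trunc f N)" for N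
  proof (induction N)
    case 0
    have "V t (\<lambda>n. 0 * unit_seq 0 n) = propagator t (\<lambda>n. 0 * unit_seq 0 n)"
      using un[OF V, of t] e[of 0] propagator_scale[OF e[of 0]] by (simp only: unitary_ell2_def) simp
    moreover have "trunc f 0 = (\<lambda>n. 0 * unit_seq 0 n)" by (auto simp: trunc_def)
    ultimately show ?case by simp
  next
    case (Suc N)
    have "trunc f (Suc N) = (\<lambda>n. trunc f N n + f N * unit_seq N n)"
      by (auto simp: trunc_def unit_seq_def less_Suc_eq)
    moreover have "V t (\<lambda>n. trunc f N n + f N * unit_seq N n) = (\<lambda>n. V t (trunc f N) n + f N * V t (unit_seq N) n)"
      using un[OF V, of t] tr[of N] e[of N] ell2_scale[OF e[of N], of "f N"] by (simp add: unitary_ell2_def)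
    moreover have "propagator t (\<lambda>n. trunc f N n + f N * unit_seq N n) = (\<lambda>n. propagator t (trunc f N) n + f N * propagator t (unit_seq N) n)"
      using tr[of N] e[of N] ell2_scale[OF e[of N], of "f N"] by (simp add: propagator_add propagator_scale)
    ultimately show ?case by (simp add: Suc eqe)
  qed
  have Vell: "V t f \<in> ell2" if "f \<in> ell2" for f using un[OF V, of t] that by (auto simp: unitary_ell2_def)
  have "(\<lambda>N. V t (trunc f N) n) \<longlonglongrightarrow> V t f n"
  proof (rule ell2_norm_tendsto_component)
    have diff: "V t (\<lambda>n. g n - f n) = (\<lambda>n. V t g n - V t f n)" if "g \<in> ell2" for g
    proof -
      have "V t (\<lambda>n. g n + (-1) * f n) = (\<lambda>n. V t g n + (-1) * V t f n)"
        using un[OF V, of t] that f ell2_scale[OF f, of "-1"] unfolding unitary_ell2_def by metis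
      then show ?thesis by simp
    qed
    have "ell2_norm (\<lambda>n. V t (trunc f N) n - V t f n) = ell2_norm (\<lambda>n. trunc f N n - f n)" for N
      unfolding diff[OF tr, symmetric] using un[OF V, of t] ell2_minus[OF tr f] by (auto simp: unitary_ell2_def)
    then show "(\<lambda>N. ell2_norm (\<lambda>n. V t (trunc f N) n - V t f n)) \<longlonglongrightarrow> 0"
      using trunc_tendsto[OF f] by simp
  qed (intro Vell tr f)+
  moreover have "(\<lambda>N. V t (trunc f N) n) \<longlonglongrightarrow> propagator t f n"
    unfolding eqt by (rule propagator_tendsto[OF trunc_tendsto[OF f] tr f])
  ultimately show "V t f n = propagator t f n" by (rule LIMSEQ_unique)
qed

section \<open>Identification with \<open>exp_group\<close> and with Hermite coefficients\<close>

lemma exp_group_hermite_J: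
  assumes "f \<in> ell2" shows "exp_group hermite_J t f = propagator t f"
  unfolding exp_group_def hermite_J_eq_Jmax
proof (rule the_equality)
  show "\<exists>V. unitary_group V \<and> group_generator V = Jmax \<and> propagator t f = V t f"
    using propagator_unitary_group propagator_generator by blast
  show "u = propagator t f" if "\<exists>V. unitary_group V \<and> group_generator V = Jmax \<and> u = V t f" for u
    using that group_determined_by_generator[OF _ _ assms] by blast
qed

text \<open>Membership in \<open>Phi f\<close> yields mean square convergence along the truncations
  of \<open>f\<close>, and by Bessel's inequality each Hermite coefficient is continuous for
  it.\<close>

lemma propagator_eq_fcoef:
  assumes f: "f \<in> ell2" and g: "g \<in> Phi f"
  shows "propagator t f n = fcoef (modulate t g) n"
proof -
  have gL: "g \<in> L2_fun" and lim: "(\<lambda>k. L2_norm (\<lambda>x. Phi_fin (trunc f k) x - g x)) \<longlonglongrightarrow> 0"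
    using g trunc_tendsto[OF f] trunc_finite by (auto simp: Phi_def)
  have P: "Phi_fin (trunc f k) \<in> L2_fun" for k by (rule Phi_fin_L2(1)[OF trunc_finite])
  have tr: "trunc f N \<in> ell2" for N using trunc_finite finite_seqs_subset_ell2 by auto
  have "(\<lambda>k. fcoef (modulate t (Phi_fin (trunc f k))) n) \<longlonglongrightarrow> fcoef (modulate t g) n"
    unfolding tendsto_dist_iff[of "\<lambda>k. fcoef (modulate t (Phi_fin (trunc f k))) n"]
  proof (rule tendsto_sandwich[OF _ _ tendsto_const lim])
    have "cmod (fcoef (modulate t (Phi_fin (trunc f k))) n - fcoef (modulate t g) n) \<le> L2_norm (\<lambda>x. Phi_fin (trunc f k) x - g x)" for k
    proof -
      have "fcoef (modulate t (Phi_fin (trunc f k))) n - fcoef (modulate t g) n = fcoef (\<lambda>x. modulate t (Phi_fin (trunc f k)) x - modulate t g x) n"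
        by (rule fcoef_diff[symmetric, OF modulate_L2[OF P] modulate_L2[OF gL]])
      also have "(\<lambda>x. modulate t (Phi_fin (trunc f k)) x - modulate t g x) = modulate t (\<lambda>x. Phi_fin (trunc f k) x - g x)"
        by (auto simp: modulate_def algebra_simps)
      finally show ?thesis
        using cmod_fcoef_le[OF modulate_L2[OF L2_fun_diff[OF P gL]]] by (simp add: L2_norm_modulate)
    qed
    then show "\<forall>\<^sub>F k in sequentially. dist (fcoef (modulate t (Phi_fin (trunc f k))) n) (fcoef (modulate t g) n) \<le> L2_norm (\<lambda>x. Phi_fin (trunc f k) x - g x)"
      by (simp add: dist_norm)
  qed auto
  moreover have "(\<lambda>k. propagator t (trunc f k) n) \<longlonglongrightarrow> propagator t f n"
    by (rule propagator_tendsto[OF trunc_tendsto[OF f] tr f])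
  ultimately show ?thesis unfolding propagator_finite[OF trunc_finite] by (metis LIMSEQ_unique)
qed

section \<open>Asymptotics of the Hermite functions\<close>

text \<open>The derivative of \<open>psi n\<close> in raising form, which makes its value at 0 a
  multiple of \<open>psi (Suc n) 0\<close>.\<close>

definition dpsi :: "nat \<Rightarrow> real \<Rightarrow> real" where
  "dpsi n x = x * psi n x - 2 * hermite_a n * psi (Suc n) x"

lemma psi_dpsi: "(psi n has_real_derivative dpsi n x) (at x)"
  unfolding dpsi_def by (rule psi_deriv')

text \<open>The harmonic oscillator equation: raising followed by lowering produces
  \<open>4 * (hermite_a n)\<^sup>2 = 2 * real n + 2\<close>, whence the frequency.\<close>

lemma dpsi_deriv: "(dpsi n has_real_derivative (x\<^sup>2 - (2 * real n + 1)) * psi n x) (at x)"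
proof -
  have "((\<lambda>x. x * psi n x - 2 * hermite_a n * psi (Suc n) x) has_real_derivative
      (1 * psi n x + dpsi n x * x - 2 * hermite_a n * (2 * hermite_a n * psi n x - x * psi (Suc n) x))) (at x)"
    using psi_deriv[of "Suc n" x] by (intro DERIV_diff DERIV_mult DERIV_cmult DERIV_ident psi_dpsi) simp
  moreover have "1 * psi n x + dpsi n x * x - 2 * hermite_a n * (2 * hermite_a n * psi n x - x * psi (Suc n) x)
     = (x\<^sup>2 + 1 - 4 * (hermite_a n)\<^sup>2) * psi n x"
    by (simp add: dpsi_def power2_eq_square algebra_simps)
  moreover have "x\<^sup>2 + 1 - 4 * (hermite_a n)\<^sup>2 = x\<^sup>2 - (2 * real n + 1)"
    by (simp add: hermite_a_sq field_simps)
  moreover have "dpsi n = (\<lambda>x. x * psi n x - 2 * hermite_a n * psi (Suc n) x)"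
    by (auto simp: dpsi_def)
  ultimately show ?thesis by (simp only:)
qed

text \<open>The energy \<open>y'\<^sup>2 + (\<omega>\<^sup>2 - x\<^sup>2) y\<^sup>2\<close> is largest at \<open>x = 0\<close>, since its derivative is \<open>- 2 x y\<^sup>2\<close>.\<close>

lemma oscillator_amplitude_bound:
  fixes y y' :: "real \<Rightarrow> real"
  assumes y: "\<And>x. (y has_real_derivative y' x) (at x)"
    and y': "\<And>x. (y' has_real_derivative (x\<^sup>2 - w\<^sup>2) * y x) (at x)"
    and w: "0 < w" "2 * x\<^sup>2 \<le> w\<^sup>2" and s: "0 \<le> s" "(y 0)\<^sup>2 + (y' 0 / w)\<^sup>2 = s\<^sup>2"
  shows "\<bar>y x\<bar> \<le> 2 * s"
proof -
  define En where "En x = (y' x)\<^sup>2 + (w\<^sup>2 - x\<^sup>2) * (y x)\<^sup>2" for x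
  have d: "(En has_real_derivative - 2 * x * (y x)\<^sup>2) (at x)" for x
    unfolding En_def[abs_def]
    by (rule derivative_eq_intros y y' refl)+ (simp add: power2_eq_square algebra_simps)
  have "En x \<le> En 0"
  proof (cases "0 \<le> x")
    case True
    show ?thesis
    proof (rule DERIV_nonpos_imp_nonincreasing[OF True])
      fix z assume "0 \<le> z" "z \<le> x"
      then show "\<exists>D. (En has_real_derivative D) (at z) \<and> D \<le> 0"
        using d[of z] by (intro exI[of _ "- 2 * z * (y z)\<^sup>2"]) auto
    qed
  next
    case False
    then have "x \<le> 0" by simp
    then show ?thesis
    proof (rule DERIV_nonneg_imp_nondecreasing)
      fix z assume "x \<le> z" "z \<le> 0"
      then show "\<exists>D. (En has_real_derivative D) (at z) \<and> 0 \<le> D"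
        using d[of z] by (intro exI[of _ "- 2 * z * (y z)\<^sup>2"]) (auto simp: mult_nonpos_nonneg)
    qed
  qed
  moreover have "En 0 = w\<^sup>2 * s\<^sup>2"
    unfolding En_def s(2)[symmetric] using w(1) by (simp add: power_divide field_simps)
  \<comment> \<open>On this range \<open>x\<^sup>2\<close> is at most half of
    \<open>w\<^sup>2\<close>, so the potential term of the energy still controls
    \<open>y\<close>.\<close>
  moreover have "w\<^sup>2 / 2 * (y x)\<^sup>2 \<le> En x"
  proof -
    have "w\<^sup>2 / 2 * (y x)\<^sup>2 \<le> (w\<^sup>2 - x\<^sup>2) * (y x)\<^sup>2" using w(2) by (intro mult_right_mono) auto
    also have "\<dots> \<le> En x" by (simp add: En_def)
    finally show ?thesis .
  qed
  ultimately have "w\<^sup>2 * (y x)\<^sup>2 \<le> w\<^sup>2 * (2 * s\<^sup>2)" by simp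
  then have "(y x)\<^sup>2 \<le> 2 * s\<^sup>2" using w(1) by (subst (asm) mult_le_cancel_left_pos) auto
  also have "\<dots> \<le> (2 * s)\<^sup>2" by (simp add: power_mult_distrib)
  finally show ?thesis using s(1) abs_le_square_iff[of "y x" "2 * s"] by simp
qed

text \<open>Variation of constants: \<open>e\<^sup>-\<^sup>i\<^sup>\<omega>\<^sup>x (y' + i \<omega> y)\<close> has derivative \<open>e\<^sup>-\<^sup>i\<^sup>\<omega>\<^sup>x x\<^sup>2 y\<close>.\<close>

lemma oscillator_approx:
  fixes y y' :: "real \<Rightarrow> real"
  assumes y: "\<And>x. (y has_real_derivative y' x) (at x)"
    and y': "\<And>x. (y' has_real_derivative (x\<^sup>2 - w\<^sup>2) * y x) (at x)"
    and w: "0 < w" "2 * R\<^sup>2 \<le> w\<^sup>2" and s: "0 \<le> s" "(y 0)\<^sup>2 + (y' 0 / w)\<^sup>2 = s\<^sup>2"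
    and x: "\<bar>x\<bar> \<le> R"
  shows "\<bar>y x - (y 0 * cos (w * x) + y' 0 / w * sin (w * x))\<bar> \<le> 2 * R ^ 3 * s / w"
proof -
  define z where "z x = cis (- (w * x)) * Complex (y' x) (w * y x)" for x
  have R: "0 \<le> R" using x by linarith
  have sq: "v\<^sup>2 \<le> R\<^sup>2" if "\<bar>v\<bar> \<le> R" for v using that R by (metis abs_le_square_iff abs_of_nonneg)
  have zd: "(z has_vector_derivative cis (- (w * x)) * of_real (x\<^sup>2 * y x)) (at x)" for x
  proof -
    have "((\<lambda>x. Complex (y' x) (w * y x)) has_vector_derivative Complex ((x\<^sup>2 - w\<^sup>2) * y x) (w * y' x)) (at x)"
      using has_vector_derivative_add[of "\<lambda>x. complex_of_real (y' x)" "complex_of_real ((x\<^sup>2 - w\<^sup>2) * y x)" "at x"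
        "\<lambda>x. \<i> * complex_of_real (w * y x)" "\<i> * complex_of_real (w * y' x)"]
      by (simp only: Complex_eq)
        (intro has_vector_derivative_add has_vector_derivative_mult_right has_vector_derivative_of_real;
          (rule y' | rule DERIV_cmult y)+)
    moreover have "((\<lambda>x. cis (- (w * x))) has_vector_derivative (- w) *\<^sub>R (\<i> * cis (- (w * x)))) (at x)"
      by (rule cis_linear_derivative)
    ultimately have "(z has_vector_derivative cis (- (w * x)) * Complex ((x\<^sup>2 - w\<^sup>2) * y x) (w * y' x)
       + (- w) *\<^sub>R (\<i> * cis (- (w * x))) * Complex (y' x) (w * y x)) (at x)"
      unfolding z_def[abs_def] by (rule has_vector_derivative_mult[rotated])
    moreover have "cis (- (w * x)) * Complex ((x\<^sup>2 - w\<^sup>2) * y x) (w * y' x)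
       + (- w) *\<^sub>R (\<i> * cis (- (w * x))) * Complex (y' x) (w * y x) = cis (- (w * x)) * of_real (x\<^sup>2 * y x)"
    proof -
      have "Complex ((x\<^sup>2 - w\<^sup>2) * y x) (w * y' x) + (- w) *\<^sub>R (\<i> * Complex (y' x) (w * y x)) = of_real (x\<^sup>2 * y x)"
        by (simp add: complex_eq_iff power2_eq_square algebra_simps)
      moreover have "cis (- (w * x)) * Complex ((x\<^sup>2 - w\<^sup>2) * y x) (w * y' x)
       + (- w) *\<^sub>R (\<i> * cis (- (w * x))) * Complex (y' x) (w * y x)
       = cis (- (w * x)) * (Complex ((x\<^sup>2 - w\<^sup>2) * y x) (w * y' x) + (- w) *\<^sub>R (\<i> * Complex (y' x) (w * y x)))"
        by (simp only: distrib_left scaleR_conv_of_real mult_ac)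
      ultimately show ?thesis by (simp only:)
    qed
    ultimately show ?thesis by simp
  qed
  have "norm (z x - z 0) \<le> (R\<^sup>2 * (2 * s)) * norm (x - 0)"
  proof (rule differentiable_bound[of "{-R..R}" z "\<lambda>x h. h *\<^sub>R (cis (- (w * x)) * of_real (x\<^sup>2 * y x))"])
    fix v assume v: "v \<in> {-R..R}"
    show "(z has_derivative (\<lambda>h. h *\<^sub>R (cis (- (w * v)) * of_real (v\<^sup>2 * y v)))) (at v within {-R..R})"
      using zd[of v] by (simp add: has_vector_derivative_def has_derivative_at_withinI)
    have v2: "v\<^sup>2 \<le> R\<^sup>2" using v by (intro sq) auto
    have "\<bar>y v\<bar> \<le> 2 * s" by (rule oscillator_amplitude_bound[OF y y' w(1) _ s]) (use v2 w(2) in auto)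
    then have "v\<^sup>2 * \<bar>y v\<bar> \<le> R\<^sup>2 * (2 * s)" using v2 by (intro mult_mono) auto
    then have b: "cmod (cis (- (w * v)) * of_real (v\<^sup>2 * y v)) \<le> R\<^sup>2 * (2 * s)"
      by (simp add: norm_mult norm_power)
    show "onorm (\<lambda>h. h *\<^sub>R (cis (- (w * v)) * of_real (v\<^sup>2 * y v))) \<le> R\<^sup>2 * (2 * s)"
    proof (rule onorm_le)
      fix h :: real
      show "norm (h *\<^sub>R (cis (- (w * v)) * of_real (v\<^sup>2 * y v))) \<le> R\<^sup>2 * (2 * s) * norm h"
        unfolding norm_scaleR real_norm_def using mult_left_mono[OF b, of "\<bar>h\<bar>"] by (simp only: mult.commute abs_ge_zero)
    qed
  qed (use x R in auto)
  also have "\<dots> \<le> (R\<^sup>2 * (2 * s)) * R" using x s(1) by (intro mult_left_mono) auto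
  finally have zb: "cmod (z x - z 0) \<le> 2 * R ^ 3 * s" by (simp add: power2_eq_square power3_eq_cube mult_ac)
  \<comment> \<open>Undoing the rotation, the imaginary part recovers \<open>w * y x\<close>;
    dividing by \<open>w\<close> yields the gain of order \<open>1 / w\<close>.\<close>
  have "cis (w * x) * (z x - z 0) = Complex (y' x) (w * y x) - cis (w * x) * Complex (y' 0) (w * y 0)"
    by (simp add: z_def right_diff_distrib cis_mult flip: mult.assoc)
  then have "Im (cis (w * x) * (z x - z 0)) = w * y x - (cos (w * x) * (w * y 0) + sin (w * x) * y' 0)"
    by simp
  also have "\<dots> = w * (y x - (y 0 * cos (w * x) + y' 0 / w * sin (w * x)))"
    using w(1) by (simp add: right_diff_distrib distrib_left)
  finally have "w * (y x - (y 0 * cos (w * x) + y' 0 / w * sin (w * x))) = Im (cis (w * x) * (z x - z 0))" ..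
  then have "w * \<bar>y x - (y 0 * cos (w * x) + y' 0 / w * sin (w * x))\<bar> \<le> cmod (cis (w * x) * (z x - z 0))"
    using abs_Im_le_cmod[of "cis (w * x) * (z x - z 0)"] w(1) by (metis abs_mult abs_of_pos)
  also have "\<dots> \<le> 2 * R ^ 3 * s" using zb by (simp add: norm_mult)
  finally show ?thesis using w(1) by (simp add: pos_le_divide_eq mult.commute)
qed

section \<open>Two-sided bounds for the Wallis product\<close>

definition wallis_prod :: "nat \<Rightarrow> real" where
  "wallis_prod m = (\<Prod>j<m. ((2 * real j + 1) / (2 * real j + 2))\<^sup>2)"

lemma wallis_prod_pos: "0 < wallis_prod m"
  unfolding wallis_prod_def by (intro prod_pos) auto

lemma wallis_prod_Suc: "wallis_prod (Suc m) = wallis_prod m * ((2 * real m + 1) / (2 * real m + 2))\<^sup>2"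
  by (simp add: wallis_prod_def)

text \<open>\<open>wallis_prod m\<close> is the square of \<open>(2 * m choose m) / 4 ^ m\<close>.
  The factors \<open>4 * k\<^sup>2 - 1 = (2 * k - 1) * (2 * k + 1)\<close> of the classical product
  match it up to the boundary factor \<open>2 * m + 1\<close>.\<close>

lemma wallis_prod_inverse: "(\<Prod>k=1..m. (4 * real k ^ 2) / (4 * real k ^ 2 - 1)) * ((2 * real m + 1) * wallis_prod m) = 1"
proof (induction m)
  case 0 then show ?case by (simp add: wallis_prod_def)
next
  case (Suc m)
  define W where "W = (\<Prod>k=1..m. (4 * real k ^ 2) / (4 * real k ^ 2 - 1))"
  have f: "4 * (real (Suc m))\<^sup>2 - 1 = (2 * real m + 1) * (2 * real m + 3)"
    by (simp add: power2_eq_square algebra_simps)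
  have c: "(2 * real m + 2)\<^sup>2 = 4 * (real (Suc m))\<^sup>2"
    by (simp add: power2_eq_square algebra_simps)
  have "(\<Prod>k=1..Suc m. (4 * real k ^ 2) / (4 * real k ^ 2 - 1)) * ((2 * real (Suc m) + 1) * wallis_prod (Suc m))
     = W * (4 * (real (Suc m))\<^sup>2 / ((2 * real m + 1) * (2 * real m + 3))) * ((2 * real m + 3) * (wallis_prod m * ((2 * real m + 1)\<^sup>2 / (4 * (real (Suc m))\<^sup>2))))"
  proof -
    have "(\<Prod>k=1..Suc m. (4 * real k ^ 2) / (4 * real k ^ 2 - 1)) = W * (4 * (real (Suc m))\<^sup>2 / (4 * (real (Suc m))\<^sup>2 - 1))"
      by (simp add: W_def del: of_nat_Suc)
    moreover have "2 * real (Suc m) + 1 = 2 * real m + 3" by simp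
    ultimately show ?thesis unfolding wallis_prod_Suc power_divide c by (simp only: f)
  qed
  also have "\<dots> = W * ((2 * real m + 1) * wallis_prod m)"
  proof -
    have "4 * (real (Suc m))\<^sup>2 \<noteq> 0" "2 * real m + 1 \<noteq> 0" "2 * real m + 3 \<noteq> 0" by auto
    then show ?thesis
      by (simp only: power2_eq_square[of "2 * real m + 1"]) (simp add: divide_simps del: of_nat_Suc)
  qed
  finally show ?case using Suc unfolding W_def by (simp only:)
qed

text \<open>The classical partial products increase to \<open>pi / 2\<close> and hence stay below
  it; taking reciprocals bounds \<open>wallis_prod\<close> from below.\<close>

lemma wallis_prod_lower: "2 \<le> pi * ((2 * real m + 1) * wallis_prod m)"
proof -
  define W where "W m = (\<Prod>k=1..m. (4 * real k ^ 2) / (4 * real k ^ 2 - 1))" for m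
  have pos: "0 < W m" for m
    unfolding W_def
  proof (intro prod_pos ballI divide_pos_pos)
    fix k assume "k \<in> {1..m}"
    then have "1 \<le> real k" by simp
    then have "1 \<le> (real k)\<^sup>2" by (rule one_le_power)
    then show "0 < 4 * (real k)\<^sup>2" "0 < 4 * (real k)\<^sup>2 - 1" by linarith+
  qed
  have "incseq W"
  proof (rule incseq_SucI)
    fix m
    have "1 \<le> (real (Suc m))\<^sup>2" by (rule one_le_power) simp
    moreover have "1 \<le> 4 * M / (4 * M - 1)" if "1 \<le> M" for M :: real
      using that by (simp add: pos_le_divide_eq)
    ultimately have "1 \<le> 4 * (real (Suc m))\<^sup>2 / (4 * (real (Suc m))\<^sup>2 - 1)" by blast
    from mult_left_mono[OF this less_imp_le[OF pos[of m]]]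
    show "W m \<le> W (Suc m)" by (simp add: W_def del: of_nat_Suc)
  qed
  then have "W m \<le> pi / 2" using wallis unfolding W_def[symmetric] by (rule incseq_le)
  then have "1 \<le> pi / 2 * ((2 * real m + 1) * wallis_prod m)"
    using mult_right_mono[of "W m" "pi / 2" "(2 * real m + 1) * wallis_prod m"] wallis_prod_pos[of m]
    unfolding W_def wallis_prod_inverse by simp
  then show ?thesis by simp
qed

text \<open>The matching bound on the other side: \<open>real m * wallis_prod m\<close> also
  increases to its limit, which is \<open>1 / pi\<close>. Together the two bounds locate
  \<open>pi * wallis_prod m\<close> with a relative error of order \<open>1 / m\<close>.\<close>

lemma wallis_prod_upper: "pi * (real m * wallis_prod m) \<le> 1"
proof -
  let ?f = "\<lambda>m. real m * wallis_prod m"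
  have "incseq ?f"
  proof (rule incseq_SucI)
    fix m
    have "real m \<le> real (Suc m) * ((2 * real m + 1) / (2 * real m + 2))\<^sup>2"
    proof -
      have "(2 * real m + 2)\<^sup>2 = 4 * real (Suc m) * real (Suc m)" by (simp add: power2_eq_square algebra_simps)
      then have "real (Suc m) * ((2 * real m + 1) / (2 * real m + 2))\<^sup>2 = (2 * real m + 1)\<^sup>2 / (4 * real (Suc m))"
        by (simp add: power_divide del: of_nat_Suc)
      moreover have "real m * (4 * real (Suc m)) \<le> (2 * real m + 1)\<^sup>2" by (simp add: power2_eq_square algebra_simps)
      ultimately show ?thesis by (simp add: pos_le_divide_eq del: of_nat_Suc)
    qed
    from mult_right_mono[OF this less_imp_le[OF wallis_prod_pos[of m]]]
    show "?f m \<le> ?f (Suc m)" unfolding wallis_prod_Suc by (simp only: mult_ac)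
  qed
  moreover have "?f \<longlonglongrightarrow> 1 / 2 * inverse (pi / 2)"
  proof -
    define W where "W m = (\<Prod>k=1..m. (4 * real k ^ 2) / (4 * real k ^ 2 - 1))" for m
    have "wallis_prod m * (2 * real m + 1) = inverse (W m)" for m
      using wallis_prod_inverse[of m] unfolding W_def[symmetric]
      by (metis inverse_unique mult.commute)
    then have "wallis_prod m = inverse (W m) / (2 * real m + 1)" for m
      by (simp add: nonzero_eq_divide_eq add_nonneg_eq_0_iff)
    then have eq: "?f m = real m / (2 * real m + 1) * inverse (W m)" for m by simp
    have "(\<lambda>m. real m / (2 * real m + 1)) \<longlonglongrightarrow> 1 / 2" by real_asymp
    moreover have "(\<lambda>m. inverse (W m)) \<longlonglongrightarrow> inverse (pi / 2)"
      using wallis unfolding W_def[symmetric] by (intro tendsto_inverse) auto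
    ultimately show ?thesis unfolding eq by (rule tendsto_mult)
  qed
  ultimately have "?f m \<le> 1 / 2 * inverse (pi / 2)" by (rule incseq_le)
  then show ?thesis by (simp add: field_simps)
qed


section \<open>Amplitude of the Hermite functions at the origin\<close>

definition freq :: "nat \<Rightarrow> real" where
  "freq n = sqrt (2 * real n + 1)"

text \<open>The limiting amplitude of \<open>psi n\<close> near the origin. Half of it is
  \<open>(2 * real n + 1) powr (-1/4)\<close> times the normalisation of the Fourier transform,
  since a cosine gives half its amplitude to each of its two plane waves.\<close>

definition amp :: "nat \<Rightarrow> real" where
  "amp n = sqrt (2 / pi) * (2 * real n + 1) powr (-1/4)"

lemma freq_ge_1: "1 \<le> freq n" by (simp add: freq_def)

lemma freq_power2: "(freq n)\<^sup>2 = 2 * real n + 1" by (simp add: freq_def)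

lemma amp_pos: "0 < amp n"
proof -
  have "0 < 2 * real n + 1" by simp
  then show ?thesis unfolding amp_def by (intro mult_pos_pos) (auto simp del: of_nat_add)
qed

lemma amp_power4: "amp n ^ 4 = 4 / (pi\<^sup>2 * (2 * real n + 1))"
proof -
  have n: "0 < 2 * real n + 1" by simp
  have "sqrt (2 / pi) ^ 4 = ((sqrt (2 / pi))\<^sup>2)\<^sup>2" by (simp only: power4_eq_xxxx power2_eq_square mult.assoc)
  also have "(sqrt (2 / pi))\<^sup>2 = 2 / pi" by (rule real_sqrt_pow2) simp
  finally have "sqrt (2 / pi) ^ 4 = 4 / pi\<^sup>2" by (simp only: power_divide) simp
  moreover have "(x powr (-1/4)) ^ 4 = inverse x" if "0 < x" for x :: real
  proof -
    have "(x powr (-1/4)) ^ 4 = x powr (-1)" using that by (simp add: powr_power)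
    then show ?thesis using that by (simp add: powr_minus)
  qed
  from this[OF n] have "((2 * real n + 1) powr (-1/4)) ^ 4 = inverse (2 * real n + 1)" .
  ultimately show ?thesis unfolding amp_def power_mult_distrib
    by (simp only: divide_inverse inverse_mult_distrib mult.assoc)
qed

text \<open>The modulus of \<open>psi (2 * m) 0\<close>; the alternating sign is split off so that
  fourth powers can be compared.\<close>

definition rho :: "nat \<Rightarrow> real" where
  "rho m = pi powr (-1/4) * (\<Prod>j<m. hermite_a (2 * j) / hermite_a (2 * j + 1))"

lemma rho_nonneg: "0 \<le> rho m"
  unfolding rho_def by (intro mult_nonneg_nonneg prod_nonneg) (auto simp: hermite_a_nonneg)

lemma rho_power4: "rho m ^ 4 = wallis_prod m / pi"
proof -
  have p: "(pi powr (-1/4)) ^ 4 = inverse pi"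
  proof -
    have "(pi powr (-1/4)) ^ 4 = pi powr (-1)" by (simp add: powr_power)
    then show ?thesis by (simp add: powr_minus)
  qed
  have "(hermite_a (2 * j) / hermite_a (2 * j + 1)) ^ 4 = ((2 * real j + 1) / (2 * real j + 2))\<^sup>2" for j
  proof -
    have "(hermite_a (2 * j) / hermite_a (2 * j + 1)) ^ 4 = ((hermite_a (2 * j))\<^sup>2 / (hermite_a (2 * j + 1))\<^sup>2)\<^sup>2"
      by (simp add: power_divide flip: power_mult)
    also have "(hermite_a (2 * j))\<^sup>2 / (hermite_a (2 * j + 1))\<^sup>2 = (2 * real j + 1) / (2 * real j + 2)"
    proof -
      have "real (2 * j) + 1 = 2 * real j + 1" "real (2 * j + 1) + 1 = 2 * real j + 2" by simp_all
      then have "(hermite_a (2 * j))\<^sup>2 / (hermite_a (2 * j + 1))\<^sup>2 = (2 * real j + 1) / 2 / ((2 * real j + 2) / 2)"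
        by (simp only: hermite_a_sq)
      also have "\<dots> = (2 * real j + 1) / (2 * real j + 2)"
      proof -
        have "a / 2 / (b / 2) = a / b" for a b :: real by simp
        then show ?thesis .
      qed
      finally show ?thesis .
    qed
    finally show ?thesis .
  qed
  then have "(\<Prod>j<m. hermite_a (2 * j) / hermite_a (2 * j + 1)) ^ 4 = wallis_prod m"
    unfolding wallis_prod_def prod_power_distrib by (simp only:)
  then show ?thesis unfolding rho_def power_mult_distrib p by (simp add: divide_inverse)
qed

text \<open>At the origin the left-hand side of the recurrence vanishes, so it links only indices of
  equal parity.\<close>

lemma psi_at_0: "psi (2 * m) 0 = (-1) ^ m * rho m" "psi (2 * m + 1) 0 = 0"
proof -
  have rec: "psi (Suc (Suc n)) 0 = - (hermite_a n / hermite_a (Suc n)) * psi n 0" for n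
    using psi_recurrence[of 0 "Suc n"] hermite_a_pos[of "Suc n"] by (simp add: field_simps)
  show "psi (2 * m) 0 = (-1) ^ m * rho m"
  proof (induction m)
    case 0 then show ?case by (simp add: psi_def rho_def)
  next
    case (Suc m)
    have "psi (2 * Suc m) 0 = - (hermite_a (2 * m) / hermite_a (2 * m + 1)) * psi (2 * m) 0"
      using rec[of "2 * m"] by simp
    then show ?case unfolding Suc by (simp add: rho_def)
  qed
  show "psi (2 * m + 1) 0 = 0"
  proof (induction m)
    case 0 then show ?case by (simp add: psi_def)
  next
    case (Suc m)
    then show ?case using rec[of "2 * m + 1"] by simp
  qed
qed

text \<open>Fourth powers are compared because they free \<open>rho\<close> and \<open>amp\<close>
  of fractional powers. The factor \<open>(r + 1) * (r\<^sup>2 + 1)\<close> of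
  \<open>r ^ 4 - 1\<close> is at least 1, so the relative error does not grow in going back.\<close>

lemma close_of_power4_close:
  fixes s a d :: real
  assumes "0 \<le> s" "0 < a" "\<bar>s ^ 4 / a ^ 4 - 1\<bar> \<le> d"
  shows "\<bar>s - a\<bar> \<le> d * a"
proof -
  define r where "r = s / a"
  have r: "0 \<le> r" using assms by (simp add: r_def)
  have "\<bar>r - 1\<bar> * 1 \<le> \<bar>r - 1\<bar> * ((r + 1) * (r\<^sup>2 + 1))"
  proof (rule mult_left_mono)
    have "1 * 1 \<le> (r + 1) * (r\<^sup>2 + 1)" using r by (intro mult_mono) auto
    then show "1 \<le> (r + 1) * (r\<^sup>2 + 1)" by simp
  qed simp
  also have "\<dots> = \<bar>(r - 1) * ((r + 1) * (r\<^sup>2 + 1))\<bar>" using r by (simp add: abs_mult)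
  also have "(r - 1) * ((r + 1) * (r\<^sup>2 + 1)) = r ^ 4 - 1"
    by (simp add: power2_eq_square power4_eq_xxxx algebra_simps)
  also have "\<bar>r ^ 4 - 1\<bar> \<le> d" using assms(3) by (simp add: r_def power_divide)
  finally have "\<bar>r - 1\<bar> * a \<le> d * a" using assms(2) by (intro mult_right_mono) auto
  moreover have "\<bar>s - a\<bar> = \<bar>r - 1\<bar> * a"
  proof -
    have "s - a = (r - 1) * a" using assms(2) by (simp add: r_def left_diff_distrib)
    then show ?thesis using assms(2) by (simp add: abs_mult)
  qed
  ultimately show ?thesis by simp
qed

text \<open>Converts the relative error \<open>1 / m\<close> into one in terms of the frequency. The
  7 comes from \<open>freq n \<le> (freq n)\<^sup>2 = 2 * real n + 1 \<le> 4 * real m + 3 \<le> 7 *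
  real m\<close>.\<close>

lemma inverse_le_freq:
  assumes "1 \<le> m" "n \<le> 2 * m + 1"
  shows "1 / real m \<le> 7 / freq n"
proof -
  have "freq n \<le> freq n * freq n" using mult_left_mono[OF freq_ge_1[of n], of "freq n"] freq_ge_1[of n] by simp
  also have "\<dots> = 2 * real n + 1" using freq_power2[of n] by (simp add: power2_eq_square)
  also have "\<dots> \<le> 7 * real m" using assms by linarith
  finally show ?thesis using assms(1) freq_ge_1[of n] by (simp add: divide_simps)
qed

text \<open>The Wallis bounds put \<open>q\<close> between \<open>2 / (2 * m + 1)\<close> and
  \<open>1 / m\<close>, which keeps the ratio of fourth powers, \<open>q * (4 * m + 1) / 4\<close>,
  within \<open>1 / m\<close> of 1.\<close>

lemma psi_initial_even:
  assumes m: "1 \<le> m" 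
  shows "\<bar>rho m - amp (2 * m)\<bar> \<le> 7 / freq (2 * m) * amp (2 * m)"
proof -
  define q where "q = pi * wallis_prod m"
  have q: "2 \<le> q * (2 * real m + 1)" "real m * q \<le> 1"
    using wallis_prod_lower[of m] wallis_prod_upper[of m] by (simp_all add: q_def mult_ac)
  have m0: "0 < real m" using m by simp
  have eq: "rho m ^ 4 / amp (2 * m) ^ 4 = q * (4 * real m + 1) / 4"
    unfolding rho_power4 amp_power4 q_def by (simp add: power2_eq_square)
  have "real m * (q * (4 * real m + 1) / 4) \<le> real m + 1"
  proof -
    have "real m * q * ((4 * real m + 1) / 4) \<le> 1 * ((4 * real m + 1) / 4)"
      by (intro mult_right_mono q) auto
    also have "\<dots> \<le> real m + 1" by simp
    finally show ?thesis by (simp only: mult.assoc times_divide_eq_right)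
  qed
  moreover have "real m - 1 \<le> real m * (q * (4 * real m + 1) / 4)"
  proof -
    have "(real m - 1) * (4 * (2 * real m + 1)) \<le> 2 * (real m * (4 * real m + 1))"
      by (simp add: algebra_simps)
    also have "\<dots> \<le> q * (2 * real m + 1) * (real m * (4 * real m + 1))"
      using q(1) by (intro mult_right_mono) auto
    also have "\<dots> = real m * (q * (4 * real m + 1) / 4) * (4 * (2 * real m + 1))"
      by (simp add: algebra_simps)
    finally show ?thesis by (rule mult_right_le_imp_le) simp
  qed
  ultimately have "\<bar>real m * (q * (4 * real m + 1) / 4 - 1)\<bar> \<le> 1" by (simp add: right_diff_distrib abs_le_iff)
  then have "\<bar>q * (4 * real m + 1) / 4 - 1\<bar> \<le> 1 / real m"
    using m0 by (simp only: abs_mult abs_of_pos pos_le_divide_eq mult.commute)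
  also have "\<dots> \<le> 7 / freq (2 * m)" by (rule inverse_le_freq[OF m]) simp
  finally show ?thesis unfolding eq[symmetric]
    by (rule close_of_power4_close[OF rho_nonneg amp_pos])
qed

text \<open>For odd index \<open>psi n\<close> vanishes at 0, and the amplitude is the size of the
  slope there divided by the frequency. The estimate again rests on the two Wallis bounds.\<close>

lemma psi_initial_odd:
  assumes m: "1 \<le> m" 
  defines "n \<equiv> 2 * m + 1" 
  defines "s \<equiv> 2 * hermite_a (2 * m) * rho m / freq n"
  shows "0 \<le> s" "\<bar>s - amp n\<bar> \<le> 7 / freq n * amp n"
proof -
  show s: "0 \<le> s" unfolding s_def using rho_nonneg[of m] hermite_a_nonneg[of "2 * m"] freq_ge_1[of n] by simp
  define q where "q = pi * wallis_prod m"
  have q: "2 \<le> q * (2 * real m + 1)" "real m * q \<le> 1"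
    using wallis_prod_lower[of m] wallis_prod_upper[of m] by (simp_all add: q_def mult_ac)
  have m0: "0 < real m" using m by simp
  have s4: "s ^ 4 = 4 * (2 * real m + 1)\<^sup>2 * (wallis_prod m / pi) / (4 * real m + 3)\<^sup>2"
  proof -
    have "hermite_a (2 * m) ^ 4 = ((hermite_a (2 * m))\<^sup>2)\<^sup>2" by (simp flip: power_mult)
    also have "\<dots> = (2 * real m + 1)\<^sup>2 / 4" unfolding hermite_a_sq by (simp add: power_divide)
    finally have a: "hermite_a (2 * m) ^ 4 = (2 * real m + 1)\<^sup>2 / 4" .
    have "freq n ^ 4 = ((freq n)\<^sup>2)\<^sup>2" by (simp flip: power_mult)
    also have "\<dots> = (4 * real m + 3)\<^sup>2" unfolding freq_power2 by (simp add: n_def)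
    finally have w: "freq n ^ 4 = (4 * real m + 3)\<^sup>2" .
    show ?thesis unfolding s_def power_divide power_mult_distrib a w rho_power4 by simp
  qed
  have "s ^ 4 / amp n ^ 4 = q * (2 * real m + 1)\<^sup>2 * (4 * real m + 3) / (4 * real m + 3)\<^sup>2"
    unfolding s4 amp_power4 q_def by (simp add: n_def power2_eq_square[of pi])
  then have eq: "s ^ 4 / amp n ^ 4 = q * (2 * real m + 1)\<^sup>2 / (4 * real m + 3)"
    by (simp add: power2_eq_square[of "4 * real m + 3"])
  have p: "0 < 4 * real m + 3" by simp
  have "real m * (q * (2 * real m + 1)\<^sup>2 / (4 * real m + 3)) \<le> real m + 1"
  proof -
    have "real m * q * (2 * real m + 1)\<^sup>2 \<le> 1 * (2 * real m + 1)\<^sup>2"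
      by (intro mult_right_mono q) auto
    also have "\<dots> \<le> (real m + 1) * (4 * real m + 3)" by (simp add: power2_eq_square algebra_simps)
    finally show ?thesis using p by (simp add: pos_divide_le_eq mult.assoc)
  qed
  moreover have "real m - 1 \<le> real m * (q * (2 * real m + 1)\<^sup>2 / (4 * real m + 3))"
  proof -
    have "(real m - 1) * (4 * real m + 3) \<le> 2 * (real m * (2 * real m + 1))"
      by (simp add: algebra_simps)
    also have "\<dots> \<le> q * (2 * real m + 1) * (real m * (2 * real m + 1))"
      using q(1) by (intro mult_right_mono) auto
    also have "\<dots> = real m * (q * (2 * real m + 1)\<^sup>2)" by (simp add: power2_eq_square)
    finally show ?thesis using p by (simp add: pos_le_divide_eq)
  qed
  ultimately have "\<bar>real m * (q * (2 * real m + 1)\<^sup>2 / (4 * real m + 3) - 1)\<bar> \<le> 1" by (simp add: right_diff_distrib abs_le_iff)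
  then have "\<bar>q * (2 * real m + 1)\<^sup>2 / (4 * real m + 3) - 1\<bar> \<le> 1 / real m"
    using m0 by (simp only: abs_mult abs_of_pos pos_le_divide_eq mult.commute)
  also have "\<dots> \<le> 7 / freq n" by (rule inverse_le_freq[OF m]) (simp add: n_def)
  finally show "\<bar>s - amp n\<bar> \<le> 7 / freq n * amp n" unfolding eq[symmetric]
    by (rule close_of_power4_close[OF s amp_pos])
qed

text \<open>The power of \<open>- i\<close> unites the parities: it is real for even
  \<open>n\<close>, selecting the cosine that goes with \<open>psi n 0\<close>, and imaginary for
  odd \<open>n\<close>, selecting the sine that goes with the slope. The restriction on
  \<open>n\<close> guarantees \<open>1 \<le> m\<close> in the Wallis bounds.\<close>

lemma psi_initial:
  assumes "2 \<le> n"
  obtains s where "0 \<le> s" "\<bar>s - amp n\<bar> \<le> 7 / freq n * amp n"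
    "(psi n 0)\<^sup>2 + (dpsi n 0 / freq n)\<^sup>2 = s\<^sup>2"
    "\<And>u. psi n 0 * cos u + dpsi n 0 / freq n * sin u = s * Re (cis u * (- \<i>) ^ n)"
proof (cases "even n")
  case True
  then obtain m where n: "n = 2 * m" by blast
  have i: "(- \<i>) ^ n = complex_of_real ((-1) ^ m)" by (simp add: n power_mult)
  have d: "dpsi n 0 = 0" using psi_at_0(2)[of m] by (simp add: dpsi_def n)
  show ?thesis
  proof (rule that[of "rho m"])
    show "\<bar>rho m - amp n\<bar> \<le> 7 / freq n * amp n"
      unfolding n using assms by (intro psi_initial_even) (simp add: n)
    show "(psi n 0)\<^sup>2 + (dpsi n 0 / freq n)\<^sup>2 = (rho m)\<^sup>2"
      unfolding d unfolding n psi_at_0 by (simp add: power_mult_distrib flip: power_mult)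
    show "psi n 0 * cos u + dpsi n 0 / freq n * sin u = rho m * Re (cis u * (- \<i>) ^ n)" for u
      unfolding d i unfolding n psi_at_0 by (simp del: of_real_power)
  qed (rule rho_nonneg)
next
  case False
  then obtain m where n: "n = 2 * m + 1" using oddE by blast
  have i: "(- \<i>) ^ n = - \<i> * complex_of_real ((-1) ^ m)" by (simp add: n power_mult)
  have p: "psi n 0 = 0" using psi_at_0(2)[of m] by (simp add: n)
  have d: "dpsi n 0 = (-1) ^ m * (2 * hermite_a (2 * m) * rho m)"
  proof -
    have "dpsi n 0 = - 2 * hermite_a (2 * m + 1) * psi (2 * Suc m) 0" by (simp add: dpsi_def n)
    then show ?thesis unfolding psi_at_0 rho_def using hermite_a_pos[of "2 * m + 1"] by simp
  qed
  have m: "1 \<le> m" using assms n by simp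
  show ?thesis
  proof (rule that[of "2 * hermite_a (2 * m) * rho m / freq n"])
    show "0 \<le> 2 * hermite_a (2 * m) * rho m / freq n"
      "\<bar>2 * hermite_a (2 * m) * rho m / freq n - amp n\<bar> \<le> 7 / freq n * amp n"
      unfolding n by (rule psi_initial_odd[OF m])+
    show "(psi n 0)\<^sup>2 + (dpsi n 0 / freq n)\<^sup>2 = (2 * hermite_a (2 * m) * rho m / freq n)\<^sup>2"
      unfolding p d by (simp add: power_mult_distrib power_divide flip: power_mult)
    show "psi n 0 * cos u + dpsi n 0 / freq n * sin u = 2 * hermite_a (2 * m) * rho m / freq n * Re (cis u * (- \<i>) ^ n)" for u
      unfolding p d i by (simp del: of_real_power)
  qed
qed

lemma psi_asymptotic:
  assumes n: "2 \<le> n" "2 * R\<^sup>2 \<le> 2 * real n + 1" and x: "\<bar>x\<bar> \<le> R"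
  shows "\<bar>psi n x - amp n * Re (cis (freq n * x) * (- \<i>) ^ n)\<bar> \<le> (7 + 16 * R ^ 3) * amp n / freq n"
proof -
  obtain s where s: "0 \<le> s" "\<bar>s - amp n\<bar> \<le> 7 / freq n * amp n"
    "(psi n 0)\<^sup>2 + (dpsi n 0 / freq n)\<^sup>2 = s\<^sup>2"
    and ph: "\<And>u. psi n 0 * cos u + dpsi n 0 / freq n * sin u = s * Re (cis u * (- \<i>) ^ n)"
    using psi_initial[OF n(1)] by metis
  let ?P = "Re (cis (freq n * x) * (- \<i>) ^ n)"
  have w: "0 < freq n" using freq_ge_1[of n] by simp
  have R: "0 \<le> R" using x by linarith
  have a: "\<bar>psi n x - s * ?P\<bar> \<le> 2 * R ^ 3 * s / freq n"
    unfolding ph[symmetric]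
    by (rule oscillator_approx[OF psi_dpsi _ w _ s(1,3) x]) (use dpsi_deriv n(2) in \<open>simp_all add: freq_power2\<close>)
  have "7 / freq n * amp n \<le> 7 * amp n"
    using freq_ge_1[of n] amp_pos[of n] by (intro mult_right_mono) (auto simp: divide_le_eq)
  \<comment> \<open>From \<open>s \<le> amp n + 7 * amp n\<close>; this 8 turns the constant
    \<open>2 * R ^ 3\<close> of \<open>oscillator_approx\<close> into
    \<open>16 * R ^ 3\<close>.\<close>
  then have "s \<le> 8 * amp n" using s(2) by linarith
  then have "2 * R ^ 3 * s / freq n \<le> 2 * R ^ 3 * (8 * amp n) / freq n"
    using w R by (intro divide_right_mono mult_left_mono) auto
  moreover have "\<bar>s * ?P - amp n * ?P\<bar> \<le> 7 / freq n * amp n"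
  proof -
    have "\<bar>?P\<bar> \<le> cmod (cis (freq n * x) * (- \<i>) ^ n)" by (rule abs_Re_le_cmod)
    then have "\<bar>?P\<bar> \<le> 1" by (simp add: norm_mult norm_power)
    then have "\<bar>s - amp n\<bar> * \<bar>?P\<bar> \<le> (7 / freq n * amp n) * 1"
      using s(2) by (intro mult_mono) auto
    then show ?thesis by (simp add: left_diff_distrib flip: abs_mult)
  qed
  ultimately have "\<bar>psi n x - amp n * ?P\<bar> \<le> 2 * R ^ 3 * (8 * amp n) / freq n + 7 / freq n * amp n"
    using a by linarith
  also have "\<dots> = (7 + 16 * R ^ 3) * amp n / freq n"
    by (simp add: add_divide_distrib distrib_right)
  finally show ?thesis .
qed

section \<open>Comparison with the free evolution\<close>

lemma compactly_supported_decay: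
  fixes h :: "real \<Rightarrow> 'b::{banach, second_countable_topology}"
  assumes cont: "continuous_on UNIV h" and supp: "\<And>x. R < \<bar>x\<bar> \<Longrightarrow> h x = 0"
  obtains C where "0 \<le> C" "\<And>x. norm (h x) \<le> C" "integrable lborel h"
proof -
  have "compact (h ` {-R..R})"
    by (intro compact_continuous_image continuous_on_subset[OF cont]) auto
  then have "bounded (h ` {-R..R})" by (rule compact_imp_bounded)
  then obtain C where C: "\<And>x. x \<in> {-R..R} \<Longrightarrow> norm (h x) \<le> C" unfolding bounded_iff by blast
  have b: "norm (h x) \<le> \<bar>C\<bar>" for x
  proof (cases "R < \<bar>x\<bar>")
    case False
    then have "norm (h x) \<le> C" by (intro C) auto
    then show ?thesis by linarith
  qed (simp add: supp)
  have "integrable lborel h"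
  proof (rule integrable_of_decay[OF _ b])
    show "h \<in> borel_measurable borel" by (intro borel_measurable_continuous_onI cont)
    show "x\<^sup>2 * norm (h x) \<le> R\<^sup>2 * \<bar>C\<bar>" for x
    proof (cases "R < \<bar>x\<bar>")
      case True then show ?thesis by (simp add: supp)
    next
      case False
      then have "x\<^sup>2 \<le> R\<^sup>2" by (metis abs_ge_zero abs_le_square_iff abs_of_nonneg linorder_not_le order_trans)
      then show ?thesis using b[of x] by (intro mult_mono) auto
    qed
  qed
  then show ?thesis using b that[of "\<bar>C\<bar>"] by simp
qed

text \<open>One integration by parts: the constant is the integral of \<open>cmod (h' x)\<close>,
  and the boundary terms vanish by compact support.\<close>

lemma compactly_supported_oscillatory_integral:
  fixes h h' :: "real \<Rightarrow> complex"
  assumes der: "\<And>x. (h has_vector_derivative h' x) (at x)" and cont: "continuous_on UNIV h'"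
    and supp: "\<And>x. R < \<bar>x\<bar> \<Longrightarrow> h x = 0" "\<And>x. R < \<bar>x\<bar> \<Longrightarrow> h' x = 0"
  shows "\<exists>C. \<forall>s. \<bar>s\<bar> * cmod (\<integral>x. cis (- (s * x)) * h x \<partial>lborel) \<le> C"
proof (intro exI allI)
  fix s :: real
  have hc: "continuous_on UNIV h"
    using der by (meson continuous_at_imp_continuous_on has_vector_derivative_continuous)
  have cc: "continuous_on UNIV (\<lambda>x. cis (- (s * x)))" by (intro continuous_intros)
  have int: "integrable lborel (\<lambda>x. cis (- (s * x)) * k x)" if "continuous_on UNIV k" "\<And>x. R < \<bar>x\<bar> \<Longrightarrow> k x = 0" for k
  proof -
    have "continuous_on UNIV (\<lambda>x. cis (- (s * x)) * k x)" using that(1) cc by (intro continuous_on_mult)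
    from compactly_supported_decay[OF this, of R] that(2) show ?thesis by auto
  qed
  note i1 = int[OF hc supp(1)] and i2 = int[OF cont supp(2)]
  let ?F' = "\<lambda>x. cis (- (s * x)) * h' x + (- \<i> * of_real s) * (cis (- (s * x)) * h x)"
  have "(\<integral>x. ?F' x \<partial>lborel) = 0"
  proof (rule integral_derivative_eq_0)
    show "((\<lambda>x. cis (- (s * x)) * h x) has_vector_derivative ?F' x) (at x)" for x
    proof -
      from has_vector_derivative_mult[OF cis_linear_derivative[of s x] der[of x]]
      show ?thesis by (simp add: scaleR_conv_of_real mult_ac)
    qed
    show "isCont ?F' x" for x
      using hc cont cc by (intro continuous_intros) (auto simp: continuous_on_eq_continuous_at)
    show "integrable lborel ?F'" by (intro Bochner_Integration.integrable_add integrable_mult_right i1 i2)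
    have z: "cis (- (s * x)) * h x = 0" if "\<bar>R\<bar> < \<bar>x\<bar>" for x using supp(1)[of x] that by simp
    show "((\<lambda>x. cis (- (s * x)) * h x) \<longlongrightarrow> 0) at_top"
      by (rule tendsto_eventually, rule eventually_mono[OF eventually_gt_at_top[of "\<bar>R\<bar>"]]) (use z in auto)
    show "((\<lambda>x. cis (- (s * x)) * h x) \<longlongrightarrow> 0) at_bot"
      by (rule tendsto_eventually, rule eventually_mono[OF eventually_gt_at_bot[of "-\<bar>R\<bar>"]]) (use z in auto)
  qed
  then have "(\<integral>x. cis (- (s * x)) * h' x \<partial>lborel) = \<i> * of_real s * (\<integral>x. cis (- (s * x)) * h x \<partial>lborel)"
    using i1 i2 by simp
  then have "\<bar>s\<bar> * cmod (\<integral>x. cis (- (s * x)) * h x \<partial>lborel) = cmod (\<integral>x. cis (- (s * x)) * h' x \<partial>lborel)"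
    by (simp add: norm_mult)
  also have "\<dots> \<le> (\<integral>x. cmod (cis (- (s * x)) * h' x) \<partial>lborel)" by (rule integral_norm_bound)
  also have "\<dots> = (\<integral>x. cmod (h' x) \<partial>lborel)" by (simp add: norm_mult)
  finally show "\<bar>s\<bar> * cmod (\<integral>x. cis (- (s * x)) * h x \<partial>lborel) \<le> (\<integral>x. cmod (h' x) \<partial>lborel)" .
qed

lemma C0_infty_E:
  assumes "g \<in> C0_infty"
  obtains g' R where "\<And>x. (g has_vector_derivative g' x) (at x)" "continuous_on UNIV g'" "0 \<le> R"
    "\<And>x. R < \<bar>x\<bar> \<Longrightarrow> g x = 0" "\<And>x. R < \<bar>x\<bar> \<Longrightarrow> g' x = 0"
proof -
  obtain D :: "nat \<Rightarrow> real \<Rightarrow> complex" where D: "D 0 = g" "\<And>k x. (D k has_vector_derivative D (Suc k) x) (at x)"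
    and c: "compact (closure {x. g x \<noteq> 0})"
    using assms by (auto simp: C0_infty_def)
  have "bounded {x. g x \<noteq> 0}" using c compact_imp_bounded bounded_subset closure_subset by metis
  then obtain R where R: "\<And>x. g x \<noteq> 0 \<Longrightarrow> \<bar>x\<bar> \<le> R" unfolding bounded_iff by auto
  have g0: "g x = 0" if "\<bar>R\<bar> < \<bar>x\<bar>" for x using R[of x] that by force
  have dg: "(g has_vector_derivative D 1 x) (at x)" for x using D(2)[of 0 x] D(1) by simp
  have "D 1 x = 0" if x: "\<bar>R\<bar> < \<bar>x\<bar>" for x
  proof -
    have "((\<lambda>_. 0) has_vector_derivative D 1 x) (at x)"
    proof (rule has_vector_derivative_transform_within_open[OF dg])
      show "open {x. \<bar>R\<bar> < \<bar>x\<bar>}" by (intro open_Collect_less continuous_intros)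
    qed (use x g0 in auto)
    moreover have "((\<lambda>_. 0) has_vector_derivative 0) (at x)" by (rule has_vector_derivative_const)
    ultimately show ?thesis by (rule vector_derivative_unique_at)
  qed
  moreover have "continuous_on UNIV (D 1)"
    using D(2)[of 1] by (meson continuous_at_imp_continuous_on has_vector_derivative_continuous)
  ultimately show ?thesis using dg g0 that[of "D 1" "\<bar>R\<bar>"] by simp
qed

lemma fourier_eq: "fourier g s = complex_of_real ((2 * pi) powr (-1/2)) * (\<integral>x. cis (- (s * x)) * g x \<partial>lborel)"
  unfolding fourier_def cis_conv_exp by simp

lemma fourier_decay:
  assumes "g \<in> C0_infty" obtains C where "0 \<le> C" "\<And>s. \<bar>s\<bar> * cmod (fourier g s) \<le> C"
proof -
  from C0_infty_E[OF assms] obtain g' R where g: "\<And>x. (g has_vector_derivative g' x) (at x)" "continuous_on UNIV g'"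
    "\<And>x. R < \<bar>x\<bar> \<Longrightarrow> g x = 0" "\<And>x. R < \<bar>x\<bar> \<Longrightarrow> g' x = 0" by metis
  from compactly_supported_oscillatory_integral[OF this]
  obtain C where C: "\<And>s. \<bar>s\<bar> * cmod (\<integral>x. cis (- (s * x)) * g x \<partial>lborel) \<le> C" by blast
  have "\<bar>s\<bar> * cmod (fourier g s) \<le> (2 * pi) powr (-1/2) * C" for s
  proof -
    have "\<bar>s\<bar> * cmod (fourier g s) = (2 * pi) powr (-1/2) * (\<bar>s\<bar> * cmod (\<integral>x. cis (- (s * x)) * g x \<partial>lborel))"
      by (simp add: fourier_eq norm_mult)
    also have "\<dots> \<le> (2 * pi) powr (-1/2) * C" by (intro mult_left_mono C) auto
    finally show ?thesis .
  qed
  moreover have "0 \<le> C" using C[of 0] by simp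
  ultimately show ?thesis using that[of "(2 * pi) powr (-1/2) * C"] by simp
qed

text \<open>Integration by parts for the fixed function \<open>psi n * g\<close>. The constant
  depends on \<open>n\<close>, so this gives only the limit of each component; uniformity in
  \<open>n\<close> comes from \<open>component_error_bound\<close>.\<close>

lemma fcoef_modulate_decay:
  assumes "g \<in> C0_infty" obtains C where "\<And>t. \<bar>t\<bar> * cmod (fcoef (modulate t g) n) \<le> C"
proof -
  from C0_infty_E[OF assms] obtain g' R where g: "\<And>x. (g has_vector_derivative g' x) (at x)" "continuous_on UNIV g'"
    "\<And>x. R < \<bar>x\<bar> \<Longrightarrow> g x = 0" "\<And>x. R < \<bar>x\<bar> \<Longrightarrow> g' x = 0" by metis
  have gc: "continuous_on UNIV g"
    using g(1) by (meson continuous_at_imp_continuous_on has_vector_derivative_continuous)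
  have "\<exists>C. \<forall>s. \<bar>s\<bar> * cmod (\<integral>x. cis (- (s * x)) * (complex_of_real (psi n x) * g x) \<partial>lborel) \<le> C"
  proof (rule compactly_supported_oscillatory_integral)
    show "((\<lambda>x. complex_of_real (psi n x) * g x) has_vector_derivative
        complex_of_real (psi n x) * g' x + complex_of_real (dpsi n x) * g x) (at x)" for x
      by (intro has_vector_derivative_mult has_vector_derivative_of_real g psi_dpsi)
    show "continuous_on UNIV (\<lambda>x. complex_of_real (psi n x) * g' x + complex_of_real (dpsi n x) * g x)"
      unfolding dpsi_def by (intro continuous_intros g gc)
  qed (use g in auto)
  then show ?thesis using that unfolding fcoef_def modulate_def by (auto simp: mult_ac)
qed

lemma amp_fourier_constant: "amp n / 2 = (2 * real n + 1) powr (-1/4) * (2 * pi) powr (-1/2)"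
proof -
  have "(2 * pi) powr (-1/2) = inverse (sqrt (2 * pi))"
    by (simp add: powr_minus powr_half_sqrt)
  moreover have "sqrt (2 / pi) / 2 = inverse (sqrt (2 * pi))"
  proof -
    have "sqrt (2 / pi) = sqrt (2 * 2 / (2 * pi))" by simp
    also have "\<dots> = 2 / sqrt (2 * pi)" by (simp only: real_sqrt_divide real_sqrt_mult_self) simp
    finally show ?thesis by (simp add: inverse_eq_divide)
  qed
  ultimately show ?thesis by (simp add: amp_def)
qed

lemma amp_le_1: "amp n \<le> 1"
proof -
  have "amp n ^ 4 \<le> 1"
  proof -
    have "4 \<le> pi\<^sup>2" using pi_gt3 power_mono[of 2 pi 2] by simp
    then have "4 * 1 \<le> pi\<^sup>2 * (2 * real n + 1)" by (intro mult_mono) auto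
    then show ?thesis unfolding amp_power4 by simp
  qed
  then show ?thesis using power_mono_iff[of "amp n" 1 4] amp_pos[of n] by simp
qed

text \<open>The real part is half the sum of a number and its conjugate, so the approximating wave
  splits into two plane waves of frequencies \<open>freq n\<close> and \<open>- freq n\<close>, each
  producing one shifted Fourier transform.\<close>

lemma integral_plane_waves:
  assumes g: "integrable lborel g"
  shows "(\<integral>x. complex_of_real (amp n * Re (cis (freq n * x) * (- \<i>) ^ n)) * (cis (- (t * x)) * g x) \<partial>lborel)
    = complex_of_real ((2 * real n + 1) powr (-1/4)) * ((- \<i>) ^ n * fourier g (t - freq n) + \<i> ^ n * fourier g (t + freq n))"
proof -
  let ?e = "\<lambda>s x. cis (- (s * x)) * g x"
  have gm [measurable]: "g \<in> borel_measurable borel" using g by auto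
  have int: "integrable lborel (?e s)" for s
  proof (rule Bochner_Integration.integrable_bound[OF g])
    show "?e s \<in> borel_measurable lborel" using measurable_cis[of "- s"] gm by simp
  qed (simp add: norm_mult)
  have eq: "complex_of_real (amp n * Re (cis (freq n * x) * (- \<i>) ^ n)) * (cis (- (t * x)) * g x)
     = complex_of_real (amp n / 2) * (- \<i>) ^ n * ?e (t - freq n) x + complex_of_real (amp n / 2) * \<i> ^ n * ?e (t + freq n) x" for x
  proof -
    let ?z = "cis (freq n * x) * (- \<i>) ^ n"
    have "complex_of_real (a * Re z) = complex_of_real (a / 2) * (z + cnj z)" for a z
      by (simp add: complex_add_cnj)
    then have "complex_of_real (amp n * Re ?z) = complex_of_real (amp n / 2) * (?z + cnj ?z)" .
    also have "cnj ?z = cis (- (freq n * x)) * \<i> ^ n" by (simp add: cis_cnj)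
    finally have a: "complex_of_real (amp n * Re ?z) = complex_of_real (amp n / 2) * (?z + cis (- (freq n * x)) * \<i> ^ n)" .
    have b: "cis (freq n * x) * cis (- (t * x)) = cis (- ((t - freq n) * x))"
      "cis (- (freq n * x)) * cis (- (t * x)) = cis (- ((t + freq n) * x))"
      by (simp_all add: cis_mult algebra_simps)
    show ?thesis unfolding a b[symmetric] by (simp add: algebra_simps)
  qed
  have "(\<integral>x. complex_of_real (amp n * Re (cis (freq n * x) * (- \<i>) ^ n)) * (cis (- (t * x)) * g x) \<partial>lborel)
     = complex_of_real (amp n / 2) * (- \<i>) ^ n * (\<integral>x. ?e (t - freq n) x \<partial>lborel) + complex_of_real (amp n / 2) * \<i> ^ n * (\<integral>x. ?e (t + freq n) x \<partial>lborel)"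
    unfolding eq using int by (simp del: of_real_divide)
  then show ?thesis unfolding amp_fourier_constant fourier_eq by (simp add: algebra_simps)
qed

lemma U_asymp_eq:
  "U_asymp t g n = complex_of_real ((2 * real n + 1) powr (-1/4)) *
     (if t > 0 then (- \<i>) ^ n * fourier g (t - freq n) else \<i> ^ n * fourier g (t + freq n))"
proof -
  have "\<i> powi (- int n) = (- \<i>) ^ n" by (simp add: power_int_minus power_inverse[symmetric])
  moreover have "\<i> powi (int n) = \<i> ^ n" by simp
  ultimately show ?thesis by (simp add: U_asymp_def freq_def mult_ac)
qed

text \<open>The wave travelling in the other direction has \<open>\<bar>t \<plusminus> freq n\<bar> \<ge> freq n\<close>, so it is absorbed by the
  same bound as the error of the Hermite asymptotics.\<close>

lemma component_error_bound:
  assumes gL: "g \<in> L2_fun" and g: "g \<in> C0_infty"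
  obtains C N where "\<And>n t. N \<le> n \<Longrightarrow> t \<noteq> 0 \<Longrightarrow>
    cmod (fcoef (modulate t g) n - U_asymp t g n) \<le> C * ((2 * real n + 1) powr (-1/4) / freq n)"
proof -
  obtain g' R where g': "\<And>x. (g has_vector_derivative g' x) (at x)" and R: "0 \<le> R" "\<And>x. R < \<bar>x\<bar> \<Longrightarrow> g x = 0"
    using C0_infty_E[OF g] by metis
  have gc: "continuous_on UNIV g"
    using g' by (meson continuous_at_imp_continuous_on has_vector_derivative_continuous)
  have gi: "integrable lborel g" using compactly_supported_decay[OF gc R(2)] by metis
  have gm [measurable]: "g \<in> borel_measurable borel" using gi by auto
  obtain C0 where C0: "0 \<le> C0" "\<And>s. \<bar>s\<bar> * cmod (fourier g s) \<le> C0" using fourier_decay[OF g] by metis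
  define I where "I = (\<integral>x. cmod (g x) \<partial>lborel)"
  have I: "0 \<le> I" by (simp add: I_def)
  define K where "K = 7 + 16 * R ^ 3"
  have K: "0 \<le> K" using R(1) by (simp add: K_def)
  obtain N0 :: nat where N0: "R\<^sup>2 \<le> real N0" using real_arch_simple by blast
  show ?thesis
  \<comment> \<open>The threshold meets both conditions on \<open>n\<close> in
    \<open>psi_asymptotic\<close>; \<open>K * I\<close> comes from integrating its error against
    \<open>g\<close>, and \<open>C0\<close> from the wave missing in \<open>U_asymp\<close>.\<close>
  proof (rule that[of "max 2 N0" "K * I + C0"])
    fix n t assume n: "max 2 N0 \<le> n" and t: "t \<noteq> (0::real)"
    let ?b = "(2 * real n + 1) powr (-1/4)"
    let ?m = "\<lambda>x. amp n * Re (cis (freq n * x) * (- \<i>) ^ n)"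
    let ?w = "\<lambda>x. cis (- (t * x)) * g x"
    have w0: "0 < freq n" using freq_ge_1[of n] by simp
    have ab: "amp n \<le> ?b"
    proof -
      have "sqrt (2 / pi) \<le> 1" using pi_ge_two by simp
      then show ?thesis unfolding amp_def using mult_right_mono[of "sqrt (2 / pi)" 1 ?b] by simp
    qed
    have n2: "2 \<le> n" "2 * R\<^sup>2 \<le> 2 * real n + 1" using n N0 by auto
    have wm: "?w \<in> borel_measurable lborel" using measurable_cis[of "- t"] gm by simp
    have i1: "integrable lborel (\<lambda>x. complex_of_real (psi n x) * ?w x)"
      using integrable_psi_L2[OF modulate_L2[OF gL]] by (simp add: modulate_def)
    have i2: "integrable lborel (\<lambda>x. complex_of_real (?m x) * ?w x)"
    proof (rule Bochner_Integration.integrable_bound[OF gi])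
      have "continuous_on UNIV (\<lambda>x. complex_of_real (?m x))" by (intro continuous_intros)
      then have "(\<lambda>x. complex_of_real (?m x)) \<in> borel_measurable borel" by (rule borel_measurable_continuous_onI)
      then show "(\<lambda>x. complex_of_real (?m x) * ?w x) \<in> borel_measurable lborel"
        using wm by simp
      show "AE x in lborel. norm (complex_of_real (?m x) * ?w x) \<le> norm (g x)"
      proof (rule AE_I2)
        fix x
        have "\<bar>Re (cis (freq n * x) * (- \<i>) ^ n)\<bar> \<le> cmod (cis (freq n * x) * (- \<i>) ^ n)" by (rule abs_Re_le_cmod)
        then have "\<bar>Re (cis (freq n * x) * (- \<i>) ^ n)\<bar> \<le> 1" by (simp only: norm_mult norm_power norm_cis norm_minus_cancel norm_ii power_one mult_1)
        then have "\<bar>?m x\<bar> \<le> 1 * 1" unfolding abs_mult using amp_le_1[of n] amp_pos[of n] by (intro mult_mono) auto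
        then show "norm (complex_of_real (?m x) * ?w x) \<le> norm (g x)"
          unfolding norm_mult norm_of_real norm_cis mult_1 using mult_right_mono[of "\<bar>?m x\<bar>" 1 "cmod (g x)"] by simp
      qed
    qed
    have "fcoef (modulate t g) n - ?b * ((- \<i>) ^ n * fourier g (t - freq n) + \<i> ^ n * fourier g (t + freq n))
       = (\<integral>x. complex_of_real (psi n x) * ?w x - complex_of_real (?m x) * ?w x \<partial>lborel)"
      unfolding integral_plane_waves[OF gi, symmetric] Bochner_Integration.integral_diff[OF i1 i2] fcoef_def modulate_def ..
    also have "cmod \<dots> \<le> (\<integral>x. (K * amp n / freq n) * cmod (g x) \<partial>lborel)"
    proof (rule Bochner_Integration.integral_norm_bound_integral)
      fix x
      show "cmod (complex_of_real (psi n x) * ?w x - complex_of_real (?m x) * ?w x) \<le> (K * amp n / freq n) * cmod (g x)"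
      proof (cases "R < \<bar>x\<bar>")
        case True then show ?thesis by (simp add: R(2))
      next
        case False
        then have "\<bar>psi n x - ?m x\<bar> \<le> K * amp n / freq n"
          unfolding K_def by (intro psi_asymptotic n2) simp
        moreover have "complex_of_real (psi n x) * ?w x - complex_of_real (?m x) * ?w x = complex_of_real (psi n x - ?m x) * ?w x"
          by (simp only: of_real_diff left_diff_distrib)
        ultimately show ?thesis
          by (simp only: norm_mult norm_of_real norm_cis mult_1) (intro mult_right_mono, simp_all)
      qed
    qed (use i1 i2 gi in auto)
    also have "\<dots> = K * I * (amp n / freq n)" by (simp add: I_def)
    also have "\<dots> \<le> K * I * (?b / freq n)"
      using ab w0 K I by (intro mult_left_mono divide_right_mono) auto
    finally have main: "cmod (fcoef (modulate t g) n - ?b * ((- \<i>) ^ n * fourier g (t - freq n) + \<i> ^ n * fourier g (t + freq n))) \<le> K * I * (?b / freq n)" .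
    have far: "cmod (fourier g s) \<le> C0 / freq n" if "freq n \<le> \<bar>s\<bar>" for s
    proof -
      have "freq n * cmod (fourier g s) \<le> \<bar>s\<bar> * cmod (fourier g s)" using that by (intro mult_right_mono) auto
      also have "\<dots> \<le> C0" by (rule C0)
      finally show ?thesis using w0 by (simp add: pos_le_divide_eq mult.commute)
    qed
    define v where "v = (if t > 0 then \<i> ^ n * fourier g (t + freq n) else (- \<i>) ^ n * fourier g (t - freq n))"
    have v: "cmod v \<le> C0 / freq n"
      using far[of "t + freq n"] far[of "t - freq n"] t w0 by (auto simp: v_def norm_mult norm_power)
    have "fcoef (modulate t g) n - U_asymp t g n =
      (fcoef (modulate t g) n - ?b * ((- \<i>) ^ n * fourier g (t - freq n) + \<i> ^ n * fourier g (t + freq n))) + ?b * v"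
      by (simp add: U_asymp_eq v_def algebra_simps)
    then have "cmod (fcoef (modulate t g) n - U_asymp t g n) \<le>
      cmod (fcoef (modulate t g) n - ?b * ((- \<i>) ^ n * fourier g (t - freq n) + \<i> ^ n * fourier g (t + freq n))) + cmod (?b * v)"
      by (simp only: norm_triangle_ineq)
    also have "cmod (complex_of_real ?b * v) \<le> C0 * (?b / freq n)"
    proof -
      have "cmod (complex_of_real ?b * v) = ?b * cmod v" by (simp add: norm_mult)
      also have "\<dots> \<le> ?b * (C0 / freq n)" by (intro mult_left_mono v) simp
      finally show ?thesis by (simp add: mult_ac)
    qed
    finally show "cmod (fcoef (modulate t g) n - U_asymp t g n) \<le> (K * I + C0) * (?b / freq n)"
      using main unfolding distrib_right by linarith
  qed
qed

section \<open>The summable majorant and the passage to the limit\<close>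

lemma summable_error_bound: "summable (\<lambda>n. (C * ((2 * real n + 1) powr (-1/4) / freq n))\<^sup>2)"
proof -
  have eq: "(C * ((2 * real n + 1) powr (-1/4) / freq n))\<^sup>2 = C\<^sup>2 * (2 * real n + 1) powr (-3/2)" for n
  proof -
    have p: "0 < 2 * real n + 1" by simp
    have "((2 * real n + 1) powr (-1/4))\<^sup>2 = (2 * real n + 1) powr (-1/2)"
      using p by (simp add: powr_power)
    moreover have "1 / (freq n)\<^sup>2 = (2 * real n + 1) powr (-1)"
      unfolding freq_power2 using p by (simp add: powr_minus divide_inverse)
    ultimately have h: "((2 * real n + 1) powr (-1/4) / freq n)\<^sup>2 = (2 * real n + 1) powr (-1/2) * (2 * real n + 1) powr (-1)"
      unfolding power_divide by (metis mult.right_neutral times_divide_eq_right)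
    show ?thesis unfolding power_mult_distrib h powr_add[symmetric] by simp
  qed
  have "summable (\<lambda>n. (2 * real n + 1) powr (-3/2))"
  proof (rule summable_comparison_test_ev)
    show "summable (\<lambda>n. real n powr (-3/2))" by (simp add: summable_real_powr_iff)
    show "\<forall>\<^sub>F n in sequentially. norm ((2 * real n + 1) powr (-3/2)) \<le> real n powr (-3/2)"
      using eventually_gt_at_top[of 0]
      by eventually_elim (auto intro!: powr_mono2')
  qed
  then show ?thesis unfolding eq by (rule summable_mult)
qed

text \<open>Stated for any filter along which \<open>\<bar>t\<bar>\<close> tends to infinity, so
  that one argument covers both time directions. For fixed \<open>n\<close> both terms tend to 0
  separately.\<close>

lemma component_error_tendsto_0:
  assumes g: "g \<in> C0_infty" and F: "filterlim (\<lambda>t::real. t) at_infinity F"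
  shows "((\<lambda>t. fcoef (modulate t g) n - U_asymp t g n) \<longlongrightarrow> 0) F"
proof -
  have dec: "((\<lambda>t. u (t + c)) \<longlongrightarrow> 0) F" if "\<And>s. \<bar>s\<bar> * cmod (u s) \<le> C" for u :: "real \<Rightarrow> complex" and c C
  proof (rule Lim_null_comparison)
    have l: "filterlim (\<lambda>t. t + c) at_infinity F"
      using tendsto_add_filterlim_at_infinity[OF tendsto_const[of c] F] by (simp add: add.commute)
    show "((\<lambda>t. C / norm (t + c)) \<longlongrightarrow> 0) F"
      by (intro tendsto_divide_0[OF tendsto_const] filterlim_at_top_imp_at_infinity
          filterlim_compose[OF filterlim_norm_at_top l])
    have "\<forall>\<^sub>F t in F. 1 \<le> norm (t + c)"
      using l unfolding filterlim_at_infinity[of 0, OF order_refl] by (metis zero_less_one)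
    then show "\<forall>\<^sub>F t in F. norm (u (t + c)) \<le> C / norm (t + c)"
    proof eventually_elim
      fix t assume "1 \<le> norm (t + c)"
      then have "0 < \<bar>t + c\<bar>" by simp
      then show "norm (u (t + c)) \<le> C / norm (t + c)"
        using that[of "t + c"] by (simp add: pos_le_divide_eq mult.commute)
    qed
  qed
  obtain C0 where C0: "\<And>s. \<bar>s\<bar> * cmod (fourier g s) \<le> C0" using fourier_decay[OF g] by metis
  obtain C1 where C1: "\<And>s. \<bar>s\<bar> * cmod (fcoef (modulate s g) n) \<le> C1" using fcoef_modulate_decay[OF g] by metis
  let ?b = "complex_of_real ((2 * real n + 1) powr (-1/4))"
  have a: "((\<lambda>t. fcoef (modulate t g) n) \<longlongrightarrow> 0) F" using dec[OF C1, of 0] by simp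
  have f: "((\<lambda>t. fourier g (t - freq n)) \<longlongrightarrow> 0) F" "((\<lambda>t. fourier g (t + freq n)) \<longlongrightarrow> 0) F"
    using dec[OF C0, of "- freq n"] dec[OF C0, of "freq n"] by simp_all
  \<comment> \<open>Adding the moduli of both branches gives a majorant that does not depend on the
    sign of \<open>t\<close>.\<close>
  have "((\<lambda>t. U_asymp t g n) \<longlongrightarrow> 0) F"
  proof (rule Lim_null_comparison)
    have "((\<lambda>t. cmod ?b * (cmod (fourier g (t - freq n)) + cmod (fourier g (t + freq n)))) \<longlongrightarrow> cmod ?b * (cmod 0 + cmod 0)) F"
      by (intro tendsto_intros f)
    then show "((\<lambda>t. cmod ?b * (cmod (fourier g (t - freq n)) + cmod (fourier g (t + freq n)))) \<longlongrightarrow> 0) F" by simp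
    show "\<forall>\<^sub>F t in F. norm (U_asymp t g n) \<le> cmod ?b * (cmod (fourier g (t - freq n)) + cmod (fourier g (t + freq n)))"
      unfolding U_asymp_eq by (intro always_eventually allI) (auto simp: norm_mult norm_power intro!: mult_left_mono)
  qed
  from tendsto_diff[OF a this] show ?thesis by simp
qed

lemma error_tendsto_0:
  assumes gL: "g \<in> L2_fun" and g: "g \<in> C0_infty" and F: "filterlim (\<lambda>t::real. t) at_infinity F"
  shows "((\<lambda>t. ell2_norm (\<lambda>n. fcoef (modulate t g) n - U_asymp t g n)) \<longlongrightarrow> 0) F"
proof (cases "F = bot")
  case False
  obtain C N where CN: "\<And>n t. N \<le> n \<Longrightarrow> t \<noteq> 0 \<Longrightarrow>
    cmod (fcoef (modulate t g) n - U_asymp t g n) \<le> C * ((2 * real n + 1) powr (-1/4) / freq n)"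
    using component_error_bound[OF gL g] by metis
  have sq: "norm ((cmod (fcoef (modulate t g) n - U_asymp t g n))\<^sup>2) \<le> (C * ((2 * real n + 1) powr (-1/4) / freq n))\<^sup>2"
    if "N \<le> n" "t \<noteq> 0" for n t
    unfolding real_norm_def abs_power2 by (intro power_mono CN that norm_ge_zero)
  have t0: "\<forall>\<^sub>F t in F. t \<noteq> 0"
  proof -
    have "\<forall>\<^sub>F t in F. 1 \<le> norm t"
      using F unfolding filterlim_at_infinity[of 0, OF order_refl] by (metis zero_less_one)
    then show ?thesis by eventually_elim auto
  qed
  have "((\<lambda>t. \<Sum>n. (cmod (fcoef (modulate t g) n - U_asymp t g n))\<^sup>2) \<longlongrightarrow> (\<Sum>n::nat. 0)) F"
  \<comment> \<open>Domination is required only for eventually all \<open>n\<close> and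
    \<open>t\<close>, so the finitely many indices below \<open>N\<close>, where the asymptotic
    bound says nothing, do not interfere.\<close>
  proof (rule tannerys_theorem[THEN conjunct2, THEN conjunct2])
    show "((\<lambda>t. (cmod (fcoef (modulate t g) n - U_asymp t g n))\<^sup>2) \<longlongrightarrow> 0) F" for n
    proof -
      have "((\<lambda>t. (cmod (fcoef (modulate t g) n - U_asymp t g n))\<^sup>2) \<longlongrightarrow> (cmod 0)\<^sup>2) F"
        by (intro tendsto_intros component_error_tendsto_0 g F)
      then show ?thesis by simp
    qed
    show "\<forall>\<^sub>F (n, t) in sequentially \<times>\<^sub>F F. norm ((cmod (fcoef (modulate t g) n - U_asymp t g n))\<^sup>2)
       \<le> (C * ((2 * real n + 1) powr (-1/4) / freq n))\<^sup>2"
      unfolding eventually_prod_filter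
    proof (intro exI conjI)
      show "\<forall>\<^sub>F n in sequentially. N \<le> n" by (rule eventually_ge_at_top)
      show "\<forall>\<^sub>F t in F. t \<noteq> 0" by (rule t0)
    qed (use sq in auto)
  qed (use summable_error_bound False in auto)
  then have "((\<lambda>t. sqrt (\<Sum>n. (cmod (fcoef (modulate t g) n - U_asymp t g n))\<^sup>2)) \<longlongrightarrow> sqrt 0) F"
    by (intro tendsto_real_sqrt) simp
  then show ?thesis by (simp add: ell2_norm_def)
qed simp

text \<open>\<open>ell2_norm\<close> is meaningful only on \<open>ell2\<close>, so the limit
  statements have content only together with this membership. It is proved for the difference
  directly, by the same majorant.\<close>

lemma error_ell2:
  assumes gL: "g \<in> L2_fun" and g: "g \<in> C0_infty" and t: "t \<noteq> 0"
  shows "(\<lambda>n. fcoef (modulate t g) n - U_asymp t g n) \<in> ell2"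
proof -
  obtain C N where CN: "\<And>n t. N \<le> n \<Longrightarrow> t \<noteq> 0 \<Longrightarrow>
    cmod (fcoef (modulate t g) n - U_asymp t g n) \<le> C * ((2 * real n + 1) powr (-1/4) / freq n)"
    using component_error_bound[OF gL g] by metis
  have sq: "norm ((cmod (fcoef (modulate t g) n - U_asymp t g n))\<^sup>2) \<le> (C * ((2 * real n + 1) powr (-1/4) / freq n))\<^sup>2"
    if "N \<le> n" "t \<noteq> 0" for n t
    unfolding real_norm_def abs_power2 by (intro power_mono CN that norm_ge_zero)
  have "summable (\<lambda>n. (cmod (fcoef (modulate t g) n - U_asymp t g n))\<^sup>2)"
  proof (rule summable_comparison_test_ev[OF _ summable_error_bound])
    show "\<forall>\<^sub>F n in sequentially. norm ((cmod (fcoef (modulate t g) n - U_asymp t g n))\<^sup>2)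
       \<le> (C * ((2 * real n + 1) powr (-1/4) / freq n))\<^sup>2"
      using eventually_ge_at_top[of N] by eventually_elim (rule sq[OF _ t])
  qed
  then show ?thesis by (simp add: ell2_def)
qed

theorem theorem4p10:
  fixes f :: "nat \<Rightarrow> complex" and g :: "real \<Rightarrow> complex"
  assumes "f \<in> ell2"
    and "g \<in> Phi f"
    and "g \<in> C0_infty"
  shows "(\<forall>t. t \<noteq> 0 \<longrightarrow> (\<lambda>n. exp_group hermite_J t f n - U_asymp t g n) \<in> ell2) \<and>
    ((\<lambda>t. ell2_norm (\<lambda>n. exp_group hermite_J t f n - U_asymp t g n)) \<longlongrightarrow> 0) at_top \<and>
    ((\<lambda>t. ell2_norm (\<lambda>n. exp_group hermite_J t f n - U_asymp t g n)) \<longlongrightarrow> 0) at_bot"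
proof -
  have gL: "g \<in> L2_fun" using assms(2) by (simp add: Phi_def)
  have "filterlim (\<lambda>t::real. t) at_infinity at_top" "filterlim (\<lambda>t::real. t) at_infinity at_bot"
    by (simp_all add: filterlim_def at_top_le_at_infinity at_bot_le_at_infinity)
  then show ?thesis
    unfolding exp_group_hermite_J[OF assms(1)] propagator_eq_fcoef[OF assms(1,2)]
    using error_ell2[OF gL assms(3)] error_tendsto_0[OF gL assms(3)] by blast
qed

end
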